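(* Let $N\ge1$, $k\ge1$ be integers, let $m>0$, and let $F:[0,+\infty)^k\to\mathbb{R}$ be upper semicontinuous and nondecreasing in each variable. Then the problem $$\max\Big\{F(\mu_1(\overline\rho),\dots,\mu_k(\overline\rho)):\ \overline\rho=\rho_1\sqcup\rho_2\sqcup\dots\sqcup\rho_k,\ \rho_i:\mathbb{R}^N\to[0,1],\ \sum_{i=1}^k\int_{\mathbb{R}^N}\rho_i\,dx=m\Big\}$$ has a solution, i.e. the maximum is attained.
   Context: For a measurable $\rho:\mathbb{R}^N\to[0,1]$ with $0<\int_{\mathbb{R}^N}\rho\,dx<+\infty$ and an integer $k\ge 0$, $$\mu_k(\rho):=\inf_{S\in\mathcal{S}_{k+1}}\ \max_{u\in S\setminus\{0\}}\frac{\int_{\mathbb{R}^N}\rho|\nabla u|^2dx}{\int_{\mathbb{R}^N}\rho u^2dx},$$ where $\mathcal{S}_{k+1}$ is the family of all linear subspaces of dimension $k+1$ of $\{u\cdot 1_{\{\rho>0\}}:u\in C_c^\infty(\mathbb{R}^N)\}$ (functions identified when equal almost everywhere; $\nabla u$ is the gradient of the smooth function $u$, which on $\{\rho>0\}$ depends only on $u\cdot 1_{\{\rho>0\}}$ up to null sets). By convention, if $\rho=0$ a.e. then $\mu_k(\rho)=+\infty$ for all $k\ge0$. A collection $\overline\rho=\rho_1\sqcup\dots\sqcup\rho_j$ is a formal finite family of densities. Its eigenvalues $\mu_0(\overline\rho)\le\mu_1(\overline\rho)\le\dots$ are obtained by taking the union, with multiplicity, of the sequences $(\mu_l(\rho_i))_{l\ge0}$,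 $i=1,\dots,j$, and relabeling in nondecreasing order: $\mu_k(\overline\rho)$ is the $(k+1)$-st smallest element of this multiset. Zero densities (all of whose eigenvalues are $+\infty$) are allowed in the collection and do not contribute. *)

theory Defs
  imports "HOL-Analysis.Analysis"
begin

text \<open>Real functions modulo equality almost everywhere, as a real vector space.\<close>

quotient_type (overloaded) 'a ae_fun = "'a::euclidean_space \<Rightarrow> real" /
  "\<lambda>f g. AE x in lebesgue. f x = g x"
  morphisms rep_ae_fun ae_class
proof (rule equivpI)
  show "reflp (\<lambda>f g::'a \<Rightarrow> real. AE x in lebesgue. f x = g x)"
    by (rule reflpI) simp
  show "symp (\<lambda>f g::'a \<Rightarrow> real. AE x in lebesgue. f x = g x)"
    by (rule sympI) (simp add: eq_commute)
  show "transp (\<lambda>f g::'a \<Rightarrow> real. AE x in lebesgue. f x = g x)"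
  proof (rule transpI)
    fix f g h :: "'a \<Rightarrow> real"
    assume "AE x in lebesgue. f x = g x" "AE x in lebesgue. g x = h x"
    then show "AE x in lebesgue. f x = h x"
      by eventually_elim simp
  qed
qed

instantiation ae_fun :: (euclidean_space) real_vector
begin

lift_definition zero_ae_fun :: "'a ae_fun" is "\<lambda>_. 0" .

lift_definition plus_ae_fun :: "'a ae_fun \<Rightarrow> 'a ae_fun \<Rightarrow> 'a ae_fun" is "\<lambda>f g x. f x + g x"
  subgoal premises prems for f f' g g'
    using prems by eventually_elim simp
  done

lift_definition minus_ae_fun :: "'a ae_fun \<Rightarrow> 'a ae_fun \<Rightarrow> 'a ae_fun" is "\<lambda>f g x. f x - g x"
  subgoal premises prems for f f' g g'
    using prems by eventually_elim simp
  done

lift_definition uminus_ae_fun :: "'a ae_fun \<Rightarrow> 'a ae_fun" is "\<lambda>f x. - f x"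
  subgoal premises prems for f f'
    using prems by eventually_elim simp
  done

lift_definition scaleR_ae_fun :: "real \<Rightarrow> 'a ae_fun \<Rightarrow> 'a ae_fun" is "\<lambda>c f x. c * f x"
  subgoal premises prems for c f f'
    using prems by eventually_elim simp
  done

instance
  by standard (transfer; simp add: algebra_simps)+

end

primrec Ck :: "nat \<Rightarrow> ('a::euclidean_space \<Rightarrow> real) \<Rightarrow> bool" where
  "Ck 0 u \<longleftrightarrow> continuous_on UNIV u"
| "Ck (Suc n) u \<longleftrightarrow> (\<forall>x. u differentiable (at x)) \<and>
     (\<forall>b\<in>Basis. Ck n (\<lambda>x. frechet_derivative u (at x) b))"

definition test_functions :: "('a::euclidean_space \<Rightarrow> real) set" where
  "test_functions = {u. (\<forall>n. Ck n u) \<and> compact (closure {x. u x \<noteq> 0})}"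

definition gradient :: "('a::euclidean_space \<Rightarrow> real) \<Rightarrow> 'a \<Rightarrow> 'a" where
  "gradient u x = (\<Sum>b\<in>Basis. frechet_derivative u (at x) b *\<^sub>R b)"

definition restr :: "('a::euclidean_space \<Rightarrow> real) \<Rightarrow> ('a \<Rightarrow> real) \<Rightarrow> 'a ae_fun" where
  "restr \<rho> u = ae_class (\<lambda>x. u x * indicator {y. \<rho> y > 0} x)"

definition subspaces :: "('a::euclidean_space \<Rightarrow> real) \<Rightarrow> nat \<Rightarrow> 'a ae_fun set set" where
  "subspaces \<rho> d = {S. subspace S \<and> dim S = d \<and> S \<subseteq> restr \<rho> ` test_functions}"

definition rayleigh :: "('a::euclidean_space \<Rightarrow> real) \<Rightarrow> ('a \<Rightarrow> real) \<Rightarrow> real" where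
  "rayleigh \<rho> u = (\<integral>x. \<rho> x * (norm (gradient u x))\<^sup>2 \<partial>lebesgue) / (\<integral>x. \<rho> x * (u x)\<^sup>2 \<partial>lebesgue)"

text \<open>The subspaces are only used in dimension at least 1, where \<^const>\<open>dim\<close> (which is 0 in
  infinite dimension) excludes the infinite-dimensional ones. The supremum is over all smooth
  representatives \<open>u\<close> of the nonzero elements of \<open>S\<close>; the quotient depends only on the class of
  \<open>u\<close>, and the supremum is attained because \<open>S\<close> is finite-dimensional.\<close>

definition mu :: "nat \<Rightarrow> ('a::euclidean_space \<Rightarrow> real) \<Rightarrow> ennreal" where
  "mu k \<rho> = (if AE x in lebesgue. \<rho> x = 0 then \<infinity>
     else (INF S\<in>subspaces \<rho> (Suc k).
             SUP u\<in>{u \<in> test_functions. restr \<rho> u \<in> S - {0}}. ennreal (rayleigh \<rho> u)))"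

text \<open>The collection \<open>\<rho>\<^sub>1 \<squnion> \<dots> \<squnion> \<rho>\<^sub>j\<close> is the list of the \<open>\<rho>\<^sub>i\<close>. The multiset of its
  eigenvalues is indexed by the pairs \<open>(i, l)\<close>; its \<open>(n+1)\<close>-st smallest element is the least \<open>t\<close>
  such that at least \<open>n+1\<close> members, counted with multiplicity, are \<open>\<le> t\<close>. The least such \<open>t\<close>
  exists as \<open>mu l (\<rho> ! i)\<close> is nondecreasing in \<open>l\<close>. (A sorted list or a library multiset
  would not do: the family is infinite and an eigenvalue may have infinite multiplicity.)\<close>

definition collection_mu :: "nat \<Rightarrow> ('a::euclidean_space \<Rightarrow> real) list \<Rightarrow> ennreal" where
  "collection_mu n \<rho> = Inf {t. \<exists>A \<subseteq> {..<length \<rho>} \<times> UNIV. card A = Suc n \<and>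
     (\<forall>(i, l)\<in>A. mu l (\<rho> ! i) \<le> t)}"

definition admissible :: "nat \<Rightarrow> real \<Rightarrow> ('a::euclidean_space \<Rightarrow> real) list set" where
  "admissible k m = {\<rho>. length \<rho> = k \<and>
     (\<forall>r\<in>set \<rho>. r \<in> borel_measurable lebesgue \<and> (\<forall>x. 0 \<le> r x \<and> r x \<le> 1)) \<and>
     (\<Sum>r\<leftarrow>\<rho>. \<integral>\<^sup>+x. ennreal (r x) \<partial>lebesgue) = ennreal m}"

text \<open>The vector \<open>(\<mu>\<^sub>1, \<dots>, \<mu>\<^sub>k)\<close>, as an extensional function on \<open>{1..k}\<close>. On an admissible
  collection of positive mass the entries are finite: some \<open>\<rho>\<^sub>i\<close> is nonzero, and then the test
  functions restricted to \<open>{\<rho>\<^sub>i > 0}\<close> form an infinite-dimensional space. So \<^const>\<open>enn2real\<close>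
  is only a change of type.\<close>

definition spectrum_vector :: "nat \<Rightarrow> ('a::euclidean_space \<Rightarrow> real) list \<Rightarrow> nat \<Rightarrow> real" where
  "spectrum_vector k \<rho> = (\<lambda>i\<in>{1..k}. enn2real (collection_mu i \<rho>))"

definition orthant :: "nat \<Rightarrow> (nat \<Rightarrow> real) set" where
  "orthant k = (\<Pi>\<^sub>E i\<in>{1..k}. {0..})"

definition orthant_topology :: "nat \<Rightarrow> (nat \<Rightarrow> real) topology" where
  "orthant_topology k = product_topology (\<lambda>_. top_of_set {0..}) {1..k}"

definition upper_semicontinuous :: "nat \<Rightarrow> ((nat \<Rightarrow> real) \<Rightarrow> real) \<Rightarrow> bool" where
  "upper_semicontinuous k F \<longleftrightarrow> (\<forall>t. openin (orthant_topology k) {x \<in> orthant k. F x < t})"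

definition nondecreasing_each :: "nat \<Rightarrow> ((nat \<Rightarrow> real) \<Rightarrow> real) \<Rightarrow> bool" where
  "nondecreasing_each k F \<longleftrightarrow>
     (\<forall>x\<in>orthant k. \<forall>i\<in>{1..k}. \<forall>t\<ge>x i. F x \<le> F (x(i := t)))"

end

theory Submission
  imports Defs "HOL-Library.Diagonal_Subsequence"
begin

text \<open>Take a maximizing sequence of collections. A ball whose concentric double does not carry much
  more mass supports a bump function of small Rayleigh quotient, and bumps with disjoint supports
  span a subspace; hence, unless the \<open>k\<close>-th eigenvalues tend to 0 along a subsequence (and then any
  admissible collection is a maximizer), mass cannot spread out. So the densities split into weakly
  convergent translates (profiles) whose mutual distances tend to infinity. Test functions of the
  profiles transplant to the sequence, so eigenvalues are upper semicontinuous; \<open>k + 1\<close> nonzero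
  profiles would force the \<open>k\<close>-th eigenvalue to 0, so there are at most \<open>k\<close> of them, and a maximal
  system of profiles carries the whole mass. Padded with zero densities, it is a maximizer.\<close>

subsection \<open>Weak compactness of bounded densities\<close>

text \<open>Only upper bounds on limits are required: \<open>F\<close> is nondecreasing and upper
  semicontinuous, so the eigenvalues along the sequence may drop in the limit estimate but must not
  exceed those of the limit collection asymptotically. Weak convergence suffices for this, because
  the test space is fixed and both quadratic forms are linear in the density. The obstacle is loss
  of mass at infinity for densities without any regularity. It is met by comparing scales: a bump at
  scale R on a ball with doubling constant C has Rayleigh quotient of order C / R^2, and balls exist
  whose C depends only on the dimension and on the ratio of the total mass to the mass that is
  spread out. A lower bound for the k-th eigenvalue therefore caps R, so every portion of mass keeps
  a fixed amount in some ball of fixed radius. Applied outside growing balls around the centres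
  already found, this produces one more profile whenever mass is missing. The number of profiles is
  limited because wide cut-offs are nearly constant: every nonzero integrable density has lowest
  eigenvalue 0.\<close>

definition L12 :: "'a measure \<Rightarrow> ('a \<Rightarrow> real) set" where
  "L12 M = {f. integrable M f \<and> integrable M (\<lambda>x. (f x)\<^sup>2)}"

lemma L12_integrable_mult:
  assumes "f \<in> L12 M" "g \<in> L12 M"
  shows "integrable M (\<lambda>x. f x * g x)"
proof (rule Bochner_Integration.integrable_bound)
  show "integrable M (\<lambda>x. (f x)\<^sup>2 + (g x)\<^sup>2)"
    using assms by (auto simp: L12_def)
  show "(\<lambda>x. f x * g x) \<in> borel_measurable M"
    using assms by (auto simp: L12_def)
  show "AE x in M. norm (f x * g x) \<le> norm ((f x)\<^sup>2 + (g x)\<^sup>2)"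
  proof (rule AE_I2)
    fix x
    have "0 \<le> (\<bar>f x\<bar> - \<bar>g x\<bar>)\<^sup>2" by simp
    then have "2 * (\<bar>f x\<bar> * \<bar>g x\<bar>) \<le> (f x)\<^sup>2 + (g x)\<^sup>2"
      by (simp add: power2_diff algebra_simps)
    moreover have "0 \<le> \<bar>f x\<bar> * \<bar>g x\<bar>" by simp
    ultimately show "norm (f x * g x) \<le> norm ((f x)\<^sup>2 + (g x)\<^sup>2)"
      unfolding real_norm_def abs_mult by linarith
  qed
qed

lemma L12_add: "f \<in> L12 M \<Longrightarrow> g \<in> L12 M \<Longrightarrow> (\<lambda>x. f x + g x) \<in> L12 M"
  using L12_integrable_mult[of f M g]
  by (auto simp: L12_def power2_sum mult.assoc)

lemma L12_scale: "f \<in> L12 M \<Longrightarrow> (\<lambda>x. c * f x) \<in> L12 M"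
  by (auto simp: L12_def power_mult_distrib)

lemma L12_diff:
  assumes "f \<in> L12 M" "g \<in> L12 M"
  shows "(\<lambda>x. f x - g x) \<in> L12 M"
  using L12_add[OF assms(1) L12_scale[OF assms(2), of "-1"]] by simp

lemma integrable_mult_unit_interval:
  fixes f g :: "'a \<Rightarrow> real"
  assumes "f \<in> borel_measurable M" "\<And>x. 0 \<le> f x" "\<And>x. f x \<le> 1" "integrable M g"
  shows "integrable M (\<lambda>x. f x * g x)"
proof (rule Bochner_Integration.integrable_bound[OF assms(4)])
  show "AE x in M. norm (f x * g x) \<le> norm (g x)"
    using assms(2,3) by (auto simp: abs_mult intro!: mult_left_le_one_le)
qed (use assms in auto)

lemma unit_interval_L12:
  fixes f :: "'a \<Rightarrow> real"
  assumes "integrable M f" "\<And>x. 0 \<le> f x" "\<And>x. f x \<le> 1"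
  shows "f \<in> L12 M"
  using integrable_mult_unit_interval[of f M f] assms
  by (auto simp: L12_def power2_eq_square)

lemma expand_square_integral:
  assumes f: "f \<in> L12 M" and g: "g \<in> L12 M"
  shows "(\<integral>x. (f x + c * g x)\<^sup>2 \<partial>M) =
    (\<integral>x. (f x)\<^sup>2 \<partial>M) + 2 * c * (\<integral>x. f x * g x \<partial>M) + c\<^sup>2 * (\<integral>x. (g x)\<^sup>2 \<partial>M)"
proof -
  have "(\<integral>x. (f x + c * g x)\<^sup>2 \<partial>M) =
      (\<integral>x. (f x)\<^sup>2 + ((2 * c) * (f x * g x) + c\<^sup>2 * (g x)\<^sup>2) \<partial>M)"
    by (rule Bochner_Integration.integral_cong) (auto simp: power2_eq_square algebra_simps)
  also have "\<dots> = (\<integral>x. (f x)\<^sup>2 \<partial>M) + ((\<integral>x. (2 * c) * (f x * g x) \<partial>M) + (\<integral>x. c\<^sup>2 * (g x)\<^sup>2 \<partial>M))"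
    using f g L12_integrable_mult[OF f g]
    by (subst Bochner_Integration.integral_add; (subst Bochner_Integration.integral_add)?)
       (auto simp: L12_def)
  finally show ?thesis by simp
qed

text \<open>A quantified first-order condition: an exact minimizer along the direction
  \<open>f\<close> would be orthogonal to \<open>f\<close>. It is enough to try \<tau> = \<epsilon>
  and \<tau> = -\<epsilon>: the linear term is then bounded by the slack \<epsilon>^2 plus the
  quadratic term, at most \<epsilon>^2 m.\<close>

lemma near_minimal_almost_orthogonal:
  assumes psi: "\<psi> \<in> L12 M" and f: "f \<in> L12 M" and m: "(\<integral>x. (f x)\<^sup>2 \<partial>M) \<le> m"
    and min: "\<And>\<tau>. (\<integral>x. (\<psi> x)\<^sup>2 \<partial>M) - \<epsilon>\<^sup>2 \<le> (\<integral>x. (\<psi> x + \<tau> * f x)\<^sup>2 \<partial>M)"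
    and eps: "\<epsilon> > 0"
  shows "\<bar>\<integral>x. \<psi> x * f x \<partial>M\<bar> \<le> \<epsilon> * (1 + m) / 2"
proof -
  let ?a = "\<integral>x. \<psi> x * f x \<partial>M" and ?N = "\<integral>x. (f x)\<^sup>2 \<partial>M"
  have 1: "- \<epsilon>\<^sup>2 \<le> 2 * \<tau> * ?a + \<tau>\<^sup>2 * ?N" for \<tau>
    using min[of \<tau>] unfolding expand_square_integral[OF psi f] by linarith
  have 2: "\<epsilon>\<^sup>2 * ?N \<le> \<epsilon>\<^sup>2 * m" using m by (intro mult_left_mono) auto
  have "\<epsilon> * (2 * \<bar>?a\<bar>) \<le> \<epsilon> * (\<epsilon> * (1 + m))"
    using 1[of \<epsilon>] 1[of "- \<epsilon>"] 2 by (simp add: abs_if power2_eq_square algebra_simps split: if_splits)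
  then show ?thesis using eps by (simp add: mult_le_cancel_left)
qed

inductive_set linear_hull :: "(nat \<Rightarrow> 'a \<Rightarrow> real) \<Rightarrow> ('a \<Rightarrow> real) set" for f where
  zero: "(\<lambda>x. 0) \<in> linear_hull f"
| step: "h \<in> linear_hull f \<Longrightarrow> (\<lambda>x. h x + c * f n x) \<in> linear_hull f"

lemma linear_hull_add_scaled:
  assumes "h \<in> linear_hull f" "g \<in> linear_hull f"
  shows "(\<lambda>x. g x + c * h x) \<in> linear_hull f"
  using assms
proof (induction)
  case (step h d n)
  then have "(\<lambda>x. (g x + c * h x) + (c * d) * f n x) \<in> linear_hull f"
    by (intro linear_hull.step) auto
  then show ?case by (simp add: algebra_simps)
qed simp

text \<open>Midpoints stand in for convex combinations: they are what the parallelogram law asks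
  for, and bounds on the generators pass to them by induction. The index set is a parameter so that
  the hulls of the tails \<open>{j..}\<close> can shrink as \<open>j\<close> grows.\<close>

inductive_set midpoint_hull :: "(nat \<Rightarrow> 'a \<Rightarrow> real) \<Rightarrow> nat set \<Rightarrow> ('a \<Rightarrow> real) set" for f A where
  base: "n \<in> A \<Longrightarrow> f n \<in> midpoint_hull f A"
| mid: "g \<in> midpoint_hull f A \<Longrightarrow> h \<in> midpoint_hull f A \<Longrightarrow> (\<lambda>x. (g x + h x) / 2) \<in> midpoint_hull f A"

lemma midpoint_hull_mono: "h \<in> midpoint_hull f A \<Longrightarrow> A \<subseteq> B \<Longrightarrow> h \<in> midpoint_hull f B"
  by (induction rule: midpoint_hull.induct) (auto intro: midpoint_hull.intros)

lemma midpoint_hull_linear_hull: "h \<in> midpoint_hull f A \<Longrightarrow> h \<in> linear_hull f"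
proof (induction rule: midpoint_hull.induct)
  case (base n)
  then show ?case using linear_hull.step[OF linear_hull.zero, of 1 f n] by simp
next
  case (mid g h)
  have "(\<lambda>x. 0 + (1/2) * g x) \<in> linear_hull f"
    by (rule linear_hull_add_scaled[OF mid.IH(1) linear_hull.zero])
  from linear_hull_add_scaled[OF mid.IH(2) this, of "1/2"]
  show ?case by (simp add: add_divide_distrib)
qed

lemma bounded_family_subseq:
  fixes a :: "nat \<Rightarrow> nat \<Rightarrow> real" and C :: real
  assumes "\<And>n l. \<bar>a n l\<bar> \<le> C"
  shows "\<exists>s. strict_mono s \<and> (\<forall>l. convergent (\<lambda>n. a (s n) l))"
proof -
  interpret subseqs "\<lambda>l s. convergent (\<lambda>n. a (s n) l)"
  proof
    fix l :: nat and s :: "nat \<Rightarrow> nat" assume "strict_mono s"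
    have "bounded (range (\<lambda>n. a (s n) l))"
      using assms by (intro boundedI[of _ C]) auto
    from bounded_imp_convergent_subsequence[OF this] obtain q r where "strict_mono r" "((\<lambda>n. a (s n) l) \<circ> r) \<longlonglongrightarrow> q"
      by blast
    then show "\<exists>r'. strict_mono r' \<and> convergent (\<lambda>n. a ((s \<circ> r') n) l)"
      by (auto simp: o_def convergent_def)
  qed
  have "convergent (\<lambda>n. a (diagseq n) l)" for l
  proof -
    \<comment> \<open>Only from index \<open>Suc l\<close> on is the diagonal sequence a subsequence
      of the one chosen for coordinate \<open>l\<close>; the shift is then ignored by
      convergence.\<close>
    have "convergent (\<lambda>n. a ((diagseq \<circ> ((+) (Suc l))) n) l)"
    proof (rule diagseq_holds)
      fix r s :: "nat \<Rightarrow> nat" and n :: nat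
      assume "strict_mono r" "convergent (\<lambda>k. a (s k) n)"
      then show "convergent (\<lambda>k. a ((s \<circ> r) k) n)"
        using convergent_subseq_convergent[of "\<lambda>k. a (s k) n" r] by (simp add: o_def)
    qed
    then have "convergent (\<lambda>n. a (diagseq (n + Suc l)) l)"
      by (simp add: o_def add.commute)
    then show ?thesis
      using convergent_ignore_initial_segment[of "\<lambda>n. a (diagseq n) l" "Suc l"] by simp
  qed
  then show ?thesis using subseq_diagseq by blast
qed

text \<open>Weak sequential compactness in \<open>L\<^sup>2\<close>, without duality: after a diagonal extraction that makes
  all inner products of the sequence converge, almost norm-minimal elements of the hulls of the
  tails form a Cauchy sequence by the parallelogram law, and its limit is the weak limit. Test
  functions are reduced to the linear hull by almost orthogonality.\<close>

proposition weakly_convergent_subsequence: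
  fixes f :: "nat \<Rightarrow> 'a \<Rightarrow> real"
  assumes M: "sigma_finite_measure M"
    and f: "\<And>n. integrable M (f n)" "\<And>n x. 0 \<le> f n x" "\<And>n x. f n x \<le> 1"
    and m: "\<And>n. (\<integral>x. f n x \<partial>M) \<le> m"
  obtains s g where "strict_mono s" "g \<in> borel_measurable M" "\<And>x. 0 \<le> g x" "\<And>x. g x \<le> 1"
    "\<And>\<phi>. \<phi> \<in> L12 M \<Longrightarrow> (\<lambda>n. \<integral>x. f (s n) x * \<phi> x \<partial>M) \<longlonglongrightarrow> (\<integral>x. g x * \<phi> x \<partial>M)"
proof -
  have fL: "f n \<in> L12 M" for n using unit_interval_L12 f by blast
  have m0: "0 \<le> m" using m[of 0] f(2)[of 0] by (smt (verit) Bochner_Integration.integral_nonneg)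
  have fN: "(\<integral>x. f n x * f l x \<partial>M) \<le> m" for n l
  proof -
    have "(\<integral>x. f n x * f l x \<partial>M) \<le> (\<integral>x. f n x \<partial>M)"
      by (intro integral_mono L12_integrable_mult fL f(1) mult_left_le f)
    then show ?thesis using m[of n] by linarith
  qed
  have "\<bar>\<integral>x. f n x * f l x \<partial>M\<bar> \<le> m" for n l
    using fN[of n l] by (simp add: Bochner_Integration.integral_nonneg f)
  then obtain s where s: "strict_mono s" "\<And>l. convergent (\<lambda>n. \<integral>x. f (s n) x * f l x \<partial>M)"
    using bounded_family_subseq[of "\<lambda>n l. \<integral>x. f n x * f l x \<partial>M" m] by auto
  define p where "p n = f (s n)" for n
  define K where "K j = midpoint_hull p {j..}" for j
  have K: "integrable M h \<and> h \<in> borel_measurable M \<and> (\<forall>x. 0 \<le> h x \<and> h x \<le> 1) \<and> (\<integral>x. h x \<partial>M) \<le> m"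
    if "h \<in> midpoint_hull p A" for h A using that
  proof (induction rule: midpoint_hull.induct)
    case (base n)
    then show ?case using f m by (auto simp: p_def)
  next
    case (mid g h)
    have "(g x + h x) / 2 \<le> 1" for x
    proof -
      have "g x \<le> 1" "h x \<le> 1" using mid.IH by auto
      then show ?thesis by simp
    qed
    then show ?case using mid by auto
  qed
  have KL: "h \<in> L12 M" if "h \<in> midpoint_hull p A" for h A
    using K[OF that] unit_interval_L12 by blast
  have KN: "(\<integral>x. (h x)\<^sup>2 \<partial>M) \<le> m" if "h \<in> midpoint_hull p A" for h A
  proof -
    have "(\<integral>x. (h x)\<^sup>2 \<partial>M) \<le> (\<integral>x. h x \<partial>M)"
      using K[OF that] KL[OF that]
      by (intro integral_mono) (auto simp: power2_eq_square L12_def intro: mult_left_le)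
    then show ?thesis using K[OF that] by linarith
  qed
  have Kne: "K j \<noteq> {}" for j unfolding K_def using midpoint_hull.base[of j "{j..}" p] by auto
  have Kmono: "K j \<subseteq> K i" if "i \<le> j" for i j
    unfolding K_def using midpoint_hull_mono[of _ p "{j..}" "{i..}"] that by auto
  let ?N = "\<lambda>h. \<integral>x. (h x)\<^sup>2 \<partial>M"
  define d where "d j = Inf (?N ` K j)" for j
  have bdd: "bdd_below (?N ` K j)" for j
    by (intro bdd_belowI[of _ 0]) (auto intro: Bochner_Integration.integral_nonneg)
  have d_le: "d j \<le> ?N h" if "h \<in> K j" for h j
    unfolding d_def using that bdd by (intro cInf_lower) auto
  have d_le_m: "d j \<le> m" for j
    using d_le Kne[of j] KN unfolding K_def by (metis all_not_in_conv order_trans)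
  have "incseq d"
  proof (rule incseq_SucI)
    fix n show "d n \<le> d (Suc n)" unfolding d_def
      by (rule cInf_superset_mono) (use Kne bdd Kmono[of n "Suc n"] in auto)
  qed
  then obtain D where D: "d \<longlonglongrightarrow> D" "\<And>j. d j \<le> D"
    using incseq_convergent[of d m] d_le_m by blast
  have "\<exists>h\<in>K j. ?N h < d j + 1 / real (Suc j)" for j
  proof -
    have "Inf (?N ` K j) < d j + 1 / real (Suc j)" unfolding d_def by simp
    from cInf_lessD[OF _ this] show ?thesis using Kne by auto
  qed
  then obtain h where h: "\<And>j. h j \<in> K j" "\<And>j. ?N (h j) < d j + 1 / real (Suc j)" by metis
  have hL: "h j \<in> L12 M" for j using h(1)[of j] KL unfolding K_def by blast
  have hK: "integrable M (h j)" "h j \<in> borel_measurable M" "0 \<le> h j x" "h j x \<le> 1" for j x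
    using K[of "h j"] h(1)[of j] unfolding K_def by blast+
  \<comment> \<open>The midpoint of \<open>h i\<close> and \<open>h j\<close> stays in the hull of
    the tail from \<open>k\<close>, so its squared norm is at least \<open>d k\<close>, while the
    squared norms of \<open>h i\<close> and \<open>h j\<close> are below
    \<open>D + 1 / (k + 1)\<close>.\<close>
  have para: "?N (\<lambda>x. h i x - h j x) \<le> 4 * (D - d k + 1 / real (Suc k))"
    if "k \<le> i" "k \<le> j" for i j k
  proof -
    have mid: "(\<lambda>x. (h i x + h j x) / 2) \<in> K k"
      using midpoint_hull.mid h(1)[of i] h(1)[of j] Kmono[OF that(1)] Kmono[OF that(2)]
      unfolding K_def by blast
    have eq: "?N (\<lambda>x. h i x - h j x) + 4 * ?N (\<lambda>x. (h i x + h j x) / 2) = 2 * ?N (h i) + 2 * ?N (h j)"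
    proof -
      have "?N (\<lambda>x. (h i x + h j x) / 2) = ?N (\<lambda>x. h i x + 1 * h j x) / 4"
        by (simp add: power_divide)
      then show ?thesis
        using expand_square_integral[OF hL hL, of i "-1" j] expand_square_integral[OF hL hL, of i 1 j]
        by simp
    qed
    have "1 / real (Suc i) \<le> 1 / real (Suc k)" "1 / real (Suc j) \<le> 1 / real (Suc k)"
      using that by (auto intro!: divide_left_mono)
    then show ?thesis
      using eq d_le[OF mid] h(2)[of i] h(2)[of j] D(2)[of i] D(2)[of j] by argo
  qed
  \<comment> \<open>The measure may be infinite, so smallness in L^2 gives nothing in L^1. With a
    strictly positive integrable weight the sequence becomes Cauchy in L^1, which yields an a.e.
    Cauchy subsequence; dividing by \<open>w\<close> recovers convergence of \<open>h\<close>
    itself.\<close>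
  have "\<exists>w :: 'a \<Rightarrow> real. w \<in> borel_measurable M \<and> (\<forall>x. w x > 0) \<and> (\<forall>x. w x \<le> 1) \<and> integrable M w"
    by (rule sigma_finite_measure.obtain_positive_integrable_function[OF M]) blast
  then obtain w :: "'a \<Rightarrow> real" where w: "w \<in> borel_measurable M" "\<And>x. w x > 0" "\<And>x. w x \<le> 1" "integrable M w"
    by blast
  have wL: "w \<in> L12 M" using unit_interval_L12 w less_imp_le by metis
  have lim0: "(\<lambda>k. D - d k + 1 / real (Suc k)) \<longlonglongrightarrow> 0"
  proof -
    have "(\<lambda>k. D - d k + 1 / real (Suc k)) \<longlonglongrightarrow> D - D + 0"
      by (intro tendsto_intros D(1) LIMSEQ_Suc[OF lim_1_over_n])
    then show ?thesis by simp
  qed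
  obtain r where r: "strict_mono r" "AE x in M. Cauchy (\<lambda>i. w x * h (r i) x)"
  proof (rule cauchy_L1_AE_cauchy_subseq[of M "\<lambda>i x. w x * h i x"])
    show "integrable M (\<lambda>x. w x * h n x)" for n using L12_integrable_mult[OF wL hL] .
    fix e :: real assume e: "0 < e"
    \<comment> \<open>The parameter in Young's inequality 2ab \<le> c a^2 + b^2 / c. This choice
      keeps the term with \<open>w\<close> below \<open>e\<close>; afterwards \<open>k\<close> is
      taken so large that the other term is below \<open>e\<close> too.\<close>
    define c where "c = e / (1 + ?N w)"
    have Nw: "0 \<le> ?N w" by (simp add: Bochner_Integration.integral_nonneg)
    have c: "c > 0" unfolding c_def using e Nw by (intro divide_pos_pos add_pos_nonneg) auto
    have c': "c * ?N w < e"
      unfolding c_def using e Nw by (simp add: field_simps add_pos_nonneg)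
    have "eventually (\<lambda>k. D - d k + 1 / real (Suc k) < c * e / 4) sequentially"
      by (rule order_tendstoD(2)[OF lim0]) (use c e in auto)
    then obtain k where "D - d k + 1 / real (Suc k) < c * e / 4"
      by (auto simp del: of_nat_Suc simp: eventually_sequentially)
    then have k: "4 * (D - d k + 1 / real (Suc k)) < c * e" by argo
    have "LINT x|M. norm (w x * h i x - w x * h j x) < e" if "i \<ge> k" "j \<ge> k" for i j
    proof -
      have dL: "(\<lambda>x. h i x - h j x) \<in> L12 M" by (rule L12_diff[OF hL hL])
      have pt: "norm (w x * h i x - w x * h j x) \<le> (c * (w x)\<^sup>2 + (1/c) * (h i x - h j x)\<^sup>2) / 2" for x
      proof -
        have "0 \<le> (c * w x - \<bar>h i x - h j x\<bar>)\<^sup>2 / c" using c by simp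
        also have "\<dots> = c * (w x)\<^sup>2 - 2 * (w x * \<bar>h i x - h j x\<bar>) + (1/c) * (h i x - h j x)\<^sup>2"
          using c by (simp add: power2_diff field_simps power2_eq_square)
        finally have "w x * \<bar>h i x - h j x\<bar> \<le> (c * (w x)\<^sup>2 + (1/c) * (h i x - h j x)\<^sup>2) / 2" by simp
        moreover have "norm (w x * h i x - w x * h j x) = w x * \<bar>h i x - h j x\<bar>"
          using w(2)[of x] by (simp add: abs_mult right_diff_distrib[symmetric])
        ultimately show ?thesis by simp
      qed
      have "(LINT x|M. norm (w x * h i x - w x * h j x)) \<le> (\<integral>x. (c * (w x)\<^sup>2 + (1/c) * (h i x - h j x)\<^sup>2) / 2 \<partial>M)"
        by (intro integral_mono pt integrable_norm Bochner_Integration.integrable_diff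
              L12_integrable_mult[OF wL hL]) (use wL dL in \<open>auto simp: L12_def\<close>)
      also have "\<dots> = (c * ?N w + (1/c) * ?N (\<lambda>x. h i x - h j x)) / 2"
        using wL dL by (subst integral_divide_zero, subst Bochner_Integration.integral_add) (auto simp: L12_def)
      also have "\<dots> < (e + e) / 2"
      proof -
        have "?N (\<lambda>x. h i x - h j x) < c * e" using para[OF that] k by linarith
        then have "(1/c) * ?N (\<lambda>x. h i x - h j x) < e" using c by (simp add: field_simps)
        then show ?thesis using c' by simp
      qed
      finally show ?thesis by simp
    qed
    then show "\<exists>N. \<forall>i\<ge>N. \<forall>j\<ge>N. LINT x|M. norm (w x * h i x - w x * h j x) < e" by blast
  qed
  \<comment> \<open>The truncation makes the bounds 0 and 1 hold at every point, including those
    where the limit does not exist and \<open>lim\<close> is arbitrary.\<close>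
  define g where "g x = max 0 (min 1 (lim (\<lambda>i. h (r i) x)))" for x
  have [measurable]: "h j \<in> borel_measurable M" for j using hK by blast
  have g: "g \<in> borel_measurable M" "\<And>x. 0 \<le> g x" "\<And>x. g x \<le> 1"
    unfolding g_def by (auto intro!: borel_measurable_max borel_measurable_min borel_measurable_lim_metric)
  have aelim: "AE x in M. (\<lambda>i. h (r i) x) \<longlonglongrightarrow> g x"
    using r(2)
  proof eventually_elim
    case (elim x)
    then have "convergent (\<lambda>i. w x * h (r i) x)" by (simp add: Cauchy_convergent)
    then have "convergent (\<lambda>i. h (r i) x)"
      using w(2)[of x] convergent_mult_const_iff[of "w x" "\<lambda>i. h (r i) x"] by simp
    then obtain l where l: "(\<lambda>i. h (r i) x) \<longlonglongrightarrow> l" by (auto simp: convergent_def)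
    have "0 \<le> l" "l \<le> 1"
      using LIMSEQ_le_const[OF l, of 0] LIMSEQ_le_const2[OF l, of 1] hK by auto
    then show ?case using l limI[OF l] by (simp add: g_def)
  qed
  \<comment> \<open>Here the integrability half of \<open>L12\<close> matters: the factors
    \<open>h (r i)\<close> are bounded by 1, so \<phi> itself dominates, and \<open>g\<close> need
    not be known to be square integrable.\<close>
  have hlim: "(\<lambda>i. \<integral>x. h (r i) x * \<phi> x \<partial>M) \<longlonglongrightarrow> (\<integral>x. g x * \<phi> x \<partial>M)" if "\<phi> \<in> L12 M" for \<phi>
  proof (rule integral_dominated_convergence[where w="\<lambda>x. \<bar>\<phi> x\<bar>"])
    have [measurable]: "\<phi> \<in> borel_measurable M" using that by (auto simp: L12_def)
    show "(\<lambda>x. g x * \<phi> x) \<in> borel_measurable M" "(\<lambda>x. h (r i) x * \<phi> x) \<in> borel_measurable M" for i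
      using g(1) by measurable
    show "integrable M (\<lambda>x. \<bar>\<phi> x\<bar>)" using that by (auto simp: L12_def)
    show "AE x in M. (\<lambda>i. h (r i) x * \<phi> x) \<longlonglongrightarrow> g x * \<phi> x"
      using aelim by eventually_elim (intro tendsto_intros)
    show "AE x in M. norm (h (r i) x * \<phi> x) \<le> \<bar>\<phi> x\<bar>" for i
      using hK by (auto simp: abs_mult intro!: mult_left_le_one_le)
  qed
  have hK': "h (r i) \<in> midpoint_hull p {i..}" for i
    using h(1)[of "r i"] Kmono[OF seq_suble[OF r(1), of i]] unfolding K_def by blast
  have gL: "(\<lambda>x. g x * \<phi> x) \<in> borel_measurable M \<and> integrable M (\<lambda>x. g x * \<phi> x)" if "\<phi> \<in> L12 M" for \<phi>
    using integrable_mult_unit_interval[OF g, of \<phi>] that by (auto simp: L12_def)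
  have base: "(\<lambda>n. \<integral>x. p n x * f l x \<partial>M) \<longlonglongrightarrow> (\<integral>x. g x * f l x \<partial>M)" for l
  proof -
    obtain \<Lambda> where L: "(\<lambda>n. \<integral>x. p n x * f l x \<partial>M) \<longlonglongrightarrow> \<Lambda>"
      using s(2)[of l] by (auto simp: convergent_def p_def)
    have "(\<lambda>i. \<integral>x. h (r i) x * f l x \<partial>M) \<longlonglongrightarrow> \<Lambda>"
    proof (rule LIMSEQ_I)
      fix e :: real assume "0 < e"
      then obtain N where N: "\<And>n. n \<ge> N \<Longrightarrow> \<bar>(\<integral>x. p n x * f l x \<partial>M) - \<Lambda>\<bar> < e"
        using LIMSEQ_D[OF L, of e] by auto
      \<comment> \<open>An interval around \<Lambda> is convex, so closeness of the generators
        beyond \<open>N\<close> passes to their midpoints. Thus the hull elements have the same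
        limit \<Lambda> as the sequence itself.\<close>
      have "\<bar>(\<integral>x. q x * f l x \<partial>M) - \<Lambda>\<bar> < e" if "q \<in> midpoint_hull p {N..}" for q
        using that
      proof (induction rule: midpoint_hull.induct)
        case (mid q1 q2)
        have "(\<integral>x. (q1 x + q2 x) / 2 * f l x \<partial>M) = (\<integral>x. (q1 x * f l x + q2 x * f l x) / 2 \<partial>M)"
          by (rule Bochner_Integration.integral_cong) (auto simp: field_simps)
        also have "\<dots> = ((\<integral>x. q1 x * f l x \<partial>M) + (\<integral>x. q2 x * f l x \<partial>M)) / 2"
          using L12_integrable_mult[OF KL[OF mid.hyps(1)] fL] L12_integrable_mult[OF KL[OF mid.hyps(2)] fL]
          by simp
        finally show ?case using mid.IH by (simp add: abs_if field_simps split: if_splits)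
      qed (use N in auto)
      moreover have "h (r i) \<in> midpoint_hull p {N..}" if "i \<ge> N" for i
        using midpoint_hull_mono[OF hK'[of i]] that by auto
      ultimately show "\<exists>no. \<forall>n\<ge>no. norm ((\<integral>x. h (r n) x * f l x \<partial>M) - \<Lambda>) < e" by auto
    qed
    then show ?thesis using LIMSEQ_unique hlim[OF fL] L by blast
  qed
  have WL: "q \<in> L12 M" if "q \<in> linear_hull p" for q
    using that
  proof (induction)
    case zero then show ?case by (simp add: L12_def)
  next
    case step then show ?case by (intro L12_add L12_scale) (auto simp: p_def fL)
  qed
  have Wlim: "(\<lambda>n. \<integral>x. p n x * q x \<partial>M) \<longlonglongrightarrow> (\<integral>x. g x * q x \<partial>M)" if "q \<in> linear_hull p" for q
    using that
  proof (induction)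
    case (step q c l)
    have "(\<integral>x. k x * (q x + c * p l x) \<partial>M) = (\<integral>x. k x * q x \<partial>M) + c * (\<integral>x. k x * p l x \<partial>M)"
      if "integrable M (\<lambda>x. k x * q x)" "integrable M (\<lambda>x. k x * p l x)" for k
    proof -
      have "(\<integral>x. k x * (q x + c * p l x) \<partial>M) = (\<integral>x. k x * q x + c * (k x * p l x) \<partial>M)"
        by (rule Bochner_Integration.integral_cong) (auto simp: algebra_simps)
      then show ?thesis using that by simp
    qed
    note lin = this
    have "(\<integral>x. p n x * (q x + c * p l x) \<partial>M) = (\<integral>x. p n x * q x \<partial>M) + c * (\<integral>x. p n x * p l x \<partial>M)" for n
      by (rule lin) (use WL[OF step.hyps] fL in \<open>auto intro!: L12_integrable_mult simp: p_def\<close>)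
    moreover have "(\<integral>x. g x * (q x + c * p l x) \<partial>M) = (\<integral>x. g x * q x \<partial>M) + c * (\<integral>x. g x * p l x \<partial>M)"
      by (rule lin) (use gL WL[OF step.hyps] fL in \<open>auto simp: p_def\<close>)
    moreover have "(\<lambda>n. \<integral>x. p n x * p l x \<partial>M) \<longlonglongrightarrow> (\<integral>x. g x * p l x \<partial>M)"
      using base[of "s l"] by (simp add: p_def)
    ultimately show ?case using step.IH by (auto intro!: tendsto_intros)
  qed simp
  have final: "(\<lambda>n. \<integral>x. p n x * \<phi> x \<partial>M) \<longlonglongrightarrow> (\<integral>x. g x * \<phi> x \<partial>M)" if phi: "\<phi> \<in> L12 M" for \<phi>
  proof (rule LIMSEQ_I)
    fix e :: real assume e: "0 < e"
    \<comment> \<open>Chosen so that \<open>near_minimal_almost_orthogonal\<close> returns the bound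
      e / 4. The test function is split as q + \<psi> with q an almost best approximation in the
      linear hull: convergence against q is known, and \<psi> contributes at most e / 4 on each
      side.\<close>
    define \<epsilon> where "\<epsilon> = e / (2 * (1 + m))"
    have eps: "\<epsilon> > 0" unfolding \<epsilon>_def using e m0 by (intro divide_pos_pos) auto
    have eps2: "\<epsilon> * (1 + m) / 2 = e / 4" unfolding \<epsilon>_def using m0 by (simp add: field_simps)
    let ?D = "(\<lambda>q. ?N (\<lambda>x. \<phi> x - q x)) ` linear_hull p"
    have bdd': "bdd_below ?D"
      by (intro bdd_belowI[of _ 0]) (auto intro: Bochner_Integration.integral_nonneg)
    have "Inf ?D < Inf ?D + \<epsilon>\<^sup>2" using eps by simp
    then obtain q where q: "q \<in> linear_hull p" "?N (\<lambda>x. \<phi> x - q x) < Inf ?D + \<epsilon>\<^sup>2"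
      using cInf_lessD[of ?D "Inf ?D + \<epsilon>\<^sup>2"] linear_hull.zero[of p] by auto
    define \<psi> where "\<psi> x = \<phi> x - q x" for x
    have psi: "\<psi> \<in> L12 M" unfolding \<psi>_def by (rule L12_diff[OF phi WL[OF q(1)]])
    have orth: "\<bar>\<integral>x. k x * \<psi> x \<partial>M\<bar> \<le> e / 4" if k: "k \<in> midpoint_hull p A" for k A
    proof -
      have "(\<integral>x. (\<psi> x)\<^sup>2 \<partial>M) - \<epsilon>\<^sup>2 \<le> (\<integral>x. (\<psi> x + \<tau> * k x)\<^sup>2 \<partial>M)" for \<tau>
      proof -
        have "(\<lambda>x. q x + (- \<tau>) * k x) \<in> linear_hull p"
          by (rule linear_hull_add_scaled[OF midpoint_hull_linear_hull[OF k] q(1)])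
        then have "Inf ?D \<le> ?N (\<lambda>x. \<phi> x - (q x + (- \<tau>) * k x))"
          using bdd' by (intro cInf_lower) auto
        also have "\<dots> = ?N (\<lambda>x. \<psi> x + \<tau> * k x)" by (simp add: \<psi>_def algebra_simps)
        finally show ?thesis using q(2) by (simp add: \<psi>_def)
      qed
      from near_minimal_almost_orthogonal[OF psi KL[OF k] KN[OF k] this eps]
      show ?thesis by (simp add: eps2 mult.commute)
    qed
    have orthp: "\<bar>\<integral>x. p n x * \<psi> x \<partial>M\<bar> \<le> e / 4" for n
      using orth[OF midpoint_hull.base[of n UNIV]] by simp
    have orthg: "\<bar>\<integral>x. g x * \<psi> x \<partial>M\<bar> \<le> e / 4"
      by (rule LIMSEQ_le_const2[OF tendsto_rabs[OF hlim[OF psi]]]) (use orth[OF hK'] in auto)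
    have split: "(\<integral>x. k x * \<phi> x \<partial>M) = (\<integral>x. k x * q x \<partial>M) + (\<integral>x. k x * \<psi> x \<partial>M)"
      if "integrable M (\<lambda>x. k x * q x)" "integrable M (\<lambda>x. k x * \<psi> x)" for k
    proof -
      have "(\<integral>x. k x * \<phi> x \<partial>M) = (\<integral>x. k x * q x + k x * \<psi> x \<partial>M)"
        by (rule Bochner_Integration.integral_cong) (auto simp: algebra_simps \<psi>_def)
      then show ?thesis using that by simp
    qed
    obtain N where N: "\<And>n. n \<ge> N \<Longrightarrow> \<bar>(\<integral>x. p n x * q x \<partial>M) - (\<integral>x. g x * q x \<partial>M)\<bar> < e / 4"
      using LIMSEQ_D[OF Wlim[OF q(1)], of "e/4"] e by auto
    have "norm ((\<integral>x. p n x * \<phi> x \<partial>M) - (\<integral>x. g x * \<phi> x \<partial>M)) < e" if "n \<ge> N" for n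
    proof -
      have 1: "(\<integral>x. p n x * \<phi> x \<partial>M) = (\<integral>x. p n x * q x \<partial>M) + (\<integral>x. p n x * \<psi> x \<partial>M)"
        by (rule split) (use WL[OF q(1)] psi fL in \<open>auto intro!: L12_integrable_mult simp: p_def\<close>)
      have 2: "(\<integral>x. g x * \<phi> x \<partial>M) = (\<integral>x. g x * q x \<partial>M) + (\<integral>x. g x * \<psi> x \<partial>M)"
        by (rule split) (use gL WL[OF q(1)] psi in auto)
      show ?thesis unfolding real_norm_def 1 2 using orthp[of n] orthg N[OF that] by linarith
    qed
    then show "\<exists>no. \<forall>n\<ge>no. norm ((\<integral>x. p n x * \<phi> x \<partial>M) - (\<integral>x. g x * \<phi> x \<partial>M)) < e" by blast
  qed
  show thesis
    by (rule that[OF s(1) g]) (use final in \<open>auto simp: p_def\<close>)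
qed

subsection \<open>Test functions\<close>

lemma Ck_SucI:
  assumes "\<And>x. (u has_derivative D x) (at x)" "\<And>b. b \<in> Basis \<Longrightarrow> Ck n (\<lambda>x. D x b)"
  shows "Ck (Suc n) u"
proof -
  have "frechet_derivative u (at x) = D x" for x
    using frechet_derivative_at[OF assms(1)] by simp
  then show ?thesis using assms by (auto simp: differentiable_def)
qed

lemma Ck_Suc_has_derivative:
  "Ck (Suc n) u \<Longrightarrow> (u has_derivative frechet_derivative u (at x)) (at x)"
  by (simp add: frechet_derivative_works)

lemma Ck_Suc_imp_Ck: "Ck (Suc n) u \<Longrightarrow> Ck n u"
proof (induction n arbitrary: u)
  case 0
  then show ?case
    by (auto intro!: differentiable_imp_continuous_on simp: differentiable_on_def differentiable_at_withinI)
next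
  case (Suc n)
  then show ?case by (metis Ck.simps(2))
qed

lemma Ck_const: "Ck n (\<lambda>x. c)"
proof (induction n arbitrary: c)
  case (Suc n)
  show ?case by (rule Ck_SucI[where D="\<lambda>x h. 0"]) (auto intro: Suc)
qed simp

lemma Ck_inner: "Ck n (\<lambda>x. x \<bullet> a)"
proof (cases n)
  case (Suc l)
  show ?thesis unfolding Suc
    by (rule Ck_SucI[where D="\<lambda>x h. h \<bullet> a"])
       (auto intro!: derivative_eq_intros Ck_const)
qed (auto intro: continuous_intros)

lemma Ck_add: "Ck n u \<Longrightarrow> Ck n v \<Longrightarrow> Ck n (\<lambda>x. u x + v x)"
proof (induction n arbitrary: u v)
  case (Suc n)
  show ?case
    by (rule Ck_SucI[OF has_derivative_add[OF Suc.prems[THEN Ck_Suc_has_derivative]]])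
       (use Suc in auto)
qed (auto intro: continuous_intros)

lemma Ck_mult: "Ck n u \<Longrightarrow> Ck n v \<Longrightarrow> Ck n (\<lambda>x. u x * v x)"
proof (induction n arbitrary: u v)
  case (Suc n)
  show ?case
    by (rule Ck_SucI[OF has_derivative_mult[OF Suc.prems[THEN Ck_Suc_has_derivative]]])
       (use Suc Ck_Suc_imp_Ck[OF Suc.prems(1)] Ck_Suc_imp_Ck[OF Suc.prems(2)] in \<open>auto intro!: Ck_add\<close>)
qed (auto intro: continuous_intros)

lemma Ck_sum: "(\<And>i. i \<in> I \<Longrightarrow> Ck n (u i)) \<Longrightarrow> Ck n (\<lambda>x. \<Sum>i\<in>I. u i x)"
  by (induction I rule: infinite_finite_induct) (auto intro: Ck_const Ck_add)

lemma Ck_translate: "Ck n u \<Longrightarrow> Ck n (\<lambda>x. u (x - a))"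
proof (induction n arbitrary: u)
  case 0
  then show ?case by (auto intro!: continuous_on_compose2[of UNIV u] continuous_intros)
next
  case (Suc n)
  show ?case
  proof (rule Ck_SucI)
    show "((\<lambda>x. u (x - a)) has_derivative frechet_derivative u (at (x - a))) (at x)" for x
    proof -
      have "((\<lambda>x. x - a) has_derivative (\<lambda>h. h)) (at x)" by (auto intro!: derivative_eq_intros)
      from has_derivative_compose[OF this Ck_Suc_has_derivative[OF Suc.prems]] show ?thesis .
    qed
    show "Ck n (\<lambda>x. frechet_derivative u (at (x - a)) b)" if "b \<in> Basis" for b
      using Suc.IH[of "\<lambda>x. frechet_derivative u (at x) b"] Suc.prems that by auto
  qed
qed

text \<open>\<open>G\<close> lists the successive derivatives of one real function. The induction
  has to be free in \<open>i\<close>, because differentiating the composition with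
  \<open>G i\<close> produces the composition with \<open>G (Suc i)\<close>.\<close>

lemma Ck_compose:
  assumes G: "\<And>i t. (G i has_real_derivative G (Suc i) t) (at t)" and u: "\<And>n. Ck n u"
  shows "Ck n (\<lambda>x. G i (u x))"
proof (induction n arbitrary: i)
  case 0
  have "continuous_on UNIV (G i)"
    using G by (auto intro!: continuous_at_imp_continuous_on DERIV_isCont)
  then show ?case using u[of 0] by (auto intro: continuous_on_compose2)
next
  case (Suc n)
  show ?case
  proof (rule Ck_SucI)
    show "((\<lambda>x. G i (u x)) has_derivative (\<lambda>h. G (Suc i) (u x) * frechet_derivative u (at x) h)) (at x)" for x
      using has_derivative_compose[OF Ck_Suc_has_derivative[OF u[of "Suc n"], of x], of "G i" "(*) (G (Suc i) (u x))"]
        G[of i "u x"] by (simp add: has_field_derivative_def)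
    show "Ck n (\<lambda>x. G (Suc i) (u x) * frechet_derivative u (at x) b)" if "b \<in> Basis" for b
      using u[of "Suc n"] that by (intro Ck_mult Suc.IH) auto
  qed
qed

lemma test_functionsI: "(\<And>n. Ck n u) \<Longrightarrow> bounded {x. u x \<noteq> 0} \<Longrightarrow> u \<in> test_functions"
  by (simp add: test_functions_def)

lemma test_functionsD:
  assumes "u \<in> test_functions"
  shows "Ck n u" "bounded {x. u x \<noteq> 0}" "(u has_derivative frechet_derivative u (at x)) (at x)"
  using assms Ck_Suc_has_derivative[of 0 u x] bounded_subset[OF _ closure_subset]
  by (auto simp: test_functions_def compact_imp_bounded)

lemma test_functions_zero: "(\<lambda>x. 0) \<in> test_functions"
  by (rule test_functionsI) (auto intro: Ck_const)

lemma test_functions_add: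
  assumes "u \<in> test_functions" "v \<in> test_functions"
  shows "(\<lambda>x. u x + v x) \<in> test_functions"
proof (rule test_functionsI)
  show "Ck n (\<lambda>x. u x + v x)" for n using assms by (intro Ck_add test_functionsD)
  show "bounded {x. u x + v x \<noteq> 0}"
    by (rule bounded_subset[of "{x. u x \<noteq> 0} \<union> {x. v x \<noteq> 0}"])
       (use assms in \<open>auto simp: test_functionsD\<close>)
qed

lemma test_functions_scale:
  assumes "u \<in> test_functions"
  shows "(\<lambda>x. c * u x) \<in> test_functions"
proof (rule test_functionsI)
  show "Ck n (\<lambda>x. c * u x)" for n using assms by (intro Ck_mult Ck_const test_functionsD)
  show "bounded {x. c * u x \<noteq> 0}"
    by (rule bounded_subset[of "{x. u x \<noteq> 0}"]) (use assms in \<open>auto simp: test_functionsD\<close>)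
qed

lemma test_functions_sum:
  "(\<And>i. i \<in> I \<Longrightarrow> u i \<in> test_functions) \<Longrightarrow> (\<lambda>x. \<Sum>i\<in>I. c i * u i x) \<in> test_functions"
proof (induction I rule: infinite_finite_induct)
  case (insert i I)
  then show ?case
    using test_functions_add[OF test_functions_scale[of "u i" "c i"], of "\<lambda>x. \<Sum>i\<in>I. c i * u i x"] by simp
qed (auto simp: test_functions_zero)

lemma test_functions_translate:
  assumes "u \<in> test_functions"
  shows "(\<lambda>x. u (x - a)) \<in> test_functions"
proof (rule test_functionsI)
  show "Ck n (\<lambda>x. u (x - a))" for n using assms by (intro Ck_translate test_functionsD)
  have "{x. u (x - a) \<noteq> 0} = (\<lambda>x. a + x) ` {x. u x \<noteq> 0}"
    by (auto simp: image_iff intro!: exI[of _ "_ - a"])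
  then show "bounded {x. u (x - a) \<noteq> 0}"
    using test_functionsD(2)[OF assms] by (auto intro: bounded_translation)
qed

lemma gradient_eqI:
  "(u has_derivative D) (at x) \<Longrightarrow> gradient u x = (\<Sum>b\<in>Basis. D b *\<^sub>R b)"
  using frechet_derivative_at[of u D x] by (simp add: gradient_def)

lemma gradient_sum:
  assumes "\<And>i. i \<in> I \<Longrightarrow> u i \<in> test_functions"
  shows "gradient (\<lambda>x. \<Sum>i\<in>I. c i * u i x) x = (\<Sum>i\<in>I. c i *\<^sub>R gradient (u i) x)"
proof -
  have "((\<lambda>x. \<Sum>i\<in>I. c i * u i x) has_derivative (\<lambda>h. \<Sum>i\<in>I. c i * frechet_derivative (u i) (at x) h)) (at x)"
    using assms by (intro has_derivative_sum has_derivative_mult_right test_functionsD(3))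
  then have "gradient (\<lambda>x. \<Sum>i\<in>I. c i * u i x) x
      = (\<Sum>b\<in>Basis. (\<Sum>i\<in>I. c i * frechet_derivative (u i) (at x) b) *\<^sub>R b)"
    by (rule gradient_eqI)
  also have "\<dots> = (\<Sum>b\<in>Basis. \<Sum>i\<in>I. c i *\<^sub>R (frechet_derivative (u i) (at x) b *\<^sub>R b))"
    by (simp add: scaleR_sum_left)
  also have "\<dots> = (\<Sum>i\<in>I. c i *\<^sub>R gradient (u i) x)"
    by (subst sum.swap) (simp add: gradient_def scaleR_sum_right)
  finally show ?thesis .
qed

lemma gradient_translate:
  assumes "u \<in> test_functions"
  shows "gradient (\<lambda>x. u (x - a)) x = gradient u (x - a)"
proof -
  have "((\<lambda>x. u (x - a)) has_derivative frechet_derivative u (at (x - a))) (at x)"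
  proof -
    have "((\<lambda>x. x - a) has_derivative (\<lambda>h. h)) (at x)" by (auto intro!: derivative_eq_intros)
    from has_derivative_compose[OF this test_functionsD(3)[OF assms]] show ?thesis .
  qed
  from gradient_eqI[OF this] show ?thesis by (simp add: gradient_def)
qed

lemma gradient_zero_outside:
  assumes "closed S" "\<And>y. y \<notin> S \<Longrightarrow> u y = 0" "x \<notin> S"
  shows "gradient u x = 0"
proof -
  have "(u has_derivative (\<lambda>h. 0)) (at x)"
    by (rule has_derivative_transform_within_open[of "\<lambda>_. 0" "\<lambda>_. 0" x UNIV "- S"])
       (use assms in \<open>auto simp: open_Compl\<close>)
  from gradient_eqI[OF this] show ?thesis by simp
qed

lemma continuous_on_gradient:
  assumes "u \<in> test_functions" shows "continuous_on UNIV (gradient u)"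
proof -
  have "continuous_on UNIV (\<lambda>x. frechet_derivative u (at x) b)" if "b \<in> Basis" for b
    using test_functionsD(1)[OF assms, of 1] that by auto
  then show ?thesis unfolding gradient_def by (intro continuous_intros) auto
qed

lemma test_function_support_cball:
  assumes "u \<in> test_functions"
  obtains r where "r > 0" "\<And>x. x \<notin> cball 0 r \<Longrightarrow> u x = 0"
proof -
  obtain r where "r > 0" "\<forall>x\<in>{x. u x \<noteq> 0}. norm x \<le> r"
    using test_functionsD(2)[OF assms] bounded_pos by blast
  then show thesis by (intro that[of r]) (auto simp: not_le)
qed

subsection \<open>Bump functions\<close>

text \<open>With s = 1/t, differentiating p(s) exp(-s) in t gives s^2 (p(s) - p'(s)) exp(-s); the
  recursion records this polynomial factor.\<close>

primrec flat_poly :: "nat \<Rightarrow> real poly" where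
  "flat_poly 0 = 1"
| "flat_poly (Suc n) = [:0, 0, 1:] * (flat_poly n - pderiv (flat_poly n))"

text \<open>\<open>flat n\<close> is the \<open>n\<close>-th derivative of \<open>exp (-1/t)\<close>, extended by 0 to \<open>t \<le> 0\<close>.\<close>

definition flat :: "nat \<Rightarrow> real \<Rightarrow> real" where
  "flat n t = (if t > 0 then poly (flat_poly n) (1 / t) * exp (- (1 / t)) else 0)"

lemma poly_exp_tendsto_0: "((\<lambda>s. poly p s * exp (- s)) \<longlongrightarrow> (0::real)) at_top"
proof -
  have "((\<lambda>s. \<Sum>i\<le>degree p. coeff p i * (s ^ i / exp s)) \<longlongrightarrow> (\<Sum>i\<le>degree p. coeff p i * 0)) at_top"
    by (intro tendsto_intros tendsto_power_div_exp_0)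
  then show ?thesis
    by (simp add: poly_altdef sum_distrib_right exp_minus divide_inverse mult.assoc)
qed

lemma has_real_derivative_flat: "(flat n has_real_derivative flat (Suc n) t) (at t)"
proof -
  consider "t > 0" | "t < 0" | "t = 0" by linarith
  then show ?thesis
  proof cases
    case 1
    have "((\<lambda>t. poly (flat_poly n) (1 / t) * exp (- (1 / t))) has_real_derivative
        poly (flat_poly n) (1 / t) * (exp (- (1 / t)) * (1 / t\<^sup>2)) +
        poly (pderiv (flat_poly n)) (1 / t) * (- 1 / t\<^sup>2) * exp (- (1 / t))) (at t)"
      using 1 by (auto intro!: derivative_eq_intros DERIV_chain2[OF poly_DERIV] simp: power2_eq_square field_simps)
    then have "((\<lambda>t. poly (flat_poly n) (1 / t) * exp (- (1 / t))) has_real_derivative flat (Suc n) t) (at t)"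
      using 1 by (simp add: flat_def power2_eq_square algebra_simps)
    then show ?thesis
      by (rule has_field_derivative_transform_within_open[of _ _ _ "{0<..}"])
         (use 1 in \<open>auto simp: flat_def\<close>)
  next
    case 2
    have "((\<lambda>t. 0) has_real_derivative flat (Suc n) t) (at t)"
      using 2 by (simp add: flat_def)
    then show ?thesis
      by (rule has_field_derivative_transform_within_open[of _ _ _ "{..<0}"])
         (use 2 in \<open>auto simp: flat_def\<close>)
  next
    case 3
    \<comment> \<open>For s = 1/t the right difference quotient at 0 is s p(s) exp(-s); the factor
      \<open>[:0,1:]\<close> accounts for the division by t.\<close>
    have "((\<lambda>s. poly ([:0,1:] * flat_poly n) s * exp (- s)) \<longlongrightarrow> 0) at_top"
      by (rule poly_exp_tendsto_0)
    then have "((\<lambda>t. poly ([:0,1:] * flat_poly n) (inverse t) * exp (- inverse t)) \<longlongrightarrow> 0) (at_right 0)"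
      by (rule filterlim_compose[OF _ filterlim_inverse_at_top_right])
    then have "((\<lambda>t. flat n t / t) \<longlongrightarrow> 0) (at_right 0)"
      by (rule Lim_transform_eventually)
         (auto simp: eventually_at_right_field flat_def field_simps intro!: exI[of _ 1])
    moreover have "((\<lambda>t. flat n t / t) \<longlongrightarrow> 0) (at_left 0)"
      by (rule Lim_transform_eventually[of "\<lambda>_. 0"])
         (auto simp: eventually_at_left_field flat_def intro!: exI[of _ "-1"])
    ultimately have "((\<lambda>t. flat n t / t) \<longlongrightarrow> 0) (at 0)"
      by (simp add: filterlim_split_at)
    then have "((\<lambda>t. (flat n t - flat n 0) / (t - 0)) \<longlongrightarrow> flat (Suc n) 0) (at 0)"
      by (simp add: flat_def)
    then show ?thesis using 3 by (simp add: has_field_derivative_iff)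
  qed
qed

text \<open>The squared distance is used because it is a polynomial, hence smooth at
  \<open>a\<close>. The number 4 puts the edge of the support at radius 2R, and inside radius R the
  argument of \<open>flat 0\<close> is at least 3, whence the lower bound exp(-1/3).\<close>

definition bump :: "'a::euclidean_space \<Rightarrow> real \<Rightarrow> 'a \<Rightarrow> real" where
  "bump a R x = flat 0 (4 - ((x - a) \<bullet> (x - a)) / R\<^sup>2)"

lemma bump_support: "R > 0 \<Longrightarrow> x \<notin> cball a (2 * R) \<Longrightarrow> bump a R x = 0"
proof -
  assume R: "R > 0" and "x \<notin> cball a (2 * R)"
  then have "2 * R \<le> norm (x - a)" by (simp add: dist_norm norm_minus_commute)
  then have "(2 * R)\<^sup>2 \<le> (norm (x - a))\<^sup>2" using R by (intro power_mono) auto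
  then show ?thesis using R
    by (simp add: bump_def flat_def power2_norm_eq_inner field_simps power_mult_distrib)
qed

lemma bump_lower: "R > 0 \<Longrightarrow> x \<in> cball a R \<Longrightarrow> exp (- (1 / 3)) \<le> bump a R x"
proof -
  assume R: "R > 0" and "x \<in> cball a R"
  then have "norm (x - a) \<le> R" by (simp add: dist_norm norm_minus_commute)
  then have "(norm (x - a))\<^sup>2 \<le> R\<^sup>2" by (intro power_mono) auto
  then have *: "((x - a) \<bullet> (x - a)) / R\<^sup>2 \<le> 1"
    using R by (simp add: power2_norm_eq_inner)
  then have "1 / (4 - ((x - a) \<bullet> (x - a)) / R\<^sup>2) \<le> 1 / 3"
    by (intro frac_le) linarith+
  moreover have "0 < 4 - ((x - a) \<bullet> (x - a)) / R\<^sup>2" using * by linarith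
  ultimately show ?thesis by (simp add: bump_def flat_def)
qed

lemma bump_test_function:
  assumes "R > 0" shows "bump a R \<in> test_functions"
proof (rule test_functionsI)
  have "Ck n (\<lambda>x. \<Sum>b\<in>Basis. (x \<bullet> b) * (x \<bullet> b))" for n
    by (intro Ck_sum Ck_mult Ck_inner)
  then have "Ck n (\<lambda>x::'a. x \<bullet> x)" for n by (simp add: euclidean_inner[symmetric])
  then have "Ck n (\<lambda>x. 4 + (- 1 / R\<^sup>2) * ((x - a) \<bullet> (x - a)))" for n
    by (intro Ck_add Ck_const Ck_mult) (rule Ck_translate)
  from Ck_compose[of flat, OF has_real_derivative_flat this]
  have "Ck n (\<lambda>x. flat 0 (4 + (- 1 / R\<^sup>2) * ((x - a) \<bullet> (x - a))))" for n by blast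
  then show "Ck n (bump a R)" for n unfolding bump_def by simp
  show "bounded {x. bump a R x \<noteq> 0}"
    by (rule bounded_subset[OF bounded_cball[of a "2 * R"]]) (use bump_support[OF assms] in blast)
qed

lemma flat_bounded: "\<exists>C>0. \<forall>t\<le>4. \<bar>flat 1 t\<bar> \<le> C"
proof -
  have "continuous_on {0..4} (flat 1)"
    by (auto intro!: continuous_at_imp_continuous_on DERIV_isCont has_real_derivative_flat)
  then have "bounded (flat 1 ` {0..4})"
    by (intro compact_imp_bounded compact_continuous_image) auto
  then obtain C where C: "C > 0" "\<forall>y\<in>flat 1 ` {0..4}. norm y \<le> C" using bounded_pos by blast
  have "\<bar>flat 1 t\<bar> \<le> C" if "t \<le> 4" for t
  proof (cases "t \<ge> 0")
    case True
    then have "flat 1 t \<in> flat 1 ` {0..4}" using that by auto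
    then show ?thesis using C(2) by auto
  next
    case False
    then show ?thesis using C(1) by (simp add: flat_def)
  qed
  then show ?thesis using C(1) by blast
qed

text \<open>By the chain rule the gradient is a multiple of x - a with factor of size 2 C / R^2 at
  most, and |x - a| \<le> 2R on the ball containing the support; this leaves the scale 1/R.\<close>

lemma bump_gradient:
  assumes C: "\<And>t. t \<le> 4 \<Longrightarrow> \<bar>flat 1 t\<bar> \<le> C" and R: "R > 0"
  shows "norm (gradient (bump a R) x) \<le> 4 * C / R"
proof (cases "x \<in> cball a (2 * R)")
  case False
  have "gradient (bump a R) x = 0"
    by (rule gradient_zero_outside[OF closed_cball bump_support False]) (use R in auto)
  moreover have "0 \<le> C" using C[of 0] by simp
  ultimately show ?thesis using R by simp
next
  case True
  let ?q = "4 - ((x - a) \<bullet> (x - a)) / R\<^sup>2"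
  have "((\<lambda>x. flat 0 (4 - ((x - a) \<bullet> (x - a)) / R\<^sup>2)) has_derivative
      (\<lambda>h. (- (2 * (h \<bullet> (x - a))) / R\<^sup>2) * flat 1 ?q)) (at x)"
  proof -
    have "((\<lambda>x. 4 - ((x - a) \<bullet> (x - a)) / R\<^sup>2) has_derivative (\<lambda>h. - (2 * (h \<bullet> (x - a))) / R\<^sup>2)) (at x)"
    proof -
      have "((\<lambda>x. 4 - ((x - a) \<bullet> (x - a)) * (1 / R\<^sup>2)) has_derivative
          (\<lambda>h. 0 - ((x - a) \<bullet> h + h \<bullet> (x - a)) * (1 / R\<^sup>2))) (at x)"
        by (intro has_derivative_diff has_derivative_const has_derivative_mult_left has_derivative_inner)
           (auto intro!: derivative_eq_intros)
      then show ?thesis by (simp add: inner_commute)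
    qed
    moreover have "(flat 0 has_derivative (\<lambda>h. h * flat 1 ?q)) (at ?q)"
      using has_real_derivative_flat[of 0 ?q] by (simp add: has_field_derivative_def mult_commute_abs)
    ultimately show ?thesis by (rule has_derivative_compose)
  qed
  then have "gradient (bump a R) x = (\<Sum>b\<in>Basis. ((- (2 * (b \<bullet> (x - a))) / R\<^sup>2) * flat 1 ?q) *\<^sub>R b)"
    using gradient_eqI[of "bump a R" _ x] by (simp add: bump_def[abs_def])
  also have "\<dots> = (\<Sum>b\<in>Basis. (- (2 / R\<^sup>2) * flat 1 ?q) *\<^sub>R (((x - a) \<bullet> b) *\<^sub>R b))"
    by (rule sum.cong) (auto simp: inner_commute)
  also have "\<dots> = (- (2 / R\<^sup>2) * flat 1 ?q) *\<^sub>R (x - a)"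
    unfolding scaleR_sum_right[symmetric] euclidean_representation ..
  finally have "norm (gradient (bump a R) x) = 2 / R\<^sup>2 * \<bar>flat 1 ?q\<bar> * norm (x - a)"
    by (simp add: abs_mult)
  also have "\<dots> \<le> 2 / R\<^sup>2 * C * (2 * R)"
    using True R C[of ?q] by (intro mult_mono) (auto simp: dist_norm norm_minus_commute)
  also have "\<dots> = 4 * C / R" using R by (simp add: power2_eq_square)
  finally show ?thesis .
qed

subsection \<open>Spectral families\<close>

definition density_fun :: "('a::euclidean_space \<Rightarrow> real) \<Rightarrow> bool" where
  "density_fun \<rho> \<longleftrightarrow> \<rho> \<in> borel_measurable lebesgue \<and> (\<forall>x. 0 \<le> \<rho> x \<and> \<rho> x \<le> 1)"

definition mform :: "('a::euclidean_space \<Rightarrow> real) \<Rightarrow> ('a \<Rightarrow> real) \<Rightarrow> ('a \<Rightarrow> real) \<Rightarrow> real" where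
  "mform \<rho> u v = (\<integral>x. \<rho> x * (u x * v x) \<partial>lebesgue)"

definition gform :: "('a::euclidean_space \<Rightarrow> real) \<Rightarrow> ('a \<Rightarrow> real) \<Rightarrow> ('a \<Rightarrow> real) \<Rightarrow> real" where
  "gform \<rho> u v = (\<integral>x. \<rho> x * (gradient u x \<bullet> gradient v x) \<partial>lebesgue)"

definition lincomb :: "'i set \<Rightarrow> ('i \<Rightarrow> 'a \<Rightarrow> real) \<Rightarrow> ('i \<Rightarrow> real) \<Rightarrow> 'a \<Rightarrow> real" where
  "lincomb I u \<xi> x = (\<Sum>i\<in>I. \<xi> i * u i x)"

text \<open>A competitor in the min-max, described by smooth representatives instead of a subspace
  of classes. Positivity of \<open>mform\<close> on nonzero coefficient vectors expresses linear
  independence on the set where the density is positive, and the Rayleigh bound is multiplied out.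
  The index type is free so that unions of families can be indexed by pairs.\<close>

definition spectral_family ::
    "('a::euclidean_space \<Rightarrow> real) \<Rightarrow> 'i set \<Rightarrow> ('i \<Rightarrow> 'a \<Rightarrow> real) \<Rightarrow> real \<Rightarrow> bool" where
  "spectral_family \<rho> I u t \<longleftrightarrow> finite I \<and> (\<forall>i\<in>I. u i \<in> test_functions) \<and>
     (\<forall>\<xi>. (\<exists>i\<in>I. \<xi> i \<noteq> 0) \<longrightarrow> 0 < mform \<rho> (lincomb I u \<xi>) (lincomb I u \<xi>) \<and>
        gform \<rho> (lincomb I u \<xi>) (lincomb I u \<xi>) \<le> t * mform \<rho> (lincomb I u \<xi>) (lincomb I u \<xi>))"

lemma rayleigh_eq: "rayleigh \<rho> u = gform \<rho> u u / mform \<rho> u u"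
  unfolding rayleigh_def gform_def mform_def dot_square_norm power2_eq_square ..

lemma lincomb_test_function:
  "(\<And>i. i \<in> I \<Longrightarrow> u i \<in> test_functions) \<Longrightarrow> lincomb I u \<xi> \<in> test_functions"
  unfolding lincomb_def[abs_def] by (rule test_functions_sum)

lemma continuous_compact_support_L12:
  fixes g :: "'a::euclidean_space \<Rightarrow> real"
  assumes "continuous_on UNIV g" "\<And>x. x \<notin> cball 0 r \<Longrightarrow> g x = 0"
  shows "g \<in> L12 lebesgue"
proof -
  have *: "integrable lebesgue h" if h: "continuous_on UNIV h" "\<And>x. x \<notin> cball 0 r \<Longrightarrow> h x = 0" for h :: "'a \<Rightarrow> real"
  proof -
    have "integrable lborel (\<lambda>x. indicator (cball 0 r) x *\<^sub>R h x)"
      by (rule borel_integrable_compact) (use h(1) continuous_on_subset in auto)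
    moreover have "(\<lambda>x. indicator (cball 0 r) x *\<^sub>R h x) = h"
      using h(2) by (auto simp: indicator_def fun_eq_iff)
    ultimately have "integrable lborel h" by simp
    moreover have "h \<in> borel_measurable borel" using h(1) by (rule borel_measurable_continuous_onI)
    ultimately show ?thesis by (subst integrable_completion) auto
  qed
  show ?thesis unfolding L12_def
    using *[of g] *[of "\<lambda>x. (g x)\<^sup>2"] assms by (auto intro: continuous_intros)
qed

lemma test_function_product_L12:
  assumes "u \<in> test_functions" "v \<in> test_functions"
  shows "(\<lambda>x. u x * v x) \<in> L12 lebesgue" "(\<lambda>x. gradient u x \<bullet> gradient v x) \<in> L12 lebesgue"
proof -
  obtain r where r: "\<And>x. x \<notin> cball 0 r \<Longrightarrow> u x = 0"
    using test_function_support_cball[OF assms(1)] by blast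
  have g: "gradient u x = 0" if "x \<notin> cball 0 r" for x
    by (rule gradient_zero_outside[of "cball 0 r" u, OF closed_cball r that])
  show "(\<lambda>x. u x * v x) \<in> L12 lebesgue"
    by (rule continuous_compact_support_L12[of _ r])
       (use r test_functionsD(1)[OF assms(1), of 0] test_functionsD(1)[OF assms(2), of 0] in \<open>auto intro: continuous_intros\<close>)
  show "(\<lambda>x. gradient u x \<bullet> gradient v x) \<in> L12 lebesgue"
    by (rule continuous_compact_support_L12[of _ r])
       (use g assms in \<open>auto intro!: continuous_intros continuous_on_gradient\<close>)
qed

lemma form_integrable:
  assumes "density_fun \<rho>" "u \<in> test_functions" "v \<in> test_functions"
  shows "integrable lebesgue (\<lambda>x. \<rho> x * (u x * v x))"
    "integrable lebesgue (\<lambda>x. \<rho> x * (gradient u x \<bullet> gradient v x))"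
  using assms test_function_product_L12[OF assms(2,3)]
  by (auto intro!: integrable_mult_unit_interval simp: L12_def density_fun_def)

text \<open>Here and in \<open>gform_sum\<close> the density enters only through a finite Gram
  matrix, so that weak convergence tested on finitely many products controls the forms on the whole
  span.\<close>

lemma mform_sum:
  assumes \<rho>: "density_fun \<rho>" and u: "\<And>i. i \<in> I \<Longrightarrow> u i \<in> test_functions"
  shows "mform \<rho> (lincomb I u \<xi>) (lincomb I u \<xi>) = (\<Sum>i\<in>I. \<Sum>j\<in>I. \<xi> i * \<xi> j * mform \<rho> (u i) (u j))"
proof -
  have "mform \<rho> (lincomb I u \<xi>) (lincomb I u \<xi>) =
      (\<integral>x. (\<Sum>i\<in>I. \<Sum>j\<in>I. (\<xi> i * \<xi> j) * (\<rho> x * (u i x * u j x))) \<partial>lebesgue)"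
    unfolding mform_def lincomb_def
    by (rule Bochner_Integration.integral_cong)
       (auto simp: sum_product sum_distrib_left algebra_simps intro!: sum.cong)
  also have "\<dots> = (\<Sum>i\<in>I. \<Sum>j\<in>I. \<xi> i * \<xi> j * mform \<rho> (u i) (u j))"
    unfolding mform_def using form_integrable[OF \<rho> u u] by simp
  finally show ?thesis .
qed

lemma gform_sum:
  assumes \<rho>: "density_fun \<rho>" and u: "\<And>i. i \<in> I \<Longrightarrow> u i \<in> test_functions"
  shows "gform \<rho> (lincomb I u \<xi>) (lincomb I u \<xi>) = (\<Sum>i\<in>I. \<Sum>j\<in>I. \<xi> i * \<xi> j * gform \<rho> (u i) (u j))"
proof -
  have "gradient (lincomb I u \<xi>) x = (\<Sum>i\<in>I. \<xi> i *\<^sub>R gradient (u i) x)" for x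
    unfolding lincomb_def[abs_def] using u by (rule gradient_sum)
  then have "gform \<rho> (lincomb I u \<xi>) (lincomb I u \<xi>) =
      (\<integral>x. (\<Sum>i\<in>I. \<Sum>j\<in>I. (\<xi> i * \<xi> j) * (\<rho> x * (gradient (u i) x \<bullet> gradient (u j) x))) \<partial>lebesgue)"
    unfolding gform_def
    by (intro Bochner_Integration.integral_cong)
       (auto simp: inner_sum_left inner_sum_right sum_distrib_left algebra_simps inner_commute intro!: sum.cong)
  also have "\<dots> = (\<Sum>i\<in>I. \<Sum>j\<in>I. \<xi> i * \<xi> j * gform \<rho> (u i) (u j))"
    unfolding gform_def using form_integrable[OF \<rho> u u] by simp
  finally show ?thesis .
qed

lemma mform_nonneg: "density_fun \<rho> \<Longrightarrow> 0 \<le> mform \<rho> u u"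
  unfolding mform_def density_fun_def by (auto intro!: Bochner_Integration.integral_nonneg)

lemma spectral_familyD:
  assumes "spectral_family \<rho> I u t" "i \<in> I" "\<xi> i \<noteq> 0"
  shows "0 < mform \<rho> (lincomb I u \<xi>) (lincomb I u \<xi>)"
    "gform \<rho> (lincomb I u \<xi>) (lincomb I u \<xi>) \<le> t * mform \<rho> (lincomb I u \<xi>) (lincomb I u \<xi>)"
proof -
  have "\<exists>i\<in>I. \<xi> i \<noteq> 0" using assms by blast
  moreover note assms(1)[unfolded spectral_family_def, THEN conjunct2, THEN conjunct2, rule_format, of \<xi>]
  ultimately show "0 < mform \<rho> (lincomb I u \<xi>) (lincomb I u \<xi>)"
    "gform \<rho> (lincomb I u \<xi>) (lincomb I u \<xi>) \<le> t * mform \<rho> (lincomb I u \<xi>) (lincomb I u \<xi>)"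
    by simp_all
qed

lemma spectral_family_subset:
  assumes "spectral_family \<rho> I u t" "J \<subseteq> I"
  shows "spectral_family \<rho> J u t"
  unfolding spectral_family_def
proof (intro conjI allI impI)
  have fin: "finite I" using assms by (auto simp: spectral_family_def)
  then show "finite J" using assms finite_subset by auto
  fix \<xi> :: "'b \<Rightarrow> real" assume \<xi>: "\<exists>i\<in>J. \<xi> i \<noteq> 0"
  have eq: "lincomb J u \<xi> = lincomb I u (\<lambda>i. if i \<in> J then \<xi> i else 0)"
    unfolding lincomb_def fun_eq_iff using fin assms(2)
    by (auto intro!: sum.mono_neutral_cong_left)
  obtain i where i: "i \<in> I" "(if i \<in> J then \<xi> i else 0) \<noteq> 0" using \<xi> assms(2) by auto
  show "0 < mform \<rho> (lincomb J u \<xi>) (lincomb J u \<xi>)"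
    "gform \<rho> (lincomb J u \<xi>) (lincomb J u \<xi>) \<le> t * mform \<rho> (lincomb J u \<xi>) (lincomb J u \<xi>)"
    unfolding eq using spectral_familyD[OF assms(1) i(1), of "\<lambda>i. if i \<in> J then \<xi> i else 0"] i(2) by auto
qed (use assms in \<open>auto simp: spectral_family_def\<close>)

lemma spectral_family_singleton:
  assumes "density_fun \<rho>" "u i \<in> test_functions" "0 < mform \<rho> (u i) (u i)" "gform \<rho> (u i) (u i) \<le> t * mform \<rho> (u i) (u i)"
  shows "spectral_family \<rho> {i} u t"
  unfolding spectral_family_def
proof (intro conjI allI impI)
  fix \<xi> :: "'b \<Rightarrow> real" assume "\<exists>i\<in>{i}. \<xi> i \<noteq> 0"
  then have \<xi>: "0 < \<xi> i * \<xi> i" by (auto simp: zero_less_mult_iff)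
  have m: "mform \<rho> (lincomb {i} u \<xi>) (lincomb {i} u \<xi>) = \<xi> i * \<xi> i * mform \<rho> (u i) (u i)"
    using mform_sum[of \<rho> "{i}" u \<xi>] assms by simp
  have g: "gform \<rho> (lincomb {i} u \<xi>) (lincomb {i} u \<xi>) = \<xi> i * \<xi> i * gform \<rho> (u i) (u i)"
    using gform_sum[of \<rho> "{i}" u \<xi>] assms by simp
  show "0 < mform \<rho> (lincomb {i} u \<xi>) (lincomb {i} u \<xi>)"
    unfolding m by (rule mult_pos_pos[OF \<xi> assms(3)])
  show "gform \<rho> (lincomb {i} u \<xi>) (lincomb {i} u \<xi>) \<le> t * mform \<rho> (lincomb {i} u \<xi>) (lincomb {i} u \<xi>)"
    unfolding m g using mult_left_mono[OF assms(4), of "\<xi> i * \<xi> i"] \<xi> by (simp add: algebra_simps)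
qed (use assms in auto)

text \<open>Disjoint supports make both forms block diagonal, so the inequalities of the blocks add
  up; a block with zero coefficients contributes 0 to both sides. The sets are closed so that the
  gradients vanish outside them as well.\<close>

lemma spectral_family_disjoint_union:
  assumes \<rho>: "density_fun \<rho>" and B: "finite B"
    and fam: "\<And>b. b \<in> B \<Longrightarrow> spectral_family \<rho> (I b) (u b) t"
    and S: "\<And>b. b \<in> B \<Longrightarrow> closed (S b)" "disjoint_family_on S B"
    and supp: "\<And>b i x. b \<in> B \<Longrightarrow> i \<in> I b \<Longrightarrow> x \<notin> S b \<Longrightarrow> u b i x = 0"
  shows "spectral_family \<rho> (Sigma B I) (\<lambda>(b, i). u b i) t"
  unfolding spectral_family_def
proof (intro conjI allI impI)
  have finI: "finite (I b)" if "b \<in> B" for b using fam[OF that] by (auto simp: spectral_family_def)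
  have ut: "u b i \<in> test_functions" if "b \<in> B" "i \<in> I b" for b i
    using fam[OF that(1)] that by (auto simp: spectral_family_def)
  show "finite (Sigma B I)" using B finI by auto
  show "\<forall>i\<in>Sigma B I. (case i of (b, i) \<Rightarrow> u b i) \<in> test_functions" using ut by auto
  fix \<xi> :: "'b \<times> 'c \<Rightarrow> real" assume \<xi>: "\<exists>i\<in>Sigma B I. \<xi> i \<noteq> 0"
  let ?s = "lincomb (Sigma B I) (\<lambda>(b, i). u b i) \<xi>"
  define v where "v b = lincomb (I b) (u b) (\<lambda>i. \<xi> (b, i))" for b
  \<comment> \<open>Collecting the terms of each block leaves a combination of the
    \<open>v b\<close> with all coefficients 1, to which the expansions over \<open>B\<close>
    apply.\<close>
  have s: "?s = lincomb B v (\<lambda>_. 1)"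
  proof (rule ext)
    fix x
    have "?s x = (\<Sum>(b, i)\<in>Sigma B I. \<xi> (b, i) * u b i x)"
      unfolding lincomb_def by (rule sum.cong) auto
    also have "\<dots> = (\<Sum>b\<in>B. \<Sum>i\<in>I b. \<xi> (b, i) * u b i x)"
      by (rule sum.Sigma[symmetric]) (use B finI in auto)
    finally show "?s x = lincomb B v (\<lambda>_. 1) x" by (simp add: lincomb_def v_def)
  qed
  have vt: "v b \<in> test_functions" if "b \<in> B" for b
    unfolding v_def using ut that by (intro lincomb_test_function)
  have v0: "v b x = 0" if "b \<in> B" "x \<notin> S b" for b x
    unfolding v_def lincomb_def using supp that by simp
  have g0: "gradient (v b) x = 0" if "b \<in> B" "x \<notin> S b" for b x
    by (rule gradient_zero_outside[of "S b" "v b", OF S(1)[OF that(1)] v0[OF that(1)] that(2)])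
  have cross: "mform \<rho> (v b) (v c) = 0" "gform \<rho> (v b) (v c) = 0"
    if "b \<in> B" "c \<in> B" "c \<noteq> b" for b c
  proof -
    have "x \<notin> S b \<or> x \<notin> S c" for x
      using S(2) that by (auto simp: disjoint_family_on_def)
    then have z: "v b x * v c x = 0" "gradient (v b) x \<bullet> gradient (v c) x = 0" for x
      using v0[of b x] v0[of c x] g0[of b x] g0[of c x] that by force+
    show "mform \<rho> (v b) (v c) = 0" "gform \<rho> (v b) (v c) = 0"
      unfolding mform_def gform_def z by simp_all
  qed
  have m: "mform \<rho> ?s ?s = (\<Sum>b\<in>B. mform \<rho> (v b) (v b))"
  proof -
    have "mform \<rho> ?s ?s = (\<Sum>b\<in>B. \<Sum>c\<in>B. 1 * 1 * mform \<rho> (v b) (v c))"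
      unfolding s using vt by (rule mform_sum[OF \<rho>])
    also have "\<dots> = (\<Sum>b\<in>B. \<Sum>c\<in>B. if c = b then mform \<rho> (v b) (v b) else 0)"
      by (intro sum.cong refl) (auto simp: cross)
    also have "\<dots> = (\<Sum>b\<in>B. mform \<rho> (v b) (v b))" using B by simp
    finally show ?thesis .
  qed
  have g: "gform \<rho> ?s ?s = (\<Sum>b\<in>B. gform \<rho> (v b) (v b))"
  proof -
    have "gform \<rho> ?s ?s = (\<Sum>b\<in>B. \<Sum>c\<in>B. 1 * 1 * gform \<rho> (v b) (v c))"
      unfolding s using vt by (rule gform_sum[OF \<rho>])
    also have "\<dots> = (\<Sum>b\<in>B. \<Sum>c\<in>B. if c = b then gform \<rho> (v b) (v b) else 0)"
      by (intro sum.cong refl) (auto simp: cross)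
    also have "\<dots> = (\<Sum>b\<in>B. gform \<rho> (v b) (v b))" using B by simp
    finally show ?thesis .
  qed
  have each: "(\<exists>i\<in>I b. \<xi> (b, i) \<noteq> 0) \<Longrightarrow> 0 < mform \<rho> (v b) (v b)"
      "gform \<rho> (v b) (v b) \<le> t * mform \<rho> (v b) (v b)" if b: "b \<in> B" for b
  proof -
    show "0 < mform \<rho> (v b) (v b)" if "\<exists>i\<in>I b. \<xi> (b, i) \<noteq> 0"
      using that spectral_familyD(1)[OF fam[OF b], of _ "\<lambda>i. \<xi> (b, i)"] unfolding v_def by auto
    show "gform \<rho> (v b) (v b) \<le> t * mform \<rho> (v b) (v b)"
    proof (cases "\<exists>i\<in>I b. \<xi> (b, i) \<noteq> 0")
      case True
      then show ?thesis using spectral_familyD(2)[OF fam[OF b], of _ "\<lambda>i. \<xi> (b, i)"] unfolding v_def by auto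
    next
      case False
      have "mform \<rho> (v b) (v b) = 0" "gform \<rho> (v b) (v b) = 0"
        unfolding v_def using False ut b by (simp_all add: mform_sum[OF \<rho>] gform_sum[OF \<rho>])
      then show ?thesis by simp
    qed
  qed
  show "0 < mform \<rho> ?s ?s"
    unfolding m using \<xi> each(1) B mform_nonneg[OF \<rho>] by (auto intro!: sum_pos2)
  show "gform \<rho> ?s ?s \<le> t * mform \<rho> ?s ?s"
    unfolding m g sum_distrib_left by (rule sum_mono) (rule each(2))
qed

section \<open>Eigenvalues in terms of spectral families\<close>

lemma gradient_zero_ae_on_zero_set:
  fixes u :: "'a::euclidean_space \<Rightarrow> real"
  assumes u: "u \<in> test_functions"
  shows "AE x in lebesgue. u x = 0 \<longrightarrow> gradient u x = 0"
proof -
  let ?D = "\<lambda>x. frechet_derivative u (at x)"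
  have "AE x in lebesgue. u x = 0 \<longrightarrow> ?D x b = 0" if b: "b \<in> Basis" for b
  proof -
    \<comment> \<open>Replacing the coordinate along \<open>b\<close> by \<open>u\<close> is a local diffeomorphism where the partial
      derivative is nonzero, and it maps the zero set of \<open>u\<close> into a hyperplane.\<close>
    define h where "h x = x + (u x - x \<bullet> b) *\<^sub>R b" for x
    have "negligible {x \<in> {x. ?D x b \<noteq> 0}. h x \<in> {y. y \<bullet> b = 0}}"
    proof (rule negligible_differentiable_vimage)
      show "negligible {y. y \<bullet> b = 0}" by (rule negligible_standard_hyperplane[OF b])
      fix x assume x: "x \<in> {x. ?D x b \<noteq> 0}"
      have lin: "linear (?D x)" using test_functionsD(3)[OF u] by (rule has_derivative_linear)
      show "(h has_derivative (\<lambda>y. y + (?D x y - y \<bullet> b) *\<^sub>R b)) (at x within {x. ?D x b \<noteq> 0})"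
        unfolding h_def
        by (rule has_derivative_at_withinI)
           (auto intro!: derivative_eq_intros test_functionsD(3)[OF u])
      have lin': "linear (\<lambda>y. y + (?D x y - y \<bullet> b) *\<^sub>R b)"
        using lin by (auto simp: linear_iff algebra_simps inner_add_left)
      show "inj (\<lambda>y. y + (?D x y - y \<bullet> b) *\<^sub>R b)"
        unfolding linear_injective_0[OF lin']
      proof (intro allI impI)
        fix y assume y: "y + (?D x y - y \<bullet> b) *\<^sub>R b = 0"
        then have "(y + (?D x y - y \<bullet> b) *\<^sub>R b) \<bullet> b = 0" by simp
        then have D0: "?D x y = 0" using b by (simp add: inner_add_left)
        then have y': "y = (y \<bullet> b) *\<^sub>R b" using y by simp
        then have "?D x y = (y \<bullet> b) * ?D x b"
          using linear_scale[OF lin, of "y \<bullet> b" b] by simp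
        then have "y \<bullet> b = 0" using D0 x by simp
        then show "y = 0" using y' by simp
      qed
    qed
    then have "{x. ?D x b \<noteq> 0 \<and> h x \<bullet> b = 0} \<in> null_sets lebesgue"
      by (simp add: negligible_iff_null_sets)
    moreover have "h x \<bullet> b = u x" for x using b by (simp add: h_def inner_add_left)
    ultimately show ?thesis by (intro AE_I'[of "{x. ?D x b \<noteq> 0 \<and> u x = 0}"]) auto
  qed
  then have "AE x in lebesgue. \<forall>b\<in>Basis. u x = 0 \<longrightarrow> ?D x b = 0"
    by (intro AE_finite_allI) auto
  then show ?thesis by eventually_elim (simp add: gradient_def)
qed

lemma restr_eq_iff:
  assumes "density_fun \<rho>"
  shows "restr \<rho> u = restr \<rho> v \<longleftrightarrow> (AE x in lebesgue. \<rho> x \<noteq> 0 \<longrightarrow> u x = v x)"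
proof -
  have "\<rho> x > 0 \<longleftrightarrow> \<rho> x \<noteq> 0" for x using assms by (auto simp: density_fun_def less_le)
  then show ?thesis
    unfolding restr_def ae_fun.abs_eq_iff
    by (intro AE_cong) (auto simp: indicator_def)
qed

lemma zero_ae_fun_eq_restr: "0 = restr \<rho> (\<lambda>x. 0)"
  by (simp add: restr_def zero_ae_fun.abs_eq)

lemma restr_lincomb: "finite I \<Longrightarrow> (\<Sum>i\<in>I. \<xi> i *\<^sub>R restr \<rho> (u i)) = restr \<rho> (lincomb I u \<xi>)"
proof (induction I rule: finite_induct)
  case empty
  then show ?case by (simp add: lincomb_def[abs_def] zero_ae_fun_eq_restr[symmetric])
next
  case (insert i I)
  then show ?case
    by (simp add: restr_def lincomb_def[abs_def] scaleR_ae_fun.abs_eq plus_ae_fun.abs_eq algebra_simps)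
qed

text \<open>The delicate form is the one with gradients: two representatives agree a.e. where the
  density is positive, so their difference vanishes there, and the gradient of a smooth function
  vanishes a.e. on its zero set.\<close>

lemma forms_cong_restr:
  assumes \<rho>: "density_fun \<rho>" and u: "u \<in> test_functions" and v: "v \<in> test_functions"
    and eq: "restr \<rho> u = restr \<rho> v"
  shows "mform \<rho> u u = mform \<rho> v v" "gform \<rho> u u = gform \<rho> v v"
proof -
  have ae: "AE x in lebesgue. \<rho> x \<noteq> 0 \<longrightarrow> u x = v x" using eq restr_eq_iff[OF \<rho>] by blast
  have w: "(\<lambda>x. u x - v x) \<in> test_functions"
    using test_functions_add[OF u test_functions_scale[OF v, of "-1"]] by simp
  have gw: "gradient (\<lambda>x. u x - v x) x = gradient u x - gradient v x" for x
    using gradient_sum[of "{True, False}" "\<lambda>b. if b then u else v" "\<lambda>b. if b then 1 else -1" x] u v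
    by simp
  have ae': "AE x in lebesgue. \<rho> x \<noteq> 0 \<longrightarrow> gradient u x = gradient v x"
    using ae gradient_zero_ae_on_zero_set[OF w] by eventually_elim (simp add: gw)
  have [measurable]: "\<rho> \<in> borel_measurable lebesgue" using \<rho> by (simp add: density_fun_def)
  show "mform \<rho> u u = mform \<rho> v v" unfolding mform_def
    by (rule integral_cong_AE) (use form_integrable(1)[OF \<rho>] u v ae in auto)
  show "gform \<rho> u u = gform \<rho> v v" unfolding gform_def
    by (rule integral_cong_AE) (use form_integrable(2)[OF \<rho>] u v ae' in auto)
qed

lemma mform_pos:
  assumes \<rho>: "density_fun \<rho>" and u: "u \<in> test_functions" and ne: "restr \<rho> u \<noteq> 0"
  shows "0 < mform \<rho> u u"
proof (rule ccontr)
  assume "\<not> 0 < mform \<rho> u u"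
  then have "(\<integral>x. \<rho> x * (u x * u x) \<partial>lebesgue) = 0"
    using mform_nonneg[OF \<rho>, of u] by (simp add: mform_def)
  then have "AE x in lebesgue. \<rho> x * (u x * u x) = 0"
    using \<rho> by (subst (asm) integral_nonneg_eq_0_iff_AE)
      (auto simp: density_fun_def intro!: form_integrable(1)[OF \<rho> u u])
  then have "AE x in lebesgue. \<rho> x \<noteq> 0 \<longrightarrow> u x = 0" by eventually_elim auto
  then have "restr \<rho> u = restr \<rho> (\<lambda>x. 0)" by (simp add: restr_eq_iff[OF \<rho>])
  then show False using ne by (simp add: zero_ae_fun_eq_restr[symmetric])
qed

text \<open>Positivity makes the restrictions of l + 1 members independent, so their span competes
  in the infimum for \<open>mu l\<close>. Any representative of a class in the span has the same
  forms as a linear combination of the family, which bounds its quotient.\<close>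

lemma mu_le_spectral_family:
  assumes \<rho>: "density_fun \<rho>" and fam: "spectral_family \<rho> I u t" and card: "l < card I"
  shows "mu l \<rho> \<le> ennreal t"
proof -
  obtain J where J: "J \<subseteq> I" "card J = Suc l"
    using obtain_subset_with_card_n[of "Suc l" I] card by auto
  have famJ: "spectral_family \<rho> J u t" by (rule spectral_family_subset[OF fam J(1)])
  have fin: "finite J" and ut: "\<And>i. i \<in> J \<Longrightarrow> u i \<in> test_functions"
    using famJ by (auto simp: spectral_family_def)
  note pos = spectral_familyD[OF famJ]
  define c where "c i = restr \<rho> (u i)" for i
  have sumc: "(\<Sum>i\<in>J. \<xi> i *\<^sub>R c i) = restr \<rho> (lincomb J u \<xi>)" for \<xi>
    unfolding c_def by (rule restr_lincomb[OF fin])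
  have indep: "\<forall>i\<in>J. \<xi> i = 0" if "(\<Sum>i\<in>J. \<xi> i *\<^sub>R c i) = 0" for \<xi>
  proof (rule ccontr)
    assume "\<not> (\<forall>i\<in>J. \<xi> i = 0)"
    then have p: "0 < mform \<rho> (lincomb J u \<xi>) (lincomb J u \<xi>)" using pos(1) by blast
    have "restr \<rho> (lincomb J u \<xi>) = restr \<rho> (\<lambda>x. 0)"
      using that by (simp add: sumc zero_ae_fun_eq_restr[symmetric])
    from forms_cong_restr(1)[OF \<rho> lincomb_test_function[OF ut] test_functions_zero this]
    show False using p by (simp add: mform_def)
  qed
  have inj: "inj_on c J"
  proof (rule inj_onI, rule ccontr)
    fix i j assume ij: "i \<in> J" "j \<in> J" "c i = c j" "i \<noteq> j"
    \<comment> \<open>Two equal classes would give a vanishing combination with coefficients 1 and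
      -1, contradicting \<open>indep\<close>.\<close>
    have "(\<Sum>k\<in>J. ((if k = i then 1 else 0) - (if k = j then 1 else 0)) *\<^sub>R c k)
        = (\<Sum>k\<in>J. if k = i then c k else 0) - (\<Sum>k\<in>J. if k = j then c k else 0)"
      unfolding sum_subtractf[symmetric] by (rule sum.cong) auto
    also have "\<dots> = 0" using ij fin by simp
    finally have "(\<Sum>k\<in>J. ((if k = i then 1 else 0) - (if k = j then 1 else 0)) *\<^sub>R c k) = 0" .
    from indep[OF this] show False using ij by auto
  qed
  have ind: "independent (c ` J)"
  proof (rule independent_if_scalars_zero)
    fix f x assume "(\<Sum>x\<in>c ` J. f x *\<^sub>R x) = 0" "x \<in> c ` J"
    then have "(\<Sum>i\<in>J. f (c i) *\<^sub>R c i) = 0" by (simp add: sum.reindex[OF inj])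
    from indep[OF this] \<open>x \<in> c ` J\<close> show "f x = 0" by auto
  qed (use fin in auto)
  have rep: "\<exists>\<xi>. s = restr \<rho> (lincomb J u \<xi>)" if "s \<in> span (c ` J)" for s
  proof -
    have "finite (c ` J)" using fin by simp
    from that[unfolded span_finite[OF this]] obtain f where "s = (\<Sum>x\<in>c ` J. f x *\<^sub>R x)" by (rule rangeE)
    then have "s = (\<Sum>i\<in>J. f (c i) *\<^sub>R c i)" by (simp add: sum.reindex[OF inj])
    then show ?thesis using sumc[of "\<lambda>i. f (c i)"] by auto
  qed
  have S: "span (c ` J) \<in> subspaces \<rho> (Suc l)"
    unfolding subspaces_def mem_Collect_eq
  proof (intro conjI subsetI)
    show "dim (span (c ` J)) = Suc l"
      using dim_span_eq_card_independent[OF ind] card_image[OF inj] J(2) by simp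
    fix s assume "s \<in> span (c ` J)"
    from rep[OF this] obtain \<xi> where s: "s = restr \<rho> (lincomb J u \<xi>)" ..
    have "lincomb J u \<xi> \<in> test_functions" by (rule lincomb_test_function) (rule ut)
    then show "s \<in> restr \<rho> ` test_functions" unfolding s by (rule imageI)
  qed simp
  \<comment> \<open>For an a.e. vanishing density \<open>mu\<close> is infinite by definition, so
    this branch has to be excluded before a competitor counts.\<close>
  have nz: "\<not> (AE x in lebesgue. \<rho> x = 0)"
  proof
    assume ae: "AE x in lebesgue. \<rho> x = 0"
    obtain j where j: "j \<in> J" using J(2) by fastforce
    then have "0 < mform \<rho> (lincomb J u (\<lambda>_. 1)) (lincomb J u (\<lambda>_. 1))" using pos(1)[of j "\<lambda>_. 1"] by auto
    moreover have "mform \<rho> (lincomb J u (\<lambda>_. 1)) (lincomb J u (\<lambda>_. 1)) = 0"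
      unfolding mform_def by (rule integral_eq_zero_AE) (use ae in eventually_elim, simp)
    ultimately show False by simp
  qed
  have "(SUP v\<in>{v \<in> test_functions. restr \<rho> v \<in> span (c ` J) - {0}}. ennreal (rayleigh \<rho> v)) \<le> ennreal t"
  proof (rule SUP_least)
    fix v assume v: "v \<in> {v \<in> test_functions. restr \<rho> v \<in> span (c ` J) - {0}}"
    then have "restr \<rho> v \<in> span (c ` J)" by simp
    from rep[OF this] obtain \<xi> where \<xi>: "restr \<rho> v = restr \<rho> (lincomb J u \<xi>)" ..
    have "\<exists>i\<in>J. \<xi> i \<noteq> 0"
    proof (rule ccontr)
      assume "\<not> (\<exists>i\<in>J. \<xi> i \<noteq> 0)"
      then have "restr \<rho> (lincomb J u \<xi>) = 0" unfolding sumc[symmetric] by simp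
      then show False using v \<xi> by simp
    qed
    then obtain i where "i \<in> J" "\<xi> i \<noteq> 0" by blast
    note p = pos[of i \<xi>, OF this]
    have "rayleigh \<rho> v = gform \<rho> (lincomb J u \<xi>) (lincomb J u \<xi>) / mform \<rho> (lincomb J u \<xi>) (lincomb J u \<xi>)"
      unfolding rayleigh_eq using forms_cong_restr[OF \<rho> _ lincomb_test_function[OF ut] \<xi>] v by simp
    also have "\<dots> \<le> t" using p by (simp add: divide_le_eq)
    finally show "ennreal (rayleigh \<rho> v) \<le> ennreal t" by (rule ennreal_leI)
  qed
  then show ?thesis unfolding mu_def using nz S by (auto intro: INF_lower2)
qed

text \<open>Converse to \<open>mu_le_spectral_family\<close>. The strict inequality selects a
  subspace whose supremum is below \<open>t\<close>, whether or not the infimum is attained; smooth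
  representatives of a basis form the family.\<close>

lemma mu_less_imp_spectral_family:
  assumes \<rho>: "density_fun \<rho>" and less: "mu l \<rho> < ennreal t"
  obtains u where "spectral_family \<rho> {..<Suc l} u t"
proof -
  have "\<not> (AE x in lebesgue. \<rho> x = 0)" using less by (auto simp: mu_def)
  then obtain S where S: "S \<in> subspaces \<rho> (Suc l)"
    and sup: "(SUP v\<in>{v \<in> test_functions. restr \<rho> v \<in> S - {0}}. ennreal (rayleigh \<rho> v)) < ennreal t"
    using less by (auto simp: mu_def INF_less_iff)
  have sub: "subspace S" and dimS: "dim S = Suc l" and rng: "S \<subseteq> restr \<rho> ` test_functions"
    using S by (auto simp: subspaces_def)
  obtain B where B: "B \<subseteq> S" "independent B" "card B = Suc l"
    using basis_exists[of S] dimS by metis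
  have finB: "finite B" using B(3) by (metis card.infinite nat.distinct(1))
  obtain e where e: "bij_betw e {..<Suc l} B"
    using ex_bij_betw_nat_finite[OF finB] B(3) by (auto simp: atLeast0LessThan)
  have "\<exists>v\<in>test_functions. restr \<rho> v = e i" if "i < Suc l" for i
    using bij_betwE[OF e] that B(1) rng by (fastforce simp: image_iff)
  then obtain u where u: "\<And>i. i < Suc l \<Longrightarrow> u i \<in> test_functions \<and> restr \<rho> (u i) = e i" by metis
  have "spectral_family \<rho> {..<Suc l} u t" unfolding spectral_family_def
  proof (intro conjI allI impI)
    fix \<xi> :: "nat \<Rightarrow> real" assume \<xi>: "\<exists>i\<in>{..<Suc l}. \<xi> i \<noteq> 0"
    let ?s = "lincomb {..<Suc l} u \<xi>"
    have st: "?s \<in> test_functions" using u by (intro lincomb_test_function) auto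
    have rs: "restr \<rho> ?s = (\<Sum>i<Suc l. \<xi> i *\<^sub>R e i)"
      using restr_lincomb[of "{..<Suc l}" \<xi> \<rho> u] u by simp
    have "restr \<rho> ?s \<noteq> 0"
    proof
      assume "restr \<rho> ?s = 0"
      \<comment> \<open>The coefficients are moved to the basis elements along the enumeration
        \<open>e\<close>, so that independence of \<open>B\<close> applies.\<close>
      let ?f = "\<lambda>b. \<xi> (the_inv_into {..<Suc l} e b)"
      have "(\<Sum>b\<in>B. ?f b *\<^sub>R b) = (\<Sum>i<Suc l. ?f (e i) *\<^sub>R e i)"
        using sum.reindex_bij_betw[OF e, of "\<lambda>b. ?f b *\<^sub>R b"] by simp
      also have "\<dots> = (\<Sum>i<Suc l. \<xi> i *\<^sub>R e i)"
        using e by (intro sum.cong) (auto simp: the_inv_into_f_f bij_betw_def)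
      finally have sum0: "(\<Sum>b\<in>B. ?f b *\<^sub>R b) = 0" using \<open>restr \<rho> ?s = 0\<close> rs by simp
      obtain i where i: "i < Suc l" "\<xi> i \<noteq> 0" using \<xi> by auto
      have "e i \<in> B" using e i by (auto dest: bij_betwE)
      with independentD[OF B(2) finB subset_refl sum0] have "?f (e i) = 0" by blast
      then show False using i e by (simp add: the_inv_into_f_f bij_betw_def)
    qed
    moreover have "restr \<rho> ?s \<in> S"
      unfolding rs using bij_betwE[OF e] B(1) by (intro subspace_sum subspace_scale sub) auto
    ultimately have "ennreal (rayleigh \<rho> ?s) < ennreal t"
      using st by (intro le_less_trans[OF SUP_upper sup]) auto
    then have r: "rayleigh \<rho> ?s \<le> t"
      using ennreal_leI[of t "rayleigh \<rho> ?s"] by (metis leD le_cases)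
    show pos: "0 < mform \<rho> ?s ?s" by (rule mform_pos[OF \<rho> st \<open>restr \<rho> ?s \<noteq> 0\<close>])
    show "gform \<rho> ?s ?s \<le> t * mform \<rho> ?s ?s"
      using r pos by (simp add: rayleigh_eq divide_le_eq)
  qed (use u in auto)
  then show thesis by (rule that)
qed

subsection \<open>Mass distribution and small eigenvalues\<close>

definition mass_measure :: "('a::euclidean_space \<Rightarrow> real) \<Rightarrow> 'a measure" where
  "mass_measure \<rho> = density lebesgue (\<lambda>x. ennreal (\<rho> x))"

abbreviation mass :: "('a::euclidean_space \<Rightarrow> real) \<Rightarrow> 'a set \<Rightarrow> real" where
  "mass \<rho> A \<equiv> measure (mass_measure \<rho>) A"

definition finite_density :: "('a::euclidean_space \<Rightarrow> real) \<Rightarrow> bool" where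
  "finite_density \<rho> \<longleftrightarrow> density_fun \<rho> \<and> integrable lebesgue \<rho>"

lemma sets_mass_measure [simp, measurable_cong]: "sets (mass_measure \<rho>) = sets lebesgue"
  by (simp add: mass_measure_def)

lemma space_mass_measure [simp]: "space (mass_measure \<rho>) = UNIV"
  by (simp add: mass_measure_def)

lemma finite_density_integrable_mult:
  "finite_density \<rho> \<Longrightarrow> A \<in> sets lebesgue \<Longrightarrow> integrable lebesgue (\<lambda>x. \<rho> x * indicator A x)"
  unfolding finite_density_def
  by (auto intro!: integrable_real_mult_indicator)

lemma emeasure_mass_measure:
  assumes "finite_density \<rho>" "A \<in> sets lebesgue"
  shows "emeasure (mass_measure \<rho>) A = ennreal (\<integral>x. \<rho> x * indicator A x \<partial>lebesgue)"
proof -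
  have "emeasure (mass_measure \<rho>) A = (\<integral>\<^sup>+x. ennreal (\<rho> x) * indicator A x \<partial>lebesgue)"
    unfolding mass_measure_def using assms
    by (intro emeasure_density) (auto simp: finite_density_def density_fun_def)
  also have "\<dots> = (\<integral>\<^sup>+x. ennreal (\<rho> x * indicator A x) \<partial>lebesgue)"
    by (intro nn_integral_cong) (auto simp: indicator_def)
  also have "\<dots> = ennreal (\<integral>x. \<rho> x * indicator A x \<partial>lebesgue)"
    using assms finite_density_integrable_mult[OF assms]
    by (intro nn_integral_eq_integral) (auto simp: finite_density_def density_fun_def)
  finally show ?thesis .
qed

lemma mass_eq_integral:
  assumes "finite_density \<rho>" "A \<in> sets lebesgue"
  shows "mass \<rho> A = (\<integral>x. \<rho> x * indicator A x \<partial>lebesgue)"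
proof -
  have "0 \<le> (\<integral>x. \<rho> x * indicator A x \<partial>lebesgue)"
    using assms(1) by (auto intro!: Bochner_Integration.integral_nonneg simp: finite_density_def density_fun_def)
  then show ?thesis using emeasure_mass_measure[OF assms] by (simp add: measure_def)
qed

lemma finite_measure_mass: "finite_density \<rho> \<Longrightarrow> finite_measure (mass_measure \<rho>)"
  using emeasure_mass_measure[of \<rho> UNIV] by (intro finite_measureI) simp

lemma mass_le_content:
  fixes \<rho> :: "'a::euclidean_space \<Rightarrow> real"
  assumes "finite_density \<rho>" "R \<ge> 0"
  shows "mass \<rho> (cball a R) \<le> unit_ball_vol (DIM('a)) * R ^ DIM('a)"
proof -
  have "emeasure (mass_measure \<rho>) (cball a R) \<le> (\<integral>\<^sup>+x. indicator (cball a R) x \<partial>lebesgue)"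
  proof -
    have r: "\<rho> \<in> borel_measurable lebesgue" "\<And>x. \<rho> x \<le> 1"
      using assms by (auto simp: finite_density_def density_fun_def)
    have "emeasure (mass_measure \<rho>) (cball a R) = (\<integral>\<^sup>+x. ennreal (\<rho> x) * indicator (cball a R) x \<partial>lebesgue)"
      unfolding mass_measure_def using r by (intro emeasure_density) auto
    also have "\<dots> \<le> (\<integral>\<^sup>+x. indicator (cball a R) x \<partial>lebesgue)"
      using r(2) by (intro nn_integral_mono) (auto simp: indicator_def)
    finally show ?thesis .
  qed
  also have "\<dots> = ennreal (unit_ball_vol (DIM('a)) * R ^ DIM('a))"
    using emeasure_cball[OF assms(2), of a] by simp
  finally show ?thesis
    using finite_measure.emeasure_eq_measure[OF finite_measure_mass[OF assms(1)], of "cball a R"] assms(2)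
    by (simp add: ennreal_le_iff)
qed

text \<open>The bound is fixed once by choice, so that later constants depend on no centre, radius
  or density. Arguments up to 4 are those that occur in \<open>bump\<close>.\<close>

definition flat_sup :: real where
  "flat_sup = (SOME C. C > 0 \<and> (\<forall>t\<le>4. \<bar>flat 1 t\<bar> \<le> C))"

lemma flat_sup: "flat_sup > 0" "t \<le> 4 \<Longrightarrow> \<bar>flat 1 t\<bar> \<le> flat_sup"
proof -
  have "\<exists>C. C > 0 \<and> (\<forall>t\<le>4. \<bar>flat 1 t\<bar> \<le> C)" using flat_bounded by simp
  from someI_ex[OF this] show "flat_sup > 0" "t \<le> 4 \<Longrightarrow> \<bar>flat 1 t\<bar> \<le> flat_sup"
    unfolding flat_sup_def by simp_all
qed

text \<open>The factor 16 and the square come from the squared gradient bound (4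
  \<open>flat_sup\<close> / R)^2; exp(2/3) is the inverse of the squared lower bound of the bump on
  the inner ball.\<close>

definition bump_const :: real where
  "bump_const = 16 * flat_sup\<^sup>2 * exp (2 / 3)"

lemma bump_const_pos: "bump_const > 0"
  using flat_sup(1) by (simp add: bump_const_def)

text \<open>The numerator lives on the ball of radius 2R and is of order its mass over R^2; the
  denominator is at least a multiple of the mass of the inner ball. The doubling inequality compares
  the two masses.\<close>

lemma spectral_family_bump:
  assumes \<rho>: "finite_density \<rho>" and R: "R > 0" and pos: "0 < mass \<rho> (cball a R)"
    and doubling: "mass \<rho> (cball a (2 * R)) \<le> C * mass \<rho> (cball a R)"
  shows "spectral_family \<rho> {i} (\<lambda>_. bump a R) (bump_const * C / R\<^sup>2)"
proof (rule spectral_family_singleton)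
  let ?u = "bump a R"
  show d: "density_fun \<rho>" using \<rho> by (simp add: finite_density_def)
  then have r: "0 \<le> \<rho> x" for x by (simp add: density_fun_def)
  show u: "?u \<in> test_functions" by (rule bump_test_function[OF R])
  have lower: "exp (- (2 / 3)) * mass \<rho> (cball a R) \<le> mform \<rho> ?u ?u"
  proof -
    have "(\<integral>x. exp (- (2 / 3)) * (\<rho> x * indicator (cball a R) x) \<partial>lebesgue) \<le> mform \<rho> ?u ?u"
      unfolding mform_def
    proof (rule integral_mono)
      show "integrable lebesgue (\<lambda>x. exp (- (2 / 3)) * (\<rho> x * indicator (cball a R) x))"
        using finite_density_integrable_mult[OF \<rho>, of "cball a R"] by simp
      show "integrable lebesgue (\<lambda>x. \<rho> x * (?u x * ?u x))" by (rule form_integrable(1)[OF d u u])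
      show "exp (- (2 / 3)) * (\<rho> x * indicator (cball a R) x) \<le> \<rho> x * (?u x * ?u x)" for x
      proof (cases "x \<in> cball a R")
        case True
        have "exp (- (1 / 3)) * exp (- (1 / 3)) \<le> ?u x * ?u x"
          by (intro mult_mono bump_lower[OF R True]) (auto intro: order_trans[OF _ bump_lower[OF R True]])
        then have "exp (- (2 / 3)) \<le> ?u x * ?u x" by (simp add: exp_add[symmetric])
        from mult_left_mono[OF this r[of x]] show ?thesis using True by (simp add: mult.commute)
      qed (use r in simp)
    qed
    then show ?thesis using mass_eq_integral[OF \<rho>, of "cball a R"] by simp
  qed
  have "0 < exp (- (2 / 3)) * mass \<rho> (cball a R)" by (rule mult_pos_pos[OF exp_gt_zero pos])
  then show "0 < mform \<rho> ?u ?u" using lower by linarith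
  have upper: "gform \<rho> ?u ?u \<le> (4 * flat_sup / R)\<^sup>2 * mass \<rho> (cball a (2 * R))"
  proof -
    have "gform \<rho> ?u ?u \<le> (\<integral>x. (4 * flat_sup / R)\<^sup>2 * (\<rho> x * indicator (cball a (2 * R)) x) \<partial>lebesgue)"
      unfolding gform_def
    proof (rule integral_mono)
      show "integrable lebesgue (\<lambda>x. (4 * flat_sup / R)\<^sup>2 * (\<rho> x * indicator (cball a (2 * R)) x))"
        using finite_density_integrable_mult[OF \<rho>, of "cball a (2 * R)"] by simp
      show "integrable lebesgue (\<lambda>x. \<rho> x * (gradient ?u x \<bullet> gradient ?u x))" by (rule form_integrable(2)[OF d u u])
      show "\<rho> x * (gradient ?u x \<bullet> gradient ?u x) \<le> (4 * flat_sup / R)\<^sup>2 * (\<rho> x * indicator (cball a (2 * R)) x)" for x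
      proof (cases "x \<in> cball a (2 * R)")
        case True
        have "(norm (gradient ?u x))\<^sup>2 \<le> (4 * flat_sup / R)\<^sup>2"
          by (intro power_mono bump_gradient[OF flat_sup(2) R]) auto
        from mult_left_mono[OF this r[of x]] show ?thesis
          using True by (simp add: power2_norm_eq_inner mult.commute)
      next
        case False
        have "gradient ?u x = 0"
          by (rule gradient_zero_outside[of "cball a (2 * R)" ?u, OF closed_cball bump_support[OF R] False])
        then show ?thesis using False by simp
      qed
    qed
    then show ?thesis using mass_eq_integral[OF \<rho>, of "cball a (2 * R)"] by simp
  qed
  have C: "0 \<le> C"
  proof (rule ccontr)
    assume "\<not> 0 \<le> C"
    then have "C * mass \<rho> (cball a R) < 0" using pos by (simp add: mult_neg_pos)
    then show False using doubling measure_nonneg[of "mass_measure \<rho>" "cball a (2 * R)"] by linarith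
  qed
  have "gform \<rho> ?u ?u \<le> (4 * flat_sup / R)\<^sup>2 * (C * mass \<rho> (cball a R))"
    by (rule order_trans[OF upper]) (intro mult_left_mono doubling zero_le_power2)
  also have "\<dots> = bump_const * C / R\<^sup>2 * (exp (- (2 / 3)) * mass \<rho> (cball a R))"
    by (simp add: bump_const_def power_mult_distrib power_divide exp_minus field_simps)
  also have "\<dots> \<le> bump_const * C / R\<^sup>2 * mform \<rho> ?u ?u"
    using C bump_const_pos by (intro mult_left_mono lower) simp_all
  finally show "gform \<rho> ?u ?u \<le> bump_const * C / R\<^sup>2 * mform \<rho> ?u ?u" .
qed

text \<open>Integrating \<open>mass (cball a R)\<close> and \<open>mass (cball a (2 * R))\<close> over all admissible centres
  \<open>a\<close> shows that the doubling inequality cannot fail everywhere.\<close>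

lemma exists_doubling_ball:
  fixes \<rho> :: "'a::euclidean_space \<Rightarrow> real"
  assumes \<rho>: "finite_density \<rho>" and m: "mass \<rho> UNIV \<le> m" and R: "R > 0" and \<delta>: "\<delta> > 0"
    and P: "finite P" and core: "\<delta> \<le> mass \<rho> {x. \<forall>p\<in>P. 5 * R < dist p x}"
  shows "\<exists>a. (\<forall>p\<in>P. 4 * R < dist p a) \<and> 0 < mass \<rho> (cball a R) \<and>
    mass \<rho> (cball a (2 * R)) \<le> (2 ^ DIM('a) * m / \<delta> + 1) * mass \<rho> (cball a R)"
proof (rule ccontr)
  \<comment> \<open>If doubling failed at every admissible centre, integration would give C \<delta>
    \<le> 2^N m with N the dimension; the summand 1 makes the left side exceed the right by
    \<delta>.\<close>
  define C where "C = 2 ^ DIM('a) * m / \<delta> + 1"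
  have m0: "0 \<le> m" using m measure_nonneg order_trans by blast
  have C0: "0 \<le> C" unfolding C_def using m0 \<delta> by simp
  assume neg: "\<not> ?thesis"
  have no: "C * mass \<rho> (cball a R) \<le> mass \<rho> (cball a (2 * R))" if "\<forall>p\<in>P. 4 * R < dist p a" for a
  proof (cases "mass \<rho> (cball a R) = 0")
    case False
    then have "0 < mass \<rho> (cball a R)" by (simp add: less_le)
    then have "\<not> mass \<rho> (cball a (2 * R)) \<le> C * mass \<rho> (cball a R)"
      using neg that unfolding C_def by blast
    then show ?thesis by simp
  qed simp
  have rho_meas: "\<rho> \<in> borel_measurable (completion lborel)" and rho0: "\<And>x. 0 \<le> \<rho> x"
    using \<rho> by (auto simp: finite_density_def density_fun_def)
  \<comment> \<open>A Borel version of the density: Fubini is applied on a product of Borel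
    sigma-algebras, whereas \<rho> is only Lebesgue measurable.\<close>
  obtain \<rho>' where \<rho>' [measurable]: "\<rho>' \<in> borel_measurable lborel" and ae: "AE x in lborel. \<rho> x = \<rho>' x"
    using completion_ex_borel_measurable_real[OF rho_meas] by blast
  define \<nu> where "\<nu> = density lborel (\<lambda>x. ennreal (\<rho>' x))"
  have sets_nu [measurable_cong, simp]: "sets \<nu> = sets borel" by (simp add: \<nu>_def)
  interpret M: finite_measure "mass_measure \<rho>" by (rule finite_measure_mass[OF \<rho>])
  have nu: "emeasure \<nu> A = ennreal (mass \<rho> A)" if A: "A \<in> sets borel" for A
  proof -
    have "emeasure \<nu> A = (\<integral>\<^sup>+x. ennreal (\<rho>' x) * indicator A x \<partial>lborel)"
      unfolding \<nu>_def using A by (intro emeasure_density) auto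
    also have "\<dots> = (\<integral>\<^sup>+x. ennreal (\<rho>' x) * indicator A x \<partial>lebesgue)"
      by (rule nn_integral_completion[symmetric])
    also have "\<dots> = (\<integral>\<^sup>+x. ennreal (\<rho> x) * indicator A x \<partial>lebesgue)"
    proof (rule nn_integral_cong_AE)
      have "AE x in lebesgue. \<rho> x = \<rho>' x" using ae by (rule AE_completion)
      then show "AE x in lebesgue. ennreal (\<rho>' x) * indicator A x = ennreal (\<rho> x) * indicator A x"
        by eventually_elim simp
    qed
    also have "\<dots> = emeasure (mass_measure \<rho>) A"
      unfolding mass_measure_def using A rho_meas by (intro emeasure_density[symmetric]) auto
    finally show ?thesis by (simp add: M.emeasure_eq_measure)
  qed
  interpret N: finite_measure \<nu>
    using nu[of UNIV] by (intro finite_measureI) (simp add: \<nu>_def)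
  interpret PS: pair_sigma_finite lborel \<nu> ..
  \<comment> \<open>\<open>G\<close> is the set of admissible centres and \<open>D\<close> the core.
    The margin 5R - 4R = R ensures that the ball of radius R about a point of \<open>D\<close> lies
    entirely in \<open>G\<close>.\<close>
  define G where "G = {a. \<forall>p\<in>P. 4 * R < dist p a}"
  have "G = (\<Inter>p\<in>P. {a. 4 * R < dist p a})" by (auto simp: G_def)
  moreover have "open {a. 4 * R < dist p a}" for p :: 'a
    by (intro open_Collect_less continuous_intros)
  ultimately have G: "open G" using P by auto
  have G' [measurable]: "G \<in> sets borel" using G by simp
  define D where "D = {x. \<forall>p\<in>P. 5 * R < dist p x}"
  have "D = (\<Inter>p\<in>P. {a. 5 * R < dist p a})" by (auto simp: D_def)
  moreover have "open {a. 5 * R < dist p a}" for p :: 'a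
    by (intro open_Collect_less continuous_intros)
  ultimately have "open D" using P by auto
  then have D [measurable]: "D \<in> sets borel" by simp
  define \<beta> where "\<beta> = unit_ball_vol (DIM('a)) * R ^ DIM('a)"
  have \<beta>: "\<beta> > 0" unfolding \<beta>_def using R by simp
  define J where "J r = (\<integral>\<^sup>+a. indicator G a * emeasure \<nu> (cball a r) \<partial>lborel)" for r
  \<comment> \<open>After exchanging the integrals, J r averages over x the volume of the admissible
    centres within distance r of x. This is the full volume \<beta> for r = R and x in
    \<open>D\<close>, and at most 2^N \<beta> for r = 2R and any x.\<close>
  have J: "J r = (\<integral>\<^sup>+x. (\<integral>\<^sup>+a. indicator (G \<inter> cball x r) a \<partial>lborel) \<partial>\<nu>)" for r
  proof -
    have cl: "closed {z :: 'a \<times> 'a. dist (fst z) (snd z) \<le> r}"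
      by (intro closed_Collect_le continuous_intros)
    then have E: "{z :: 'a \<times> 'a. dist (fst z) (snd z) \<le> r} \<in> sets (borel \<Otimes>\<^sub>M borel)"
      unfolding borel_prod by (rule borel_closed)
    have E2: "{z \<in> space (lborel \<Otimes>\<^sub>M \<nu>). fst z \<in> G \<and> dist (fst z) (snd z) \<le> r} \<in> sets (lborel \<Otimes>\<^sub>M \<nu>)"
    proof -
      have "sets (lborel \<Otimes>\<^sub>M \<nu>) = sets (borel \<Otimes>\<^sub>M borel :: ('a \<times> 'a) measure)"
        by (intro sets_pair_measure_cong) auto
      moreover have "{z \<in> space (lborel \<Otimes>\<^sub>M \<nu>). fst z \<in> G \<and> dist (fst z) (snd z) \<le> r}
          = (G \<times> UNIV) \<inter> {z. dist (fst z) (snd z) \<le> r}"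
        by (auto simp: space_pair_measure \<nu>_def)
      moreover have "G \<times> UNIV \<in> sets (borel \<Otimes>\<^sub>M borel :: ('a \<times> 'a) measure)" by auto
      ultimately show ?thesis using E by auto
    qed
    have meas: "(\<lambda>z. indicator {z \<in> space (lborel \<Otimes>\<^sub>M \<nu>). fst z \<in> G \<and> dist (fst z) (snd z) \<le> r} z :: ennreal)
        \<in> borel_measurable (lborel \<Otimes>\<^sub>M \<nu>)"
      using E2 by simp
    have sp: "space (lborel \<Otimes>\<^sub>M \<nu>) = UNIV" by (auto simp: space_pair_measure \<nu>_def)
    have "J r = (\<integral>\<^sup>+a. (\<integral>\<^sup>+x. indicator {z \<in> space (lborel \<Otimes>\<^sub>M \<nu>). fst z \<in> G \<and> dist (fst z) (snd z) \<le> r} (a, x) \<partial>\<nu>) \<partial>lborel)"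
      unfolding J_def
    proof (rule nn_integral_cong)
      fix a :: 'a
      have "(\<integral>\<^sup>+x. indicator {z \<in> space (lborel \<Otimes>\<^sub>M \<nu>). fst z \<in> G \<and> dist (fst z) (snd z) \<le> r} (a, x) \<partial>\<nu>)
          = (\<integral>\<^sup>+x. indicator G a * indicator (cball a r) x \<partial>\<nu>)"
        by (rule nn_integral_cong) (auto simp: indicator_def sp)
      then show "indicator G a * emeasure \<nu> (cball a r) =
          (\<integral>\<^sup>+x. indicator {z \<in> space (lborel \<Otimes>\<^sub>M \<nu>). fst z \<in> G \<and> dist (fst z) (snd z) \<le> r} (a, x) \<partial>\<nu>)"
        by (simp add: nn_integral_cmult_indicator)
    qed
    also have "\<dots> = (\<integral>\<^sup>+x. (\<integral>\<^sup>+a. indicator {z \<in> space (lborel \<Otimes>\<^sub>M \<nu>). fst z \<in> G \<and> dist (fst z) (snd z) \<le> r} (a, x) \<partial>lborel) \<partial>\<nu>)"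
      by (rule PS.Fubini[OF meas, symmetric])
    also have "\<dots> = (\<integral>\<^sup>+x. (\<integral>\<^sup>+a. indicator (G \<inter> cball x r) a \<partial>lborel) \<partial>\<nu>)"
      by (intro nn_integral_cong) (auto simp: indicator_def sp dist_commute)
    finally show ?thesis .
  qed
  have "ennreal (\<beta> * \<delta>) \<le> ennreal \<beta> * emeasure \<nu> D"
    using core \<beta> by (simp add: nu D_def[symmetric] ennreal_mult'[symmetric] ennreal_leI)
  also have "\<dots> = (\<integral>\<^sup>+x. ennreal \<beta> * indicator D x \<partial>\<nu>)"
    by (subst nn_integral_cmult) auto
  also have "\<dots> \<le> J R"
    unfolding J
  proof (rule nn_integral_mono)
    fix x
    show "ennreal \<beta> * indicator D x \<le> (\<integral>\<^sup>+a. indicator (G \<inter> cball x R) a \<partial>lborel)"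
    proof (cases "x \<in> D")
      case True
      have "G \<inter> cball x R = cball x R"
      proof -
        have "4 * R < dist p y" if "y \<in> cball x R" "p \<in> P" for p y
        proof -
          have "5 * R < dist p x" using True that(2) by (simp add: D_def)
          then show ?thesis using dist_triangle[of p x y] that(1) by (simp add: dist_commute)
        qed
        then show ?thesis by (auto simp: G_def)
      qed
      then show ?thesis using True emeasure_cball[of R x] R by (simp add: \<beta>_def)
    qed simp
  qed
  finally have 1: "ennreal (\<beta> * \<delta>) \<le> J R" .
  have "J (2 * R) \<le> (\<integral>\<^sup>+x. ennreal (2 ^ DIM('a) * \<beta>) \<partial>\<nu>)"
    unfolding J
  proof (rule nn_integral_mono)
    fix x
    have "(\<integral>\<^sup>+a. indicator (G \<inter> cball x (2 * R)) a \<partial>lborel) \<le> (\<integral>\<^sup>+a. indicator (cball x (2 * R)) a \<partial>lborel)"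
      by (intro nn_integral_mono) (auto simp: indicator_def)
    also have "\<dots> = ennreal (2 ^ DIM('a) * \<beta>)"
      using emeasure_cball[of "2 * R" x] R by (simp add: \<beta>_def power_mult_distrib mult_ac)
    finally show "(\<integral>\<^sup>+a. indicator (G \<inter> cball x (2 * R)) a \<partial>lborel) \<le> ennreal (2 ^ DIM('a) * \<beta>)" .
  qed
  also have "\<dots> = ennreal (2 ^ DIM('a) * \<beta>) * ennreal (mass \<rho> UNIV)"
    using nu[of UNIV] by (simp add: \<nu>_def)
  also have "\<dots> \<le> ennreal (2 ^ DIM('a) * \<beta>) * ennreal m"
    by (intro mult_left_mono ennreal_leI m) simp
  also have "\<dots> = ennreal (2 ^ DIM('a) * \<beta> * m)" using \<beta> m0 by (simp add: ennreal_mult)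
  finally have 2: "J (2 * R) \<le> ennreal (2 ^ DIM('a) * \<beta> * m)" .
  have "ennreal (C * (\<beta> * \<delta>)) \<le> ennreal C * J R"
    using C0 1 by (simp add: ennreal_mult' mult_left_mono)
  also have "\<dots> \<le> J (2 * R)"
  proof -
    have "(\<lambda>a. emeasure \<nu> (cball a R)) \<in> borel_measurable lborel"
    proof -
      have E: "{z :: 'a \<times> 'a. dist (fst z) (snd z) \<le> R} \<in> sets (borel \<Otimes>\<^sub>M borel)"
        unfolding borel_prod by (intro borel_closed closed_Collect_le continuous_intros)
      then have "{z :: 'a \<times> 'a. dist (fst z) (snd z) \<le> R} \<in> sets (lborel \<Otimes>\<^sub>M \<nu>)"
        using sets_pair_measure_cong[of lborel borel \<nu> borel] by auto
      from N.measurable_emeasure_Pair[OF this] show ?thesis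
        by (simp add: vimage_def cball_def)
    qed
    then have "(\<lambda>a. indicator G a * emeasure \<nu> (cball a R)) \<in> borel_measurable lborel"
      by (intro borel_measurable_times_ennreal borel_measurable_indicator) auto
    then have "ennreal C * J R = (\<integral>\<^sup>+a. ennreal C * (indicator G a * emeasure \<nu> (cball a R)) \<partial>lborel)"
      unfolding J_def by (rule nn_integral_cmult[symmetric])
    also have "\<dots> \<le> J (2 * R)"
      unfolding J_def
    proof (rule nn_integral_mono)
      fix a
      show "ennreal C * (indicator G a * emeasure \<nu> (cball a R)) \<le> indicator G a * emeasure \<nu> (cball a (2 * R))"
        using no[of a] C0 by (cases "a \<in> G") (simp_all add: nu G_def ennreal_mult'[symmetric] ennreal_leI)
    qed
    finally show ?thesis .
  qed
  also note 2
  finally have "C * (\<beta> * \<delta>) \<le> 2 ^ DIM('a) * \<beta> * m"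
    using \<beta> m0 by (subst (asm) ennreal_le_iff) auto
  then have "\<beta> * (C * \<delta>) \<le> \<beta> * (2 ^ DIM('a) * m)" by (simp add: mult_ac)
  then have "C * \<delta> \<le> 2 ^ DIM('a) * m" using \<beta> by simp
  moreover have "C * \<delta> = 2 ^ DIM('a) * m + \<delta>" unfolding C_def using \<delta> by (simp add: distrib_right)
  ultimately show False using \<delta> by simp
qed

text \<open>Greedy choice. At most k earlier balls of radius 5R remove at most half of the mass
  \<delta> of \<open>Z\<close>, so a core of mass \<delta> / 2 is left for
  \<open>exists_doubling_ball\<close>. Its centre is more than 4R from the earlier ones, which keeps
  the balls of radius 2R disjoint.\<close>

lemma many_doubling_balls:
  fixes \<rho> :: "'a::euclidean_space \<Rightarrow> real"
  assumes \<rho>: "finite_density \<rho>" and m: "mass \<rho> UNIV \<le> m" and R: "R > 0" and \<delta>: "\<delta> > 0"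
    and Z: "Z \<in> sets lebesgue" "\<delta> \<le> mass \<rho> Z"
    and spread: "\<And>a. mass \<rho> (Z \<inter> cball a (5 * R)) \<le> \<delta> / (2 * real (Suc k))"
    and n: "n \<le> Suc k"
  shows "\<exists>a. \<forall>i<n. 0 < mass \<rho> (cball (a i) R) \<and>
    mass \<rho> (cball (a i) (2 * R)) \<le> (2 ^ DIM('a) * m / (\<delta> / 2) + 1) * mass \<rho> (cball (a i) R) \<and>
    (\<forall>j<i. 4 * R < dist (a j) (a i))"
  using n
proof (induction n)
  case (Suc n)
  then obtain a where a: "\<forall>i<n. 0 < mass \<rho> (cball (a i) R) \<and>
      mass \<rho> (cball (a i) (2 * R)) \<le> (2 ^ DIM('a) * m / (\<delta> / 2) + 1) * mass \<rho> (cball (a i) R) \<and>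
      (\<forall>j<i. 4 * R < dist (a j) (a i))" by auto
  interpret M: finite_measure "mass_measure \<rho>" by (rule finite_measure_mass[OF \<rho>])
  define D where "D = {x. \<forall>p\<in>a ` {..<n}. 5 * R < dist p x}"
  have "D = - (\<Union>i<n. cball (a i) (5 * R))" by (force simp: D_def not_le)
  moreover have "closed (\<Union>i<n. cball (a i) (5 * R))" by auto
  ultimately have "open D" by (simp only: open_Compl)
  then have D: "D \<in> sets lebesgue" by (simp add: borel_open)
  have ZU: "Z \<inter> cball (a i) (5 * R) \<in> sets lebesgue" for i
    using Z(1) by (intro sets.Int) auto
  have "mass \<rho> Z \<le> mass \<rho> (D \<union> (\<Union>i<n. Z \<inter> cball (a i) (5 * R)))"
  proof (rule M.finite_measure_mono)
    show "Z \<subseteq> D \<union> (\<Union>i<n. Z \<inter> cball (a i) (5 * R))" by (auto simp: D_def not_le)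
    show "D \<union> (\<Union>i<n. Z \<inter> cball (a i) (5 * R)) \<in> sets (mass_measure \<rho>)"
      using D ZU by (simp only: sets_mass_measure) (intro sets.Un sets.finite_UN, auto)
  qed
  also have "\<dots> \<le> mass \<rho> D + mass \<rho> (\<Union>i<n. Z \<inter> cball (a i) (5 * R))"
  proof (rule measure_Un_le)
    show "(\<Union>i<n. Z \<inter> cball (a i) (5 * R)) \<in> sets (mass_measure \<rho>)"
      using ZU by (simp only: sets_mass_measure) (intro sets.finite_UN, auto)
  qed (use D in simp)
  also have "\<dots> \<le> mass \<rho> D + (\<Sum>i<n. mass \<rho> (Z \<inter> cball (a i) (5 * R)))"
    by (intro add_left_mono measure_UNION_le) (use ZU in auto)
  also have "\<dots> \<le> mass \<rho> D + (\<Sum>i<n. \<delta> / (2 * real (Suc k)))"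
    by (intro add_left_mono sum_mono spread)
  also have "\<dots> = mass \<rho> D + real n * (\<delta> / (2 * real (Suc k)))" by simp
  also have "\<dots> \<le> mass \<rho> D + real (Suc k) * (\<delta> / (2 * real (Suc k)))"
    by (intro add_left_mono mult_right_mono) (use Suc.prems \<delta> in auto)
  also have "\<dots> = mass \<rho> D + \<delta> / 2" by (simp add: field_simps)
  finally have "\<delta> / 2 \<le> mass \<rho> D" using Z(2) by simp
  then obtain b where b: "\<forall>p\<in>a ` {..<n}. 4 * R < dist p b" "0 < mass \<rho> (cball b R)"
      "mass \<rho> (cball b (2 * R)) \<le> (2 ^ DIM('a) * m / (\<delta> / 2) + 1) * mass \<rho> (cball b R)"
    using exists_doubling_ball[OF \<rho> m R, of "\<delta> / 2" "a ` {..<n}"] \<delta> unfolding D_def by auto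
  show ?case
    by (rule exI[of _ "a(n := b)"]) (use a b in \<open>auto simp: less_Suc_eq\<close>)
qed simp

text \<open>If no ball of radius 5R captures a sizeable part of the mass in \<open>Z\<close>, there
  are k + 1 bumps with disjoint supports, all with quotient of order 1 / R^2 and with a constant
  independent of R.\<close>

lemma mu_le_of_spread:
  fixes \<rho> :: "'a::euclidean_space \<Rightarrow> real"
  assumes \<rho>: "finite_density \<rho>" and m: "mass \<rho> UNIV \<le> m" and R: "R > 0" and \<delta>: "\<delta> > 0"
    and Z: "Z \<in> sets lebesgue" "\<delta> \<le> mass \<rho> Z"
    and spread: "\<And>a. mass \<rho> (Z \<inter> cball a (5 * R)) \<le> \<delta> / (2 * real (Suc k))"
    and l: "l \<le> k"
  shows "mu l \<rho> \<le> ennreal (bump_const * (2 ^ DIM('a) * m / (\<delta> / 2) + 1) / R\<^sup>2)"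
proof -
  let ?C = "2 ^ DIM('a) * m / (\<delta> / 2) + 1"
  obtain a where a: "\<And>i. i < Suc k \<Longrightarrow> 0 < mass \<rho> (cball (a i) R)"
      "\<And>i. i < Suc k \<Longrightarrow> mass \<rho> (cball (a i) (2 * R)) \<le> ?C * mass \<rho> (cball (a i) R)"
      "\<And>i j. i < Suc k \<Longrightarrow> j < i \<Longrightarrow> 4 * R < dist (a j) (a i)"
    using many_doubling_balls[OF \<rho> m R \<delta> Z spread order_refl] by auto
  have d: "density_fun \<rho>" using \<rho> by (simp add: finite_density_def)
  have "spectral_family \<rho> (Sigma {..<Suc k} (\<lambda>i. {i})) (\<lambda>(b, i). (\<lambda>_. bump (a b) R) i) (bump_const * ?C / R\<^sup>2)"
  proof (rule spectral_family_disjoint_union[where S="\<lambda>i. cball (a i) (2 * R)"])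
    show "spectral_family \<rho> {b} (\<lambda>_. bump (a b) R) (bump_const * ?C / R\<^sup>2)" if "b \<in> {..<Suc k}" for b
      by (rule spectral_family_bump[OF \<rho> R]) (use a that in auto)
    have far: "4 * R < dist (a i) (a j)" if "i < Suc k" "j < Suc k" "i \<noteq> j" for i j
      using a(3)[of i j] a(3)[of j i] that by (cases "i < j") (auto simp: dist_commute)
    show "disjoint_family_on (\<lambda>i. cball (a i) (2 * R)) {..<Suc k}"
      unfolding disjoint_family_on_def
    proof (intro ballI impI)
      fix i j assume ij: "i \<in> {..<Suc k}" "j \<in> {..<Suc k}" "i \<noteq> j"
      have "dist (a i) (a j) \<le> 4 * R" if "x \<in> cball (a i) (2 * R)" "x \<in> cball (a j) (2 * R)" for x
        using dist_triangle[of "a i" "a j" x] that by (simp add: dist_commute)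
      then show "cball (a i) (2 * R) \<inter> cball (a j) (2 * R) = {}" using far[of i j] ij by force
    qed
    show "bump (a b) R x = 0" if "x \<notin> cball (a b) (2 * R)" for b x
      by (rule bump_support[OF R that])
  qed (use d in auto)
  moreover have "card (Sigma {..<Suc k} (\<lambda>i. {i})) = Suc k" by simp
  ultimately show ?thesis using mu_le_spectral_family[OF d] l by force
qed

text \<open>Densities are at most 1, so the mass of a ball is at most its volume. The spread
  condition therefore holds automatically at a small radius determined by \<delta>, k and the
  dimension, with the whole space as \<open>Z\<close>.\<close>

lemma mu_uniformly_bounded:
  assumes \<delta>: "\<delta> > 0"
  shows "\<exists>M\<ge>0. \<forall>\<rho> :: 'a::euclidean_space \<Rightarrow> real. finite_density \<rho> \<longrightarrow> \<delta> \<le> mass \<rho> UNIV \<longrightarrow>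
    mass \<rho> UNIV \<le> m \<longrightarrow> (\<forall>l\<le>k. mu l \<rho> \<le> ennreal M)"
proof -
  define v where "v = unit_ball_vol (DIM('a))"
  have v: "v > 0" by (simp add: v_def)
  \<comment> \<open>The bound 5R \<le> 1 allows (5R)^N to be replaced by 5R; the other bound then
    makes the ball of radius 5R small enough in volume.\<close>
  define R where "R = min 1 (\<delta> / (2 * real (Suc k)) / v) / 5"
  have R: "R > 0" unfolding R_def using \<delta> v by simp
  have R1: "5 * R \<le> 1" "5 * R \<le> \<delta> / (2 * real (Suc k)) / v" by (simp_all add: R_def)
  have "(5 * R) ^ DIM('a) \<le> 5 * R"
    using power_decreasing[of 1 "DIM('a)" "5 * R"] R R1 DIM_positive[where 'a='a] by simp
  then have "v * (5 * R) ^ DIM('a) \<le> v * (\<delta> / (2 * real (Suc k)) / v)"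
    using R1 v by (intro mult_left_mono) auto
  then have vol: "v * (5 * R) ^ DIM('a) \<le> \<delta> / (2 * real (Suc k))" using v by simp
  define M where "M = bump_const * (2 ^ DIM('a) * m / (\<delta> / 2) + 1) / R\<^sup>2"
  have "mu l \<rho> \<le> ennreal (max 0 M)" if \<rho>: "finite_density \<rho>" "\<delta> \<le> mass \<rho> UNIV" "mass \<rho> UNIV \<le> m" and l: "l \<le> k"
    for \<rho> :: "'a \<Rightarrow> real" and l
  proof -
    have "mu l \<rho> \<le> ennreal M" unfolding M_def
    proof (rule mu_le_of_spread[OF \<rho>(1) \<rho>(3) R \<delta> _ \<rho>(2) _ l])
      show "mass \<rho> (UNIV \<inter> cball a (5 * R)) \<le> \<delta> / (2 * real (Suc k))" for a
        using mass_le_content[OF \<rho>(1), of "5 * R" a] R vol by (simp add: v_def)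
    qed simp
    then show ?thesis by (rule order_trans) (auto intro: ennreal_leI)
  qed
  then show ?thesis by (intro exI[of _ "max 0 M"]) simp
qed

lemma mass_cball_tendsto:
  assumes \<rho>: "finite_density \<rho>"
  shows "(\<lambda>n. mass \<rho> (cball 0 (real n))) \<longlonglongrightarrow> mass \<rho> UNIV"
proof -
  interpret M: finite_measure "mass_measure \<rho>" by (rule finite_measure_mass[OF \<rho>])
  have "(\<lambda>n. mass \<rho> (cball 0 (real n))) \<longlonglongrightarrow> mass \<rho> (\<Union>n. cball 0 (real n))"
    by (rule M.finite_Lim_measure_incseq) (auto simp: incseq_def)
  moreover have "(\<Union>n. cball 0 (real n)) = (UNIV :: 'a set)"
    by (auto intro: real_arch_simple)
  ultimately show ?thesis by simp
qed

text \<open>Once a ball of radius n holds more than half of the total mass, its doubling constant is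
  at most 2, so bumps at scale n have quotients of order 1 / n^2.\<close>

lemma mu_0_eq_0:
  assumes \<rho>: "finite_density \<rho>" and pos: "0 < mass \<rho> UNIV"
  shows "mu 0 \<rho> = 0"
proof -
  interpret M: finite_measure "mass_measure \<rho>" by (rule finite_measure_mass[OF \<rho>])
  have "mu 0 \<rho> \<le> 0 + ennreal e" if e: "e > 0" for e
  proof -
    have "(\<lambda>n. mass \<rho> (cball 0 (real n))) \<longlonglongrightarrow> mass \<rho> UNIV"
      by (rule mass_cball_tendsto[OF \<rho>])
    then have ev1: "eventually (\<lambda>n. mass \<rho> UNIV / 2 < mass \<rho> (cball 0 (real n))) sequentially"
      using pos by (intro order_tendstoD) auto
    have "filterlim (\<lambda>n. (real n)\<^sup>2) at_top sequentially"
      by (intro filterlim_pow_at_top filterlim_real_sequentially) auto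
    then have ev2: "eventually (\<lambda>n. bump_const * 2 / e \<le> (real n)\<^sup>2) sequentially"
      by (auto simp: filterlim_at_top)
    have "eventually (\<lambda>n. mass \<rho> UNIV / 2 < mass \<rho> (cball 0 (real n)) \<and>
        bump_const * 2 / e \<le> (real n)\<^sup>2 \<and> n > 0) sequentially"
      using ev1 ev2 eventually_gt_at_top[of 0] by eventually_elim simp
    then obtain n where n: "mass \<rho> UNIV / 2 < mass \<rho> (cball 0 (real n))"
        "bump_const * 2 / e \<le> (real n)\<^sup>2" "n > 0"
      by (auto dest: eventually_happens)
    have "mass \<rho> (cball 0 (2 * real n)) \<le> mass \<rho> UNIV" by (rule M.finite_measure_mono) auto
    then have "spectral_family \<rho> {()} (\<lambda>_. bump 0 (real n)) (bump_const * 2 / (real n)\<^sup>2)"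
      using n pos by (intro spectral_family_bump[OF \<rho>]) auto
    then have "mu 0 \<rho> \<le> ennreal (bump_const * 2 / (real n)\<^sup>2)"
      using \<rho> by (intro mu_le_spectral_family[where I="{()}"]) (auto simp: finite_density_def)
    also have "\<dots> \<le> ennreal e"
      using n e by (intro ennreal_leI) (simp add: field_simps)
    finally show ?thesis by simp
  qed
  then have "mu 0 \<rho> \<le> 0" by (rule ennreal_le_epsilon)
  then show ?thesis by simp
qed

subsection \<open>Stability of spectral families\<close>

text \<open>By homogeneity only coefficient vectors with absolute values summing to 1 matter. They
  form a compact set on which the limit form has a minimum \<kappa> > 0, and entries changed by less
  than \<kappa> / 2 change the form by at most \<kappa> / 2 there.\<close>

lemma positive_definite_perturbation:
  fixes q :: "'i \<Rightarrow> 'i \<Rightarrow> real" and q' :: "nat \<Rightarrow> 'i \<Rightarrow> 'i \<Rightarrow> real"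
  assumes I: "finite I"
    and pos: "\<And>\<xi> i. i \<in> I \<Longrightarrow> \<xi> i \<noteq> 0 \<Longrightarrow> 0 < (\<Sum>i\<in>I. \<Sum>j\<in>I. \<xi> i * \<xi> j * q i j)"
    and lim: "\<And>i j. i \<in> I \<Longrightarrow> j \<in> I \<Longrightarrow> (\<lambda>n. q' n i j) \<longlonglongrightarrow> q i j"
  shows "\<forall>\<^sub>F n in sequentially. \<forall>\<xi>. (\<exists>i\<in>I. \<xi> i \<noteq> 0) \<longrightarrow> 0 < (\<Sum>i\<in>I. \<Sum>j\<in>I. \<xi> i * \<xi> j * q' n i j)"
proof (cases "I = {}")
  case False
  then obtain i0 where i0: "i0 \<in> I" by blast
  let ?f = "\<lambda>\<xi>. \<Sum>i\<in>I. \<Sum>j\<in>I. \<xi> i * \<xi> j * q i j"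
  \<comment> \<open>Coefficient vectors are functions on the whole index type; forcing the
    coordinates outside \<open>I\<close> to be 0 makes compactness available through Tychonoff's
    theorem.\<close>
  define K0 :: "('i \<Rightarrow> real) set" where "K0 = PiE UNIV (\<lambda>i. if i \<in> I then {-1..1} else {0})"
  define K where "K = K0 \<inter> {\<xi>. (\<Sum>i\<in>I. \<bar>\<xi> i\<bar>) = 1}"
  have "compactin (product_topology (\<lambda>i::'i. euclidean :: real topology) UNIV) K0"
    unfolding K0_def compactin_PiE by simp
  then have "compact K0" by (simp add: euclidean_product_topology)
  moreover have "closed {\<xi> :: 'i \<Rightarrow> real. (\<Sum>i\<in>I. \<bar>\<xi> i\<bar>) = 1}"
    by (intro closed_Collect_eq continuous_intros continuous_on_product_coordinates)
  ultimately have K: "compact K" unfolding K_def by (rule compact_Int_closed)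
  have "(\<lambda>i. if i = i0 then 1 else 0) \<in> K"
    using I i0 by (auto simp: K_def K0_def if_distrib[of abs] cong: if_cong)
  then have "K \<noteq> {}" by blast
  moreover have "continuous_on K ?f"
    by (intro continuous_intros continuous_on_subset[OF continuous_on_product_coordinates subset_UNIV])
  ultimately obtain \<xi>0 where \<xi>0: "\<xi>0 \<in> K" "\<forall>\<xi>\<in>K. ?f \<xi>0 \<le> ?f \<xi>"
    using continuous_attains_inf[OF K] by blast
  define \<kappa> where "\<kappa> = ?f \<xi>0"
  have "\<exists>i\<in>I. \<xi>0 i \<noteq> 0"
  proof (rule ccontr)
    assume "\<not> ?thesis"
    then have "(\<Sum>i\<in>I. \<bar>\<xi>0 i\<bar>) = 0" by simp
    then show False using \<xi>0(1) by (simp add: K_def)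
  qed
  then have \<kappa>: "\<kappa> > 0" unfolding \<kappa>_def using pos by blast
  have "\<forall>\<^sub>F n in sequentially. \<bar>q' n i j - q i j\<bar> < \<kappa> / 2" if "i \<in> I" "j \<in> I" for i j
    using tendstoD[OF lim[OF that], of "\<kappa> / 2"] \<kappa> by (simp add: dist_real_def)
  then have "\<forall>\<^sub>F n in sequentially. \<forall>i\<in>I. \<forall>j\<in>I. \<bar>q' n i j - q i j\<bar> < \<kappa> / 2"
    using I by (auto intro!: eventually_ball_finite)
  then show ?thesis
  proof eventually_elim
    case (elim n)
    let ?g = "\<lambda>\<xi>. \<Sum>i\<in>I. \<Sum>j\<in>I. \<xi> i * \<xi> j * q' n i j"
    have onK: "0 < ?g \<xi>" if "\<xi> \<in> K" for \<xi>
    proof -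
      have "\<bar>?f \<xi> - ?g \<xi>\<bar> = \<bar>\<Sum>i\<in>I. \<Sum>j\<in>I. \<xi> i * \<xi> j * (q i j - q' n i j)\<bar>"
        by (simp add: sum_subtractf[symmetric] right_diff_distrib)
      also have "\<dots> \<le> (\<Sum>i\<in>I. \<Sum>j\<in>I. \<bar>\<xi> i * \<xi> j * (q i j - q' n i j)\<bar>)"
        by (intro order_trans[OF sum_abs] sum_mono sum_abs)
      also have "\<dots> \<le> (\<Sum>i\<in>I. \<Sum>j\<in>I. \<bar>\<xi> i\<bar> * \<bar>\<xi> j\<bar> * (\<kappa> / 2))"
      proof (intro sum_mono)
        fix i j assume ij: "i \<in> I" "j \<in> I"
        have "\<bar>q i j - q' n i j\<bar> \<le> \<kappa> / 2"
          using elim ij by (metis abs_minus_commute less_imp_le)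
        then show "\<bar>\<xi> i * \<xi> j * (q i j - q' n i j)\<bar> \<le> \<bar>\<xi> i\<bar> * \<bar>\<xi> j\<bar> * (\<kappa> / 2)"
          unfolding abs_mult by (intro mult_left_mono) auto
      qed
      also have "\<dots> = (\<Sum>i\<in>I. \<bar>\<xi> i\<bar>) * (\<Sum>j\<in>I. \<bar>\<xi> j\<bar>) * (\<kappa> / 2)"
        by (subst sum_product) (simp only: sum_distrib_right)
      also have "\<dots> = \<kappa> / 2" using that by (simp add: K_def)
      finally have "\<bar>?f \<xi> - ?g \<xi>\<bar> \<le> \<kappa> / 2" .
      moreover have "\<kappa> \<le> ?f \<xi>" unfolding \<kappa>_def using \<xi>0(2) that by blast
      ultimately show ?thesis using \<kappa> by linarith
    qed
    show ?case
    proof (intro allI impI)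
      fix \<xi> :: "'i \<Rightarrow> real" assume \<xi>: "\<exists>i\<in>I. \<xi> i \<noteq> 0"
      define c where "c = (\<Sum>i\<in>I. \<bar>\<xi> i\<bar>)"
      have c: "c > 0" unfolding c_def using \<xi> I by (auto intro!: sum_pos2)
      define \<eta> where "\<eta> i = (if i \<in> I then \<xi> i / c else 0)" for i
      have le: "\<bar>\<xi> i\<bar> \<le> c" if "i \<in> I" for i
        unfolding c_def using member_le_sum[of i I "\<lambda>i. \<bar>\<xi> i\<bar>"] that I by simp
      have "\<eta> i \<in> (if i \<in> I then {-1..1} else {0})" for i
        using le[of i] c by (auto simp: \<eta>_def field_simps abs_le_iff)
      moreover have "(\<Sum>i\<in>I. \<bar>\<eta> i\<bar>) = 1"
      proof -
        have "(\<Sum>i\<in>I. \<bar>\<eta> i\<bar>) = (\<Sum>i\<in>I. \<bar>\<xi> i\<bar> / c)"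
          using c by (intro sum.cong) (auto simp: \<eta>_def abs_divide)
        also have "\<dots> = (\<Sum>i\<in>I. \<bar>\<xi> i\<bar>) / c" by (rule sum_divide_distrib[symmetric])
        finally show ?thesis using c by (simp add: c_def[symmetric])
      qed
      ultimately have "\<eta> \<in> K" by (auto simp: K_def K0_def)
      from onK[OF this] have "0 < c * c * ?g \<eta>" using c by simp
      also have "c * c * ?g \<eta> = (\<Sum>i\<in>I. \<Sum>j\<in>I. \<xi> i * \<xi> j * q' n i j)"
        unfolding sum_distrib_left using c by (intro sum.cong refl) (simp add: \<eta>_def)
      finally show "0 < (\<Sum>i\<in>I. \<Sum>j\<in>I. \<xi> i * \<xi> j * q' n i j)" .
    qed
  qed
qed simp

definition weakly_converges :: "(nat \<Rightarrow> 'a::euclidean_space \<Rightarrow> real) \<Rightarrow> ('a \<Rightarrow> real) \<Rightarrow> bool" where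
  "weakly_converges f g \<longleftrightarrow>
     (\<forall>\<phi>\<in>L12 lebesgue. (\<lambda>n. \<integral>x. f n x * \<phi> x \<partial>lebesgue) \<longlonglongrightarrow> (\<integral>x. g x * \<phi> x \<partial>lebesgue))"

lemma weakly_converges_subseq:
  "weakly_converges f g \<Longrightarrow> strict_mono s \<Longrightarrow> weakly_converges (\<lambda>n. f (s n)) g"
  unfolding weakly_converges_def
  using LIMSEQ_subseq_LIMSEQ[of "\<lambda>n. \<integral>x. f n x * _ x \<partial>lebesgue"] by (fastforce simp: o_def)

text \<open>The family itself is kept. Both its mass matrix and the matrix of t times the mass minus
  the gradient form are positive definite at the limit, the latter because t' < t, and positive
  definiteness survives convergence of the entries.\<close>

lemma spectral_family_weak_limit:
  assumes \<sigma>: "density_fun \<sigma>" and f: "\<And>n. density_fun (f n)" and lim: "weakly_converges f \<sigma>"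
    and fam: "spectral_family \<sigma> I u t'" and t: "t' < t"
  shows "\<forall>\<^sub>F n in sequentially. spectral_family (f n) I u t"
proof -
  have I: "finite I" and u: "\<And>i. i \<in> I \<Longrightarrow> u i \<in> test_functions"
    using fam by (auto simp: spectral_family_def)
  have ml: "(\<lambda>n. mform (f n) (u i) (u j)) \<longlonglongrightarrow> mform \<sigma> (u i) (u j)" if "i \<in> I" "j \<in> I" for i j
    using lim test_function_product_L12(1)[OF u[OF that(1)] u[OF that(2)]]
    unfolding weakly_converges_def mform_def by (rule bspec)
  have gl: "(\<lambda>n. gform (f n) (u i) (u j)) \<longlonglongrightarrow> gform \<sigma> (u i) (u j)" if "i \<in> I" "j \<in> I" for i j
    using lim test_function_product_L12(2)[OF u[OF that(1)] u[OF that(2)]]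
    unfolding weakly_converges_def gform_def by (rule bspec)
  have ms: "mform \<rho> (lincomb I u \<xi>) (lincomb I u \<xi>) = (\<Sum>i\<in>I. \<Sum>j\<in>I. \<xi> i * \<xi> j * mform \<rho> (u i) (u j))"
    if "density_fun \<rho>" for \<rho> \<xi>
    by (rule mform_sum[OF that]) (rule u)
  have gs: "gform \<rho> (lincomb I u \<xi>) (lincomb I u \<xi>) = (\<Sum>i\<in>I. \<Sum>j\<in>I. \<xi> i * \<xi> j * gform \<rho> (u i) (u j))"
    if "density_fun \<rho>" for \<rho> \<xi>
    by (rule gform_sum[OF that]) (rule u)
  have diff: "(\<Sum>i\<in>I. \<Sum>j\<in>I. \<xi> i * \<xi> j * (t * mform \<rho> (u i) (u j) - gform \<rho> (u i) (u j))) =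
      t * mform \<rho> (lincomb I u \<xi>) (lincomb I u \<xi>) - gform \<rho> (lincomb I u \<xi>) (lincomb I u \<xi>)"
    if "density_fun \<rho>" for \<rho> \<xi>
    unfolding ms[OF that] gs[OF that] sum_distrib_left sum_subtractf[symmetric]
    by (intro sum.cong refl) (simp add: algebra_simps)
  have ev1: "\<forall>\<^sub>F n in sequentially. \<forall>\<xi>. (\<exists>i\<in>I. \<xi> i \<noteq> 0) \<longrightarrow>
      0 < (\<Sum>i\<in>I. \<Sum>j\<in>I. \<xi> i * \<xi> j * mform (f n) (u i) (u j))"
  proof (rule positive_definite_perturbation[OF I _ ml])
    fix \<xi> :: "'b \<Rightarrow> real" and i assume "i \<in> I" "\<xi> i \<noteq> 0"
    from spectral_familyD(1)[OF fam, of i \<xi>, OF this]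
    show "0 < (\<Sum>i\<in>I. \<Sum>j\<in>I. \<xi> i * \<xi> j * mform \<sigma> (u i) (u j))"
      by (simp only: ms[OF \<sigma>])
  qed
  have ev2: "\<forall>\<^sub>F n in sequentially. \<forall>\<xi>. (\<exists>i\<in>I. \<xi> i \<noteq> 0) \<longrightarrow>
      0 < (\<Sum>i\<in>I. \<Sum>j\<in>I. \<xi> i * \<xi> j * (t * mform (f n) (u i) (u j) - gform (f n) (u i) (u j)))"
  proof (rule positive_definite_perturbation[OF I])
    show "(\<lambda>n. t * mform (f n) (u i) (u j) - gform (f n) (u i) (u j)) \<longlonglongrightarrow>
        t * mform \<sigma> (u i) (u j) - gform \<sigma> (u i) (u j)" if "i \<in> I" "j \<in> I" for i j
      by (intro tendsto_intros ml gl that)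
    fix \<xi> :: "'b \<Rightarrow> real" and i assume "i \<in> I" "\<xi> i \<noteq> 0"
    note * = spectral_familyD[OF fam, of i \<xi>, OF this]
    have "t' * mform \<sigma> (lincomb I u \<xi>) (lincomb I u \<xi>) < t * mform \<sigma> (lincomb I u \<xi>) (lincomb I u \<xi>)"
      using t *(1) by (rule mult_strict_right_mono)
    then show "0 < (\<Sum>i\<in>I. \<Sum>j\<in>I. \<xi> i * \<xi> j * (t * mform \<sigma> (u i) (u j) - gform \<sigma> (u i) (u j)))"
      unfolding diff[OF \<sigma>] using *(2) by linarith
  qed
  from ev1 ev2 show ?thesis
  proof eventually_elim
    case (elim n)
    show ?case unfolding spectral_family_def
    proof (intro conjI ballI allI impI)
      fix \<xi> :: "'b \<Rightarrow> real" assume \<xi>: "\<exists>i\<in>I. \<xi> i \<noteq> 0"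
      show "0 < mform (f n) (lincomb I u \<xi>) (lincomb I u \<xi>)"
        unfolding ms[OF f] using elim(1) \<xi> by blast
      have "0 < (\<Sum>i\<in>I. \<Sum>j\<in>I. \<xi> i * \<xi> j * (t * mform (f n) (u i) (u j) - gform (f n) (u i) (u j)))"
        using elim(2) \<xi> by blast
      then show "gform (f n) (lincomb I u \<xi>) (lincomb I u \<xi>) \<le> t * mform (f n) (lincomb I u \<xi>) (lincomb I u \<xi>)"
        unfolding diff[OF f] by linarith
    qed (use I u in auto)
  qed
qed

section \<open>Translations\<close>

lemma lebesgue_eq_distr_translation:
  fixes y :: "'a::euclidean_space"
  shows "lebesgue = distr lebesgue lebesgue (\<lambda>x. x + y)" "(\<lambda>x. x + y) \<in> lebesgue \<rightarrow>\<^sub>M lebesgue"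
proof -
  have eq: "(\<lambda>x. y + (\<Sum>j\<in>Basis. (1 * (x \<bullet> j)) *\<^sub>R j)) = (\<lambda>x. x + y)"
    by (simp add: euclidean_representation add.commute)
  show "lebesgue = distr lebesgue lebesgue (\<lambda>x. x + y)"
    using lebesgue_affine_euclidean[of "\<lambda>_. 1" y] unfolding eq by (simp add: density_1)
  show "(\<lambda>x. x + y) \<in> lebesgue \<rightarrow>\<^sub>M lebesgue"
    using lebesgue_affine_measurable[of "\<lambda>_. 1" y] unfolding eq by simp
qed

lemma integral_translation:
  fixes f :: "'a::euclidean_space \<Rightarrow> real"
  assumes "f \<in> borel_measurable lebesgue"
  shows "(\<integral>x. f (x + y) \<partial>lebesgue) = (\<integral>x. f x \<partial>lebesgue)"
    "integrable lebesgue (\<lambda>x. f (x + y)) \<longleftrightarrow> integrable lebesgue f"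
  using integral_distr[OF lebesgue_eq_distr_translation(2) assms, of y]
    integrable_distr_eq[OF lebesgue_eq_distr_translation(2) assms, of y]
  unfolding lebesgue_eq_distr_translation(1)[of y, symmetric] by simp_all

lemma finite_density_translate:
  assumes "finite_density \<rho>" shows "finite_density (\<lambda>x. \<rho> (x + y))"
proof -
  have m: "\<rho> \<in> borel_measurable lebesgue" using assms by (auto simp: finite_density_def density_fun_def)
  have "(\<lambda>x. \<rho> (x + y)) \<in> borel_measurable lebesgue"
    by (rule measurable_compose[OF lebesgue_eq_distr_translation(2) m])
  then show ?thesis
    using assms integral_translation(2)[OF m] by (auto simp: finite_density_def density_fun_def)
qed

lemma mass_translate_cball:
  assumes \<rho>: "finite_density \<rho>"
  shows "(\<integral>x. \<rho> (x + y) * indicator (cball 0 r) x \<partial>lebesgue) = mass \<rho> (cball y r)"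
proof -
  have "(\<integral>x. \<rho> (x + y) * indicator (cball 0 r) x \<partial>lebesgue) = (\<integral>x. \<rho> (x + y) * indicator (cball y r) (x + y) \<partial>lebesgue)"
    by (rule Bochner_Integration.integral_cong) (auto simp: indicator_def dist_norm norm_minus_commute)
  also have "\<dots> = (\<integral>x. \<rho> x * indicator (cball y r) x \<partial>lebesgue)"
    by (rule integral_translation(1)[OF borel_measurable_integrable])
       (use finite_density_integrable_mult[OF \<rho>, of "cball y r"] in simp)
  finally show ?thesis using mass_eq_integral[OF \<rho>, of "cball y r"] by simp
qed

lemma spectral_family_translate:
  assumes \<rho>: "finite_density \<rho>" and fam: "spectral_family (\<lambda>x. \<rho> (x + y)) I u t"
  shows "spectral_family \<rho> I (\<lambda>i x. u i (x - y)) t"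
  unfolding spectral_family_def
proof (intro conjI ballI allI impI)
  show "finite I" using fam by (simp add: spectral_family_def)
  have u: "u i \<in> test_functions" if "i \<in> I" for i using fam that by (auto simp: spectral_family_def)
  then show "(\<lambda>x. u i (x - y)) \<in> test_functions" if "i \<in> I" for i
    using that by (intro test_functions_translate)
  fix \<xi> :: "'b \<Rightarrow> real" assume "\<exists>i\<in>I. \<xi> i \<noteq> 0"
  then obtain i where i: "i \<in> I" "\<xi> i \<noteq> 0" by blast
  note * = spectral_familyD[OF fam, of i \<xi>, OF this]
  let ?s = "lincomb I u \<xi>"
  have s: "lincomb I (\<lambda>i x. u i (x - y)) \<xi> = (\<lambda>x. ?s (x - y))" by (simp add: lincomb_def fun_eq_iff)
  have st: "?s \<in> test_functions" using u by (rule lincomb_test_function)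
  have st': "(\<lambda>x. ?s (x - y)) \<in> test_functions" by (rule test_functions_translate[OF st])
  have d: "density_fun \<rho>" using \<rho> by (simp add: finite_density_def)
  have m: "mform \<rho> (\<lambda>x. ?s (x - y)) (\<lambda>x. ?s (x - y)) = mform (\<lambda>x. \<rho> (x + y)) ?s ?s"
    unfolding mform_def
    using integral_translation(1)[OF borel_measurable_integrable[OF form_integrable(1)[OF d st' st']], of y] by simp
  have g: "gform \<rho> (\<lambda>x. ?s (x - y)) (\<lambda>x. ?s (x - y)) = gform (\<lambda>x. \<rho> (x + y)) ?s ?s"
    unfolding gform_def
    using integral_translation(1)[OF borel_measurable_integrable[OF form_integrable(2)[OF d st' st']], of y]
    by (simp add: gradient_translate[OF st])
  show "0 < mform \<rho> (lincomb I (\<lambda>i x. u i (x - y)) \<xi>) (lincomb I (\<lambda>i x. u i (x - y)) \<xi>)"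
    "gform \<rho> (lincomb I (\<lambda>i x. u i (x - y)) \<xi>) (lincomb I (\<lambda>i x. u i (x - y)) \<xi>)
      \<le> t * mform \<rho> (lincomb I (\<lambda>i x. u i (x - y)) \<xi>) (lincomb I (\<lambda>i x. u i (x - y)) \<xi>)"
    unfolding s m g using * by simp_all
qed

subsection \<open>Eigenvalues of collections\<close>

text \<open>\<open>D i\<close> tells how many of the lowest eigenvalues of the i-th density are
  counted; n + 1 pairs are needed for index n, hence the strict inequality.\<close>

lemma collection_mu_le:
  assumes "\<And>i l. i < length \<rho> \<Longrightarrow> l < D i \<Longrightarrow> mu l (\<rho> ! i) \<le> t" "n < (\<Sum>i<length \<rho>. D i)"
  shows "collection_mu n \<rho> \<le> t"
proof -
  let ?T = "Sigma {..<length \<rho>} (\<lambda>i. {..<D i})"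
  have "Suc n \<le> card ?T" using assms(2) by simp
  then obtain A where A: "A \<subseteq> ?T" "card A = Suc n"
    using obtain_subset_with_card_n by metis
  have "A \<subseteq> {..<length \<rho>} \<times> UNIV" using A(1) by auto
  moreover have "\<forall>(i, l)\<in>A. mu l (\<rho> ! i) \<le> t" using A(1) assms(1) by auto
  ultimately show ?thesis unfolding collection_mu_def using A(2) by (intro Inf_lower) blast
qed

lemma collection_mu_lessD:
  assumes "collection_mu n \<rho> < t"
  obtains A where "A \<subseteq> {..<length \<rho>} \<times> UNIV" "card A = Suc n" "\<And>i l. (i, l) \<in> A \<Longrightarrow> mu l (\<rho> ! i) < t"
proof -
  obtain t' A where "t' < t" "A \<subseteq> {..<length \<rho>} \<times> UNIV" "card A = Suc n" "\<forall>(i, l)\<in>A. mu l (\<rho> ! i) \<le> t'"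
    using assms unfolding collection_mu_def Inf_less_iff by blast
  then show thesis by (intro that[of A]) (auto intro: le_less_trans)
qed

subsection \<open>Profiles\<close>

text \<open>The b-th profile \<open>\<sigma> b\<close> is seen in the member
  \<open>\<iota> b\<close> of the collections from the moving centre \<open>y b n\<close>.
  Separation of centres is demanded only within the same member, since different members are
  separate densities and never interact.\<close>

definition profile_system ::
    "(nat \<Rightarrow> ('a::euclidean_space \<Rightarrow> real) list) \<Rightarrow> nat \<Rightarrow> (nat \<Rightarrow> nat) \<Rightarrow> (nat \<Rightarrow> nat \<Rightarrow> 'a) \<Rightarrow> (nat \<Rightarrow> 'a \<Rightarrow> real) \<Rightarrow> nat \<Rightarrow> bool"
  where
  "profile_system \<rho> k \<iota> y \<sigma> P \<longleftrightarrow>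
     (\<forall>b<P. \<iota> b < k \<and> finite_density (\<sigma> b) \<and> 0 < mass (\<sigma> b) UNIV \<and>
        weakly_converges (\<lambda>n x. (\<rho> n ! \<iota> b) (x + y b n)) (\<sigma> b)) \<and>
     (\<forall>b<P. \<forall>c<P. b \<noteq> c \<longrightarrow> \<iota> b = \<iota> c \<longrightarrow> filterlim (\<lambda>n. dist (y b n) (y c n)) at_top sequentially)"

definition collections :: "nat \<Rightarrow> real \<Rightarrow> ('a::euclidean_space \<Rightarrow> real) list set" where
  "collections k m = {\<rho>. length \<rho> = k \<and> (\<forall>i<k. finite_density (\<rho> ! i)) \<and> (\<Sum>i<k. mass (\<rho> ! i) UNIV) = m}"

lemma profile_system_mono: "profile_system \<rho> k \<iota> y \<sigma> P \<Longrightarrow> P' \<le> P \<Longrightarrow> profile_system \<rho> k \<iota> y \<sigma> P'"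
  by (auto simp: profile_system_def)

lemma mu_zero_density: "mu l (\<lambda>_. 0) = \<infinity>"
  by (simp add: mu_def)

text \<open>Families realizing the small eigenvalues of the profiles have supports in one common
  ball. Moved to the centres they remain good for the densities of the sequence, and far apart
  centres make those put into the same member disjoint.\<close>

proposition collection_mu_upper_semicontinuous:
  assumes \<rho>: "\<And>n. \<rho> n \<in> collections k m"
    and prof: "profile_system \<rho> k \<iota> y \<sigma> P"
    and less: "collection_mu j (map \<sigma> [0..<P] @ replicate q (\<lambda>_. 0)) < ennreal t"
  shows "\<forall>\<^sub>F n in sequentially. collection_mu j (\<rho> n) \<le> ennreal t"
proof -
  let ?\<sigma> = "map \<sigma> [0..<P] @ replicate q (\<lambda>_. 0)"
  \<comment> \<open>Room below \<open>t\<close> is needed because the Rayleigh bound deteriorates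
    slightly when passing from the weak limit back to the sequence.\<close>
  obtain t0 where t0: "collection_mu j ?\<sigma> < t0" "t0 < ennreal t" using dense[OF less] by blast
  then obtain t' where t': "t0 = ennreal t'" "0 \<le> t'" by (cases t0) auto
  then have tt: "t' < t" using t0(2) by (simp add: ennreal_less_iff)
  obtain A where A: "A \<subseteq> {..<length ?\<sigma>} \<times> UNIV" "card A = Suc j" "\<And>b l. (b, l) \<in> A \<Longrightarrow> mu l (?\<sigma> ! b) < ennreal t'"
    using collection_mu_lessD t0(1) unfolding t'(1) by metis
  have finA: "finite A" using A(2) by (metis card.infinite nat.distinct(1))
  have AP: "b < P \<and> mu l (\<sigma> b) < ennreal t'" if "(b, l) \<in> A" for b l
  proof (cases "b < P")
    case True
    then show ?thesis using A(3)[OF that] by (simp add: nth_append)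
  next
    case False
    then have "?\<sigma> ! b = (\<lambda>_. 0)" using A(1) that by (auto simp: nth_append)
    then show ?thesis using A(3)[OF that] by (simp add: mu_zero_density)
  qed
  define B where "B = fst ` A"
  have B: "finite B" "\<And>b. b \<in> B \<Longrightarrow> b < P" using finA AP by (auto simp: B_def)
  \<comment> \<open>Only the largest index used for each profile matters: a family with
    \<open>L b + 1\<close> members accounts for all pairs \<open>(b, l)\<close> in
    \<open>A\<close>.\<close>
  define L where "L b = Max {l. (b, l) \<in> A}" for b
  have finL: "finite {l. (b, l) \<in> A}" for b
    by (rule finite_subset[of _ "snd ` A"]) (use finA in \<open>force+\<close>)
  have LA: "(b, L b) \<in> A" if "b \<in> B" for b
    using Max_in[OF finL, of b] that unfolding L_def B_def by force
  have Lmax: "l \<le> L b" if "(b, l) \<in> A" for b l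
    unfolding L_def using finL that by (intro Max_ge) auto
  have cardA: "Suc j \<le> (\<Sum>b\<in>B. Suc (L b))"
  proof -
    have "A \<subseteq> Sigma B (\<lambda>b. {..<Suc (L b)})" using Lmax by (force simp: B_def less_Suc_eq_le)
    then have "card A \<le> card (Sigma B (\<lambda>b. {..<Suc (L b)}))" by (intro card_mono) (use B in auto)
    then show ?thesis using A(2) B(1) by simp
  qed
  have "\<exists>u. spectral_family (\<sigma> b) {..<Suc (L b)} u t'" if "b \<in> B" for b
  proof -
    have "density_fun (\<sigma> b)" using prof B(2)[OF that] by (auto simp: profile_system_def finite_density_def)
    moreover have "mu (L b) (\<sigma> b) < ennreal t'" using AP[OF LA[OF that]] by blast
    ultimately show ?thesis using mu_less_imp_spectral_family by blast
  qed
  then obtain u where u: "\<And>b. b \<in> B \<Longrightarrow> spectral_family (\<sigma> b) {..<Suc (L b)} (u b) t'" by metis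
  have "bounded (\<Union>b\<in>B. \<Union>l\<in>{..<Suc (L b)}. {x. u b l x \<noteq> 0})"
  proof (rule bounded_UN[OF B(1)], rule ballI, rule bounded_UN[OF finite_lessThan], rule ballI)
    fix b l assume "b \<in> B" "l \<in> {..<Suc (L b)}"
    then have "u b l \<in> test_functions" using u by (auto simp: spectral_family_def)
    then show "bounded {x. u b l x \<noteq> 0}" by (rule test_functionsD(2))
  qed
  then obtain r where r: "\<forall>x\<in>(\<Union>b\<in>B. \<Union>l\<in>{..<Suc (L b)}. {x. u b l x \<noteq> 0}). norm x \<le> r"
    unfolding bounded_iff by blast
  have supp: "u b l x = 0" if "b \<in> B" "l < Suc (L b)" "x \<notin> cball 0 r" for b l x
  proof (rule ccontr)
    assume "u b l x \<noteq> 0"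
    then have "norm x \<le> r" using r that(1,2) by blast
    then show False using that(3) by simp
  qed
  have rho: "length (\<rho> n) = k" "\<And>i. i < k \<Longrightarrow> finite_density (\<rho> n ! i)" for n
    using \<rho>[of n] by (auto simp: collections_def)
  have iota: "\<iota> b < k" if "b \<in> B" for b using prof B(2)[OF that] by (auto simp: profile_system_def)
  have ev1: "\<forall>\<^sub>F n in sequentially. spectral_family (\<lambda>x. (\<rho> n ! \<iota> b) (x + y b n)) {..<Suc (L b)} (u b) t"
    if b: "b \<in> B" for b
  proof (rule spectral_family_weak_limit[OF _ _ _ u[OF b] tt])
    show "density_fun (\<sigma> b)" "weakly_converges (\<lambda>n x. (\<rho> n ! \<iota> b) (x + y b n)) (\<sigma> b)"
      using prof B(2)[OF b] by (auto simp: profile_system_def finite_density_def)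
    show "density_fun (\<lambda>x. (\<rho> n ! \<iota> b) (x + y b n))" for n
      using finite_density_translate[OF rho(2)[OF iota[OF b]]] by (simp add: finite_density_def)
  qed
  have ev2: "\<forall>\<^sub>F n in sequentially. b \<noteq> c \<longrightarrow> \<iota> b = \<iota> c \<longrightarrow> 2 * r < dist (y b n) (y c n)"
    if bc: "b \<in> B" "c \<in> B" for b c
  proof (cases "b \<noteq> c \<and> \<iota> b = \<iota> c")
    case True
    then have "filterlim (\<lambda>n. dist (y b n) (y c n)) at_top sequentially"
      using prof B(2)[OF bc(1)] B(2)[OF bc(2)] by (auto simp: profile_system_def)
    then show ?thesis by (auto simp: filterlim_at_top_dense elim: eventually_mono)
  next
    case False
    then show ?thesis by (cases "b = c") simp_all
  qed
  have "\<forall>\<^sub>F n in sequentially. \<forall>b\<in>B. spectral_family (\<lambda>x. (\<rho> n ! \<iota> b) (x + y b n)) {..<Suc (L b)} (u b) t"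
    using B(1) ev1 by (intro eventually_ball_finite) auto
  moreover have "\<forall>\<^sub>F n in sequentially. \<forall>b\<in>B. \<forall>c\<in>B. b \<noteq> c \<longrightarrow> \<iota> b = \<iota> c \<longrightarrow> 2 * r < dist (y b n) (y c n)"
    by (intro eventually_ball_finite[OF B(1)] ballI ev2)
  ultimately show ?thesis
  proof eventually_elim
    case (elim n)
    \<comment> \<open>Profiles are grouped by the member they come from; \<open>D i\<close> counts
      the functions transplanted into member i, and these counts add up to at least j + 1.\<close>
    define Bi where "Bi i = {b\<in>B. \<iota> b = i}" for i
    define D where "D i = (\<Sum>b\<in>Bi i. Suc (L b))" for i
    show ?case
    proof (rule collection_mu_le[where D=D])
      have "(\<Sum>i<k. D i) = (\<Sum>b\<in>B. Suc (L b))"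
        unfolding D_def Bi_def using iota B(1) by (intro sum.group) auto
      then show "j < (\<Sum>i<length (\<rho> n). D i)" using cardA rho(1) by simp
      fix i l assume il: "i < length (\<rho> n)" "l < D i"
      have fd: "finite_density (\<rho> n ! i)" using rho il by simp
      have "spectral_family (\<rho> n ! i) (Sigma (Bi i) (\<lambda>b. {..<Suc (L b)})) (\<lambda>(b, l). (\<lambda>l x. u b l (x - y b n)) l) t"
      proof (rule spectral_family_disjoint_union[where S="\<lambda>b. cball (y b n) r"])
        show "density_fun (\<rho> n ! i)" using fd by (simp add: finite_density_def)
        show "finite (Bi i)" using B(1) by (simp add: Bi_def)
        show "spectral_family (\<rho> n ! i) {..<Suc (L b)} (\<lambda>l x. u b l (x - y b n)) t" if "b \<in> Bi i" for b
          using spectral_family_translate[OF fd, of "y b n"] elim(1) that by (auto simp: Bi_def)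
        show "disjoint_family_on (\<lambda>b. cball (y b n) r) (Bi i)"
          unfolding disjoint_family_on_def
        proof (intro ballI impI)
          fix b c assume bc: "b \<in> Bi i" "c \<in> Bi i" "b \<noteq> c"
          have far: "2 * r < dist (y b n) (y c n)" using elim(2) bc by (auto simp: Bi_def)
          have "dist (y b n) (y c n) \<le> 2 * r" if "x \<in> cball (y b n) r" "x \<in> cball (y c n) r" for x
            using dist_triangle[of "y b n" "y c n" x] that by (simp add: dist_commute)
          then show "cball (y b n) r \<inter> cball (y c n) r = {}" using far by force
        qed
        show "u b l (x - y b n) = 0" if "b \<in> Bi i" "l \<in> {..<Suc (L b)}" "x \<notin> cball (y b n) r" for b l x
          by (rule supp) (use that in \<open>auto simp: Bi_def dist_norm norm_minus_commute\<close>)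
      qed simp
      then show "mu l (\<rho> n ! i) \<le> ennreal t"
        using fd il(2) B(1)
        by (intro mu_le_spectral_family[where I="Sigma (Bi i) (\<lambda>b. {..<Suc (L b)})"])
           (auto simp: finite_density_def D_def Bi_def)
    qed
  qed
qed

lemma collections_mass_le:
  assumes "\<rho> \<in> collections k m" "i < k"
  shows "finite_density (\<rho> ! i)" "mass (\<rho> ! i) UNIV \<le> m"
  using assms member_le_sum[of i "{..<k}" "\<lambda>i. mass (\<rho> ! i) UNIV"] by (auto simp: collections_def)

lemma collection_mu_mono:
  assumes "j \<le> k" shows "collection_mu j \<rho> \<le> collection_mu k \<rho>"
  unfolding collection_mu_def
proof (rule Inf_superset_mono, rule subsetI)
  fix t assume "t \<in> {t. \<exists>A\<subseteq>{..<length \<rho>} \<times> UNIV. card A = Suc k \<and> (\<forall>(i, l)\<in>A. mu l (\<rho> ! i) \<le> t)}"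
  then obtain A where A: "A \<subseteq> {..<length \<rho>} \<times> UNIV" "card A = Suc k" "\<forall>(i, l)\<in>A. mu l (\<rho> ! i) \<le> t"
    by blast
  have "Suc j \<le> card A" using A(2) assms by simp
  from obtain_subset_with_card_n[OF this] obtain A' where "A' \<subseteq> A" "card A' = Suc j" by metis
  then show "t \<in> {t. \<exists>A\<subseteq>{..<length \<rho>} \<times> UNIV. card A = Suc j \<and> (\<forall>(i, l)\<in>A. mu l (\<rho> ! i) \<le> t)}"
    using A(1,3) by (intro CollectI exI[of _ A']) auto
qed

text \<open>Contrapositive of \<open>mu_le_of_spread\<close> at a radius where its bound falls below
  \<open>c\<close>. Both constants are uniform over all collections of mass \<open>m\<close>,
  members and sets \<open>Z\<close>.\<close>

lemma nonvanishing:
  fixes m :: real and k :: nat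
  assumes c: "c > 0" and \<delta>: "\<delta> > 0"
  shows "\<exists>R>0. \<exists>\<eta>>0. \<forall>\<rho> :: ('a::euclidean_space \<Rightarrow> real) list. \<rho> \<in> collections k m \<longrightarrow>
    ennreal c \<le> collection_mu k \<rho> \<longrightarrow>
    (\<forall>i<k. \<forall>Z\<in>sets lebesgue. \<delta> \<le> mass (\<rho> ! i) Z \<longrightarrow> (\<exists>a. \<eta> < mass (\<rho> ! i) (Z \<inter> cball a R)))"
proof -
  define C where "C = bump_const * (2 ^ DIM('a) * m / (\<delta> / 2) + 1)"
  \<comment> \<open>Yields c R^2 = |C| + c > C; the summand 1 also makes R positive.\<close>
  define R where "R = sqrt (\<bar>C\<bar> / c + 1)"
  have R2: "R\<^sup>2 = \<bar>C\<bar> / c + 1" using c by (simp add: R_def)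
  have R: "R > 0" unfolding R_def using c by (simp add: add_nonneg_pos)
  have small: "C / R\<^sup>2 < c"
  proof -
    have "c * R\<^sup>2 = \<bar>C\<bar> + c" unfolding R2 using c by (simp add: distrib_left)
    then have "C < c * R\<^sup>2" using c by linarith
    then show ?thesis using R by (simp add: pos_divide_less_eq)
  qed
  define \<eta> where "\<eta> = \<delta> / (2 * real (Suc k))"
  have \<eta>: "\<eta> > 0" unfolding \<eta>_def using \<delta> by simp
  have "\<exists>a. \<eta> < mass (\<rho> ! i) (Z \<inter> cball a (5 * R))"
    if \<rho>: "\<rho> \<in> collections k m" and low: "ennreal c \<le> collection_mu k \<rho>" and i: "i < k"
      and Z: "Z \<in> sets lebesgue" "\<delta> \<le> mass (\<rho> ! i) Z"
    for \<rho> :: "('a \<Rightarrow> real) list" and i Z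
  proof (rule ccontr)
    assume "\<not> ?thesis"
    then have spread: "mass (\<rho> ! i) (Z \<inter> cball a (5 * R)) \<le> \<delta> / (2 * real (Suc k))" for a
      unfolding \<eta>_def by (simp only: not_less not_ex)
    have "collection_mu k \<rho> \<le> ennreal (C / R\<^sup>2)"
    \<comment> \<open>The single member \<open>i\<close> already supplies k + 1 small
      eigenvalues.\<close>
    proof (rule collection_mu_le[where D="\<lambda>j. if j = i then Suc k else 0"])
      show "k < (\<Sum>j<length \<rho>. if j = i then Suc k else 0)"
        using \<rho> i by (simp add: collections_def)
      fix j l assume "j < length \<rho>" "l < (if j = i then Suc k else 0)"
      then have "j = i" "l \<le> k" by (auto split: if_splits)
      then show "mu l (\<rho> ! j) \<le> ennreal (C / R\<^sup>2)"
        using mu_le_of_spread[OF collections_mass_le[OF \<rho> i] R \<delta> Z spread] unfolding C_def by simp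
    qed
    then have "ennreal c \<le> ennreal (C / R\<^sup>2)" using low by (rule order_trans[rotated])
    then have "c \<le> C / R\<^sup>2" using c by (simp add: ennreal_le_iff2)
    then show False using small by simp
  qed
  then show ?thesis
    using \<eta> R by (intro exI[of _ "5 * R"] exI[of _ \<eta>] conjI allI impI ballI) auto
qed

section \<open>Mass and number of profiles, and their extension\<close>

lemma sigma_finite_lebesgue: "sigma_finite_measure (lebesgue :: 'a::euclidean_space measure)"
proof
  have "(\<Union>n. cball 0 (real n)) = (UNIV :: 'a set)" by (auto intro: real_arch_simple)
  then show "\<exists>A. countable A \<and> A \<subseteq> sets lebesgue \<and> \<Union> A = space lebesgue \<and> (\<forall>a\<in>A. emeasure lebesgue (a :: 'a set) \<noteq> \<infinity>)"
    using emeasure_bounded_finite[OF bounded_cball[of "0::'a"]]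
    by (intro exI[of _ "range (\<lambda>n. cball 0 (real n))"]) (auto simp: less_top)
qed

lemma indicator_cball_L12: "(\<lambda>x. indicator (cball a r) x) \<in> L12 lebesgue"
proof -
  have "integrable lebesgue (indicator (cball a r) :: 'a \<Rightarrow> real)"
    using emeasure_bounded_finite[OF bounded_cball[of a r]]
    by (intro integrable_real_indicator) auto
  moreover have "(\<lambda>x. (indicator (cball a r) x :: real)\<^sup>2) = indicator (cball a r)"
    by (auto simp: indicator_def fun_eq_iff)
  ultimately show ?thesis by (simp add: L12_def)
qed

lemma profile_mass_tendsto:
  assumes \<rho>: "\<And>n. \<rho> n \<in> collections k m" and prof: "profile_system \<rho> k \<iota> y \<sigma> P" and b: "b < P"
  shows "(\<lambda>n. mass (\<rho> n ! \<iota> b) (cball (y b n) r)) \<longlonglongrightarrow> mass (\<sigma> b) (cball 0 r)"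
proof -
  have \<sigma>: "finite_density (\<sigma> b)" and \<iota>: "\<iota> b < k"
    and lim: "weakly_converges (\<lambda>n x. (\<rho> n ! \<iota> b) (x + y b n)) (\<sigma> b)"
    using prof b by (auto simp: profile_system_def)
  have "(\<lambda>n. \<integral>x. (\<rho> n ! \<iota> b) (x + y b n) * indicator (cball 0 r) x \<partial>lebesgue)
      \<longlonglongrightarrow> (\<integral>x. \<sigma> b x * indicator (cball 0 r) x \<partial>lebesgue)"
    using lim[unfolded weakly_converges_def] indicator_cball_L12 by (rule bspec)
  then show ?thesis
    using mass_translate_cball[OF collections_mass_le(1)[OF \<rho> \<iota>]] mass_eq_integral[OF \<sigma>, of "cball 0 r"] by simp
qed

text \<open>For a fixed radius the balls around the centres are eventually disjoint within each
  member, so their masses add up to at most m. The limit in n is taken first, then the radius tends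
  to infinity.\<close>

lemma profile_total_mass_le:
  assumes \<rho>: "\<And>n. \<rho> n \<in> collections k m" and prof: "profile_system \<rho> k \<iota> y \<sigma> P"
  shows "(\<Sum>b<P. mass (\<sigma> b) UNIV) \<le> m"
proof -
  have \<sigma>: "finite_density (\<sigma> b)" and \<iota>: "\<iota> b < k" if "b < P" for b
    using prof that by (auto simp: profile_system_def)
  have le: "(\<Sum>b<P. mass (\<sigma> b) (cball 0 r)) \<le> m" for r
  proof (rule LIMSEQ_le_const2)
    show "(\<lambda>n. \<Sum>b<P. mass (\<rho> n ! \<iota> b) (cball (y b n) r)) \<longlonglongrightarrow> (\<Sum>b<P. mass (\<sigma> b) (cball 0 r))"
      by (intro tendsto_sum profile_mass_tendsto[OF \<rho> prof]) auto
    have ev: "\<forall>\<^sub>F n in sequentially. b \<noteq> c \<longrightarrow> \<iota> b = \<iota> c \<longrightarrow> 2 * r < dist (y b n) (y c n)"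
      if "b < P" "c < P" for b c
    proof (cases "b \<noteq> c \<and> \<iota> b = \<iota> c")
      case True
      then have "filterlim (\<lambda>n. dist (y b n) (y c n)) at_top sequentially"
        using prof that by (auto simp: profile_system_def)
      then show ?thesis by (auto simp: filterlim_at_top_dense elim: eventually_mono)
    next
      case False
      then show ?thesis by (cases "b = c") simp_all
    qed
    have "\<forall>\<^sub>F n in sequentially. \<forall>b\<in>{..<P}. \<forall>c\<in>{..<P}. b \<noteq> c \<longrightarrow> \<iota> b = \<iota> c \<longrightarrow> 2 * r < dist (y b n) (y c n)"
      by (intro eventually_ball_finite[OF finite_lessThan] ballI ev) auto
    then have "\<forall>\<^sub>F n in sequentially. (\<Sum>b<P. mass (\<rho> n ! \<iota> b) (cball (y b n) r)) \<le> m"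
    proof eventually_elim
      case (elim n)
      have "(\<Sum>b<P. mass (\<rho> n ! \<iota> b) (cball (y b n) r)) =
          (\<Sum>i<k. \<Sum>b\<in>{b\<in>{..<P}. \<iota> b = i}. mass (\<rho> n ! \<iota> b) (cball (y b n) r))"
        using \<iota> by (intro sum.group[symmetric]) auto
      also have "\<dots> \<le> (\<Sum>i<k. mass (\<rho> n ! i) UNIV)"
      proof (rule sum_mono)
        fix i assume "i \<in> {..<k}"
        then interpret M: finite_measure "mass_measure (\<rho> n ! i)"
          using collections_mass_le(1)[OF \<rho>] by (intro finite_measure_mass) auto
        have "(\<Sum>b\<in>{b\<in>{..<P}. \<iota> b = i}. mass (\<rho> n ! \<iota> b) (cball (y b n) r)) =
            (\<Sum>b\<in>{b\<in>{..<P}. \<iota> b = i}. mass (\<rho> n ! i) (cball (y b n) r))"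
          by (rule sum.cong) auto
        also have "\<dots> = mass (\<rho> n ! i) (\<Union>b\<in>{b\<in>{..<P}. \<iota> b = i}. cball (y b n) r)"
        proof (rule M.finite_measure_finite_Union[symmetric])
          show "disjoint_family_on (\<lambda>b. cball (y b n) r) {b\<in>{..<P}. \<iota> b = i}"
            unfolding disjoint_family_on_def
          proof (intro ballI impI)
            fix b c assume bc: "b \<in> {b\<in>{..<P}. \<iota> b = i}" "c \<in> {b\<in>{..<P}. \<iota> b = i}" "b \<noteq> c"
            have far: "2 * r < dist (y b n) (y c n)" using elim bc by auto
            have "dist (y b n) (y c n) \<le> 2 * r" if "x \<in> cball (y b n) r" "x \<in> cball (y c n) r" for x
              using dist_triangle[of "y b n" "y c n" x] that by (simp add: dist_commute)
            then show "cball (y b n) r \<inter> cball (y c n) r = {}" using far by force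
          qed
        qed auto
        also have "\<dots> \<le> mass (\<rho> n ! i) UNIV" by (rule M.finite_measure_mono) auto
        finally show "(\<Sum>b\<in>{b\<in>{..<P}. \<iota> b = i}. mass (\<rho> n ! \<iota> b) (cball (y b n) r)) \<le> mass (\<rho> n ! i) UNIV" .
      qed
      also have "\<dots> = m" using \<rho>[of n] by (simp add: collections_def)
      finally show ?case .
    qed
    then show "\<exists>N. \<forall>n\<ge>N. (\<Sum>b<P. mass (\<rho> n ! \<iota> b) (cball (y b n) r)) \<le> m"
      by (simp add: eventually_sequentially)
  qed
  show ?thesis
  proof (rule LIMSEQ_le_const2)
    show "(\<lambda>r. \<Sum>b<P. mass (\<sigma> b) (cball 0 (real r))) \<longlonglongrightarrow> (\<Sum>b<P. mass (\<sigma> b) UNIV)"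
      using \<sigma> by (intro tendsto_sum mass_cball_tendsto) auto
  qed (use le in auto)
qed

text \<open>Each profile contributes an eigenvalue 0, so k + 1 of them make the entry of index k
  vanish, and upper semicontinuity contradicts the lower bound \<open>c\<close>.\<close>

lemma profile_count_le:
  assumes \<rho>: "\<And>n. \<rho> n \<in> collections k m" and low: "\<And>n. ennreal c \<le> collection_mu k (\<rho> n)" and c: "c > 0"
    and prof: "profile_system \<rho> k \<iota> y \<sigma> P"
  shows "P \<le> k"
proof (rule ccontr)
  assume "\<not> P \<le> k"
  then have prof': "profile_system \<rho> k \<iota> y \<sigma> (Suc k)" using prof profile_system_mono by (metis not_less_eq_eq)
  have "collection_mu k (map \<sigma> [0..<Suc k] @ replicate 0 (\<lambda>_. 0)) \<le> 0"
  proof (rule collection_mu_le[where D="\<lambda>_. 1"])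
    fix i l :: nat assume "i < length (map \<sigma> [0..<Suc k] @ replicate 0 (\<lambda>_. 0))" "l < 1"
    then have "i < Suc k" "l = 0" by auto
    then show "mu l ((map \<sigma> [0..<Suc k] @ replicate 0 (\<lambda>_. 0)) ! i) \<le> 0"
      using prof' mu_0_eq_0[of "\<sigma> i"] by (simp add: profile_system_def del: upt_Suc)
  qed simp
  also have "0 < ennreal (c / 2)" using c by simp
  finally have "\<forall>\<^sub>F n in sequentially. collection_mu k (\<rho> n) \<le> ennreal (c / 2)"
    by (rule collection_mu_upper_semicontinuous[OF \<rho> prof'])
  then obtain n where "collection_mu k (\<rho> n) \<le> ennreal (c / 2)" by (auto dest: eventually_happens)
  then have "ennreal c \<le> ennreal (c / 2)" using low[of n] by (rule order_trans[rotated])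
  then show False using c by (simp add: ennreal_le_iff)
qed

text \<open>The constant 1 is not an admissible test function, so the mass bound is obtained on
  balls and carried to the whole space by monotone convergence.\<close>

lemma weak_limit_finite_density:
  fixes g :: "'a::euclidean_space \<Rightarrow> real"
  assumes f: "\<And>n. finite_density (f n)" "\<And>n. (\<integral>x. f n x \<partial>lebesgue) \<le> m"
    and g: "density_fun g" and lim: "weakly_converges f g"
  shows "finite_density g"
proof -
  let ?g = "\<lambda>r::nat. \<lambda>x. g x * indicator (cball 0 (real r)) x"
  have g01: "g \<in> borel_measurable lebesgue" "\<And>x. 0 \<le> g x" "\<And>x. g x \<le> 1"
    using g by (auto simp: density_fun_def)
  have int: "integrable lebesgue (?g r)" for r
    by (rule integrable_mult_unit_interval[OF g01])
       (use indicator_cball_L12[of "0::'a" "real r"] in \<open>simp add: L12_def\<close>)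
  have le: "(\<integral>x. ?g r x \<partial>lebesgue) \<le> m" for r
  proof (rule LIMSEQ_le_const2)
    show "(\<lambda>n. \<integral>x. f n x * indicator (cball 0 (real r)) x \<partial>lebesgue) \<longlonglongrightarrow> (\<integral>x. ?g r x \<partial>lebesgue)"
      using lim[unfolded weakly_converges_def] indicator_cball_L12 by (rule bspec)
    have "(\<integral>x. f n x * indicator (cball 0 (real r)) x \<partial>lebesgue) \<le> m" for n
    proof -
      have "(\<integral>x. f n x * indicator (cball 0 (real r)) x \<partial>lebesgue) \<le> (\<integral>x. f n x \<partial>lebesgue)"
        using f(1)[of n] finite_density_integrable_mult[OF f(1), of "cball 0 (real r)" n]
        by (intro integral_mono) (auto simp: finite_density_def density_fun_def indicator_def)
      then show ?thesis using f(2)[of n] by linarith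
    qed
    then show "\<exists>N. \<forall>n\<ge>N. (\<integral>x. f n x * indicator (cball 0 (real r)) x \<partial>lebesgue) \<le> m" by blast
  qed
  have mono: "?g r x \<le> ?g r' x" if "r \<le> r'" for r r' x
    using that g01(2)[of x] by (auto simp: indicator_def)
  have "incseq (\<lambda>r. \<integral>x. ?g r x \<partial>lebesgue)"
    unfolding incseq_def using mono int by (auto intro!: integral_mono)
  then obtain l where l: "(\<lambda>r. \<integral>x. ?g r x \<partial>lebesgue) \<longlonglongrightarrow> l"
    using incseq_convergent[of "\<lambda>r. \<integral>x. ?g r x \<partial>lebesgue" m] le by blast
  have "integrable lebesgue g"
  proof (rule integrable_monotone_convergence[OF int _ _ l g01(1)])
    show "AE x in lebesgue. mono (\<lambda>r. ?g r x)" using mono by (auto simp: mono_def)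
    show "AE x in lebesgue. (\<lambda>r. ?g r x) \<longlonglongrightarrow> g x"
    proof (rule AE_I2)
      fix x :: 'a
      obtain N :: nat where "norm x \<le> real N" using real_arch_simple by blast
      then have "\<forall>r\<ge>N. ?g r x = g x" by (auto simp: indicator_def)
      then show "(\<lambda>r. ?g r x) \<longlonglongrightarrow> g x"
        by (intro tendsto_eventually) (auto simp: eventually_sequentially)
    qed
  qed
  then show ?thesis using g by (simp add: finite_density_def)
qed

text \<open>Outside balls around the known centres some member keeps mass at least \<delta>, and
  \<open>nonvanishing\<close> concentrates part of it in a ball of radius R. Recentring there gives
  a nonzero weak limit, and letting the removed balls grow separates the new centre from the old
  ones.\<close>

lemma profile_system_extend:
  fixes \<rho> :: "nat \<Rightarrow> ('a::euclidean_space \<Rightarrow> real) list"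
  assumes \<rho>: "\<And>n. \<rho> n \<in> collections k m" and low: "\<And>n. ennreal c \<le> collection_mu k (\<rho> n)" and c: "c > 0"
    and prof: "profile_system \<rho> k \<iota> y \<sigma> P" and deficit: "(\<Sum>b<P. mass (\<sigma> b) UNIV) < m"
  shows "\<exists>s \<iota>' y' \<sigma>'. strict_mono s \<and> profile_system (\<lambda>n. \<rho> (s n)) k \<iota>' y' \<sigma>' (Suc P)"
proof -
  define M where "M = (\<Sum>b<P. mass (\<sigma> b) UNIV)"
  \<comment> \<open>The balls eventually hold less than M + (m - M) / 2, so more than half of the
    deficit lies outside them; one of the k members then carries at least this \<delta>
    there.\<close>
  define \<delta> where "\<delta> = (m - M) / (2 * real (Suc k))"
  have \<delta>: "\<delta> > 0" unfolding \<delta>_def using deficit by (simp add: M_def)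
  have \<sigma>: "finite_density (\<sigma> b)" and \<iota>: "\<iota> b < k" if "b < P" for b
    using prof that by (auto simp: profile_system_def)
  obtain R \<eta> where R: "R > 0" and \<eta>: "\<eta> > 0" and
    nv: "\<And>\<rho> :: ('a \<Rightarrow> real) list. \<And>i Z. \<rho> \<in> collections k m \<Longrightarrow> ennreal c \<le> collection_mu k \<rho> \<Longrightarrow> i < k \<Longrightarrow>
      Z \<in> sets lebesgue \<Longrightarrow> \<delta> \<le> mass (\<rho> ! i) Z \<Longrightarrow> \<exists>a. \<eta> < mass (\<rho> ! i) (Z \<inter> cball a R)"
    using nonvanishing[OF c \<delta>, where 'a='a and k=k and m=m] by metis
  define Z where "Z r n i = - (\<Union>b\<in>{b\<in>{..<P}. \<iota> b = i}. cball (y b n) r)" for r n i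
  have Zm: "Z r n i \<in> sets lebesgue" for r n i
  proof -
    have "closed (\<Union>b\<in>{b\<in>{..<P}. \<iota> b = i}. cball (y b n) r)" by auto
    then have "open (Z r n i)" unfolding Z_def by (simp only: open_Compl)
    then show ?thesis by (simp add: borel_open)
  qed
  define Q where "Q r n = (\<exists>i<k. \<exists>a. \<eta> < mass (\<rho> n ! i) (Z (real r) n i \<inter> cball a R))" for r n
  have evQ: "\<forall>\<^sub>F n in sequentially. Q r n" for r
  proof -
    have "(\<lambda>n. \<Sum>b<P. mass (\<rho> n ! \<iota> b) (cball (y b n) (real r))) \<longlonglongrightarrow> (\<Sum>b<P. mass (\<sigma> b) (cball 0 (real r)))"
      by (intro tendsto_sum profile_mass_tendsto[OF \<rho> prof]) auto
    moreover have "(\<Sum>b<P. mass (\<sigma> b) (cball 0 (real r))) \<le> M"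
      unfolding M_def using \<sigma>
      by (intro sum_mono finite_measure.finite_measure_mono finite_measure_mass) auto
    then have "(\<Sum>b<P. mass (\<sigma> b) (cball 0 (real r))) < M + (m - M) / 2"
      using deficit unfolding M_def[symmetric] by (simp add: field_simps)
    ultimately have "\<forall>\<^sub>F n in sequentially. (\<Sum>b<P. mass (\<rho> n ! \<iota> b) (cball (y b n) (real r))) < M + (m - M) / 2"
      by (rule order_tendstoD(2))
    then show ?thesis
    proof eventually_elim
      case (elim n)
      have "\<exists>i<k. \<delta> \<le> mass (\<rho> n ! i) (Z (real r) n i)"
      proof (rule ccontr)
        assume "\<not> ?thesis"
        then have small: "mass (\<rho> n ! i) (Z (real r) n i) \<le> \<delta>" if "i < k" for i
          using that by (auto simp: not_le less_imp_le)
        have "m = (\<Sum>i<k. mass (\<rho> n ! i) UNIV)" using \<rho>[of n] by (simp add: collections_def)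
        also have "\<dots> \<le> (\<Sum>i<k. \<delta> + (\<Sum>b\<in>{b\<in>{..<P}. \<iota> b = i}. mass (\<rho> n ! \<iota> b) (cball (y b n) (real r))))"
        proof (rule sum_mono)
          fix i assume i: "i \<in> {..<k}"
          let ?U = "\<Union>b\<in>{b\<in>{..<P}. \<iota> b = i}. cball (y b n) (real r)"
          have "UNIV = Z (real r) n i \<union> ?U" by (auto simp: Z_def)
          then have "mass (\<rho> n ! i) UNIV = mass (\<rho> n ! i) (Z (real r) n i \<union> ?U)" by (simp only:)
          also have "\<dots> \<le> mass (\<rho> n ! i) (Z (real r) n i) + mass (\<rho> n ! i) ?U"
            using Zm by (intro measure_Un_le) auto
          also have "mass (\<rho> n ! i) ?U \<le> (\<Sum>b\<in>{b\<in>{..<P}. \<iota> b = i}. mass (\<rho> n ! i) (cball (y b n) (real r)))"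
            by (rule measure_UNION_le) auto
          also have "\<dots> = (\<Sum>b\<in>{b\<in>{..<P}. \<iota> b = i}. mass (\<rho> n ! \<iota> b) (cball (y b n) (real r)))"
            by (rule sum.cong) auto
          finally show "mass (\<rho> n ! i) UNIV \<le> \<delta> + (\<Sum>b\<in>{b\<in>{..<P}. \<iota> b = i}. mass (\<rho> n ! \<iota> b) (cball (y b n) (real r)))"
            using small[of i] i by simp
        qed
        also have "\<dots> = real k * \<delta> + (\<Sum>b<P. mass (\<rho> n ! \<iota> b) (cball (y b n) (real r)))"
        proof -
          have "(\<Sum>i<k. \<Sum>b\<in>{b\<in>{..<P}. \<iota> b = i}. mass (\<rho> n ! \<iota> b) (cball (y b n) (real r))) =
              (\<Sum>b<P. mass (\<rho> n ! \<iota> b) (cball (y b n) (real r)))"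
            using \<iota> by (intro sum.group) auto
          then show ?thesis by (simp add: sum.distrib)
        qed
        also have "\<dots> < real k * \<delta> + (M + (m - M) / 2)" using elim by simp
        also have "real k * \<delta> \<le> (m - M) / 2"
        proof -
          have "real k * \<delta> \<le> real (Suc k) * \<delta>" using \<delta> by simp
          also have "\<dots> = (m - M) / 2" unfolding \<delta>_def by (simp add: field_simps)
          finally show ?thesis .
        qed
        finally show False by (simp add: field_simps)
      qed
      then obtain i where i: "i < k" "\<delta> \<le> mass (\<rho> n ! i) (Z (real r) n i)" by blast
      from nv[OF \<rho> low i(1) Zm i(2)] i(1) show ?case unfolding Q_def by blast
    qed
  qed
  \<comment> \<open>Diagonal choice: the removed balls have radius \<open>r\<close> at time
    \<open>s r\<close>, so the radius tends to infinity along the new subsequence.\<close>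
  have "\<exists>s. \<forall>r. Q r (s r) \<and> s r < s (Suc r)"
  proof (rule dependent_nat_choice)
    show "\<exists>n. Q 0 n" using evQ[of 0] by (auto dest: eventually_happens)
    fix n r assume "Q r n"
    have "\<forall>\<^sub>F n' in sequentially. Q (Suc r) n' \<and> n < n'"
      using evQ[of "Suc r"] eventually_gt_at_top[of n] by eventually_elim simp
    then show "\<exists>n'. Q (Suc r) n' \<and> n < n'" by (auto dest: eventually_happens)
  qed
  then obtain s where s: "\<And>r. Q r (s r)" "\<And>r. s r < s (Suc r)" by blast
  have sm: "strict_mono s" using s(2) by (simp add: strict_mono_Suc_iff)
  have "\<forall>r. \<exists>i a. i < k \<and> \<eta> < mass (\<rho> (s r) ! i) (Z (real r) (s r) i \<inter> cball a R)"
    using s(1) unfolding Q_def by blast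
  then obtain i a where ia: "\<And>r. i r < k" "\<And>r. \<eta> < mass (\<rho> (s r) ! i r) (Z (real r) (s r) (i r) \<inter> cball (a r) R)"
    by metis
  \<comment> \<open>The member in which mass concentrates may vary with \<open>r\<close>; one of the
    finitely many occurs infinitely often.\<close>
  have "\<exists>i0. infinite {r. i r = i0}"
  proof (rule ccontr)
    assume "\<not> ?thesis"
    then have "finite (\<Union>i0<k. {r. i r = i0})" by auto
    moreover have "(\<Union>i0<k. {r. i r = i0}) = UNIV" using ia(1) by auto
    ultimately show False by simp
  qed
  then obtain i0 where "infinite {r. i r = i0}" ..
  from infinite_enumerate[OF this] obtain s2 :: "nat \<Rightarrow> nat"
    where s2': "strict_mono s2 \<and> (\<forall>n. s2 n \<in> {r. i r = i0})" ..
  then have s2: "strict_mono s2" "\<And>n. i (s2 n) = i0" by simp_all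
  have i0: "i0 < k" using ia(1)[of "s2 0"] s2(2)[of 0] by simp
  define f where "f n = (\<lambda>x. (\<rho> (s (s2 n)) ! i0) (x + a (s2 n)))" for n
  have fd: "finite_density (\<rho> n ! i0)" for n by (rule collections_mass_le(1)[OF \<rho> i0])
  have f: "finite_density (f n)" for n unfolding f_def by (rule finite_density_translate[OF fd])
  have fm: "(\<integral>x. f n x \<partial>lebesgue) \<le> m" for n
  proof -
    have "(\<integral>x. f n x \<partial>lebesgue) = (\<integral>x. (\<rho> (s (s2 n)) ! i0) x \<partial>lebesgue)"
      unfolding f_def by (rule integral_translation(1)) (use fd in \<open>simp add: finite_density_def density_fun_def\<close>)
    also have "\<dots> = mass (\<rho> (s (s2 n)) ! i0) UNIV" using mass_eq_integral[OF fd, of UNIV] by simp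
    finally show ?thesis using collections_mass_le(2)[OF \<rho> i0] by simp
  qed
  have sf: "sigma_finite_measure (lebesgue :: 'a measure)" by (rule sigma_finite_lebesgue)
  obtain s3 g where s3: "strict_mono s3" and g: "g \<in> borel_measurable lebesgue" "\<And>x. 0 \<le> g x" "\<And>x. g x \<le> 1"
    and glim: "\<And>\<phi>. \<phi> \<in> L12 lebesgue \<Longrightarrow> (\<lambda>n. \<integral>x. f (s3 n) x * \<phi> x \<partial>lebesgue) \<longlonglongrightarrow> (\<integral>x. g x * \<phi> x \<partial>lebesgue)"
  proof (rule weakly_convergent_subsequence[OF sf, of f m])
    show "integrable lebesgue (f n)" "0 \<le> f n x" "f n x \<le> 1" "(\<integral>x. f n x \<partial>lebesgue) \<le> m" for n x
      using f[of n] fm[of n] by (auto simp: finite_density_def density_fun_def)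
    fix s3 and g :: "'a \<Rightarrow> real"
    assume a: "strict_mono s3" "g \<in> borel_measurable lebesgue" "\<And>x. 0 \<le> g x" "\<And>x. g x \<le> 1"
      "\<And>\<phi>. \<phi> \<in> L12 lebesgue \<Longrightarrow> (\<lambda>n. \<integral>x. f (s3 n) x * \<phi> x \<partial>lebesgue) \<longlonglongrightarrow> (\<integral>x. g x * \<phi> x \<partial>lebesgue)"
    show thesis by (rule that[OF a])
  qed
  have wl: "weakly_converges (\<lambda>n. f (s3 n)) g" using glim by (simp add: weakly_converges_def)
  have gd: "finite_density g"
    by (rule weak_limit_finite_density[OF _ _ _ wl, of m]) (use f fm g in \<open>auto simp: density_fun_def\<close>)
  define q where "q n = s2 (s3 n)" for n
  define t where "t n = s (q n)" for n
  have qm: "strict_mono q" unfolding q_def using s2(1) s3 by (simp add: strict_mono_def)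
  have tm: "strict_mono t" unfolding t_def using sm qm by (simp add: strict_mono_def)
  have iq: "i (q n) = i0" for n unfolding q_def by (rule s2(2))
  have hit: "\<eta> < mass (\<rho> (t n) ! i0) (Z (real (q n)) (t n) i0 \<inter> cball (a (q n)) R)" for n
    using ia(2)[of "q n"] unfolding t_def iq .
  have gpos: "0 < mass g UNIV"
  proof -
    have "(\<lambda>n. \<integral>x. f (s3 n) x * indicator (cball 0 R) x \<partial>lebesgue) \<longlonglongrightarrow> (\<integral>x. g x * indicator (cball 0 R) x \<partial>lebesgue)"
      by (rule glim[OF indicator_cball_L12])
    \<comment> \<open>The mass \<eta> stays in one ball of fixed radius after recentring, so it
      cannot be lost in the weak limit.\<close>
    moreover have "\<eta> \<le> (\<integral>x. f (s3 n) x * indicator (cball 0 R) x \<partial>lebesgue)" for n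
    proof -
      interpret F: finite_measure "mass_measure (\<rho> (t n) ! i0)" by (rule finite_measure_mass[OF fd])
      have "\<eta> < mass (\<rho> (t n) ! i0) (Z (real (q n)) (t n) i0 \<inter> cball (a (q n)) R)" by (rule hit)
      also have "\<dots> \<le> mass (\<rho> (t n) ! i0) (cball (a (q n)) R)" by (rule F.finite_measure_mono) auto
      also have "\<dots> = (\<integral>x. f (s3 n) x * indicator (cball 0 R) x \<partial>lebesgue)"
        unfolding f_def t_def q_def by (rule mass_translate_cball[OF fd, symmetric])
      finally show ?thesis by simp
    qed
    ultimately have "\<eta> \<le> (\<integral>x. g x * indicator (cball 0 R) x \<partial>lebesgue)"
      by (intro LIMSEQ_le_const) auto
    also have "\<dots> = mass g (cball 0 R)" using mass_eq_integral[OF gd, of "cball 0 R"] by simp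
    also have "\<dots> \<le> mass g UNIV"
      by (rule finite_measure.finite_measure_mono[OF finite_measure_mass[OF gd]]) auto
    finally show ?thesis using \<eta> by simp
  qed
  have far: "filterlim (\<lambda>n. dist (y b (t n)) (a (q n))) at_top sequentially" if b: "b < P" "\<iota> b = i0" for b
  proof (rule filterlim_at_top_mono)
    show "filterlim (\<lambda>n. real n + (- R)) at_top sequentially"
      using filterlim_tendsto_add_at_top[OF tendsto_const filterlim_real_sequentially, of "- R"]
      by (simp add: add.commute)
    show "\<forall>\<^sub>F n in sequentially. real n + (- R) \<le> dist (y b (t n)) (a (q n))"
    proof (rule always_eventually, rule allI)
      fix n
      \<comment> \<open>Positive mass makes the intersection nonempty: some point is within R of the
        new centre and farther than \<open>q n\<close> from each old centre in this member.\<close>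
      have "Z (real (q n)) (t n) i0 \<inter> cball (a (q n)) R \<noteq> {}"
      proof
        assume "Z (real (q n)) (t n) i0 \<inter> cball (a (q n)) R = {}"
        then show False using hit[of n] \<eta> by simp
      qed
      then obtain x where x: "x \<in> Z (real (q n)) (t n) i0" "dist (a (q n)) x \<le> R" by auto
      have "real (q n) < dist (y b (t n)) x" using x(1) b by (auto simp: Z_def not_le)
      moreover have "dist (y b (t n)) x \<le> dist (y b (t n)) (a (q n)) + dist (a (q n)) x" by (rule dist_triangle)
      moreover have "real n \<le> real (q n)" using seq_suble[OF qm, of n] by simp
      ultimately show "real n + (- R) \<le> dist (y b (t n)) (a (q n))" using x(2) by linarith
    qed
  qed
  let ?\<iota> = "\<iota>(P := i0)" and ?\<sigma> = "\<sigma>(P := g)"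
  let ?y = "\<lambda>b n. if b = P then a (q n) else y b (t n)"
  have 1: "?\<iota> b < k \<and> finite_density (?\<sigma> b) \<and> 0 < mass (?\<sigma> b) UNIV \<and>
      weakly_converges (\<lambda>n x. (\<rho> (t n) ! ?\<iota> b) (x + ?y b n)) (?\<sigma> b)" if "b < Suc P" for b
  proof (cases "b = P")
    case True
    then show ?thesis using i0 gd gpos wl by (simp add: f_def t_def q_def)
  next
    case False
    then have "weakly_converges (\<lambda>n x. (\<rho> n ! \<iota> b) (x + y b n)) (\<sigma> b)"
      "\<iota> b < k" "finite_density (\<sigma> b)" "0 < mass (\<sigma> b) UNIV"
      using prof that by (auto simp: profile_system_def)
    then show ?thesis
      using weakly_converges_subseq[OF _ tm, of "\<lambda>n x. (\<rho> n ! \<iota> b) (x + y b n)" "\<sigma> b"] False by simp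
  qed
  have 2: "filterlim (\<lambda>n. dist (?y b n) (?y b' n)) at_top sequentially"
    if bb: "b < Suc P" "b' < Suc P" "b \<noteq> b'" "?\<iota> b = ?\<iota> b'" for b b'
  proof -
    consider "b = P" "b' < P" | "b < P" "b' = P" | "b < P" "b' < P" using bb by linarith
    then show ?thesis
    proof cases
      case 1
      then show ?thesis using far[of b'] bb by (simp add: dist_commute)
    next
      case 2
      then show ?thesis using far[of b] bb by simp
    next
      case 3
      then have "filterlim (\<lambda>n. dist (y b n) (y b' n)) at_top sequentially"
        using prof bb by (auto simp: profile_system_def)
      from filterlim_compose[OF this filterlim_subseq[OF tm]] show ?thesis using 3 by simp
    qed
  qed
  have "profile_system (\<lambda>n. \<rho> (t n)) k ?\<iota> ?y ?\<sigma> (Suc P)"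
    unfolding profile_system_def using 1 2 by blast
  with tm show ?thesis by blast
qed

lemma finite_density_zero: "finite_density (\<lambda>_. 0)"
  by (simp add: finite_density_def density_fun_def)

lemma mass_zero: "mass (\<lambda>_. 0) UNIV = 0"
  using mass_eq_integral[OF finite_density_zero, of UNIV] by simp

text \<open>Among k members of total mass m one has mass at least m / k, and its eigenvalues alone
  bound those of the collection.\<close>

lemma collection_mu_uniformly_bounded:
  assumes k: "k \<ge> 1" and m: "m > 0"
  shows "\<exists>M\<ge>0. \<forall>\<rho> :: ('a::euclidean_space \<Rightarrow> real) list. \<rho> \<in> collections k m \<longrightarrow>
    (\<forall>j\<le>k. collection_mu j \<rho> \<le> ennreal M)"
proof -
  have \<delta>: "m / real k > 0" using k m by simp
  obtain M where M: "M \<ge> 0" "\<And>\<rho> :: 'a \<Rightarrow> real. \<And>l. finite_density \<rho> \<Longrightarrow> m / real k \<le> mass \<rho> UNIV \<Longrightarrow>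
      mass \<rho> UNIV \<le> m \<Longrightarrow> l \<le> k \<Longrightarrow> mu l \<rho> \<le> ennreal M"
    using mu_uniformly_bounded[OF \<delta>, where 'a='a and m=m and k=k] by metis
  have "collection_mu j \<rho> \<le> ennreal M" if \<rho>: "\<rho> \<in> collections k m" and j: "j \<le> k" for \<rho> :: "('a \<Rightarrow> real) list" and j
  proof -
    have "\<exists>i<k. m / real k \<le> mass (\<rho> ! i) UNIV"
    proof (rule ccontr)
      assume "\<not> ?thesis"
      then have "\<forall>i\<in>{..<k}. mass (\<rho> ! i) UNIV < m / real k" by (auto simp: not_le)
      then have "(\<Sum>i<k. mass (\<rho> ! i) UNIV) < (\<Sum>i<k. m / real k)"
        using k by (intro sum_strict_mono) (auto simp: lessThan_empty_iff)
      then show False using \<rho> k by (simp add: collections_def)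
    qed
    then obtain i where i: "i < k" "m / real k \<le> mass (\<rho> ! i) UNIV" by blast
    show ?thesis
    proof (rule collection_mu_le[where D="\<lambda>j. if j = i then Suc k else 0"])
      show "j < (\<Sum>j<length \<rho>. if j = i then Suc k else 0)"
        using \<rho> i(1) j by (simp add: collections_def)
      fix j' l assume "j' < length \<rho>" "l < (if j' = i then Suc k else 0)"
      then have "j' = i" "l \<le> k" by (auto split: if_splits)
      then show "mu l (\<rho> ! j') \<le> ennreal M"
        using M(2)[OF collections_mass_le(1)[OF \<rho> i(1)] i(2) collections_mass_le(2)[OF \<rho> i(1)]] by simp
    qed
  qed
  then show ?thesis using M(1) by blast
qed

proposition collections_limit:
  fixes \<rho> :: "nat \<Rightarrow> ('a::euclidean_space \<Rightarrow> real) list"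
  assumes \<rho>: "\<And>n. \<rho> n \<in> collections k m" and low: "\<And>n. ennreal c \<le> collection_mu k (\<rho> n)" and c: "c > 0"
    and k: "k \<ge> 1" and m: "m > 0"
  shows "\<exists>s. \<exists>\<sigma>\<in>(collections k m :: ('a \<Rightarrow> real) list set). strict_mono s \<and>
    (\<forall>j\<le>k. \<forall>\<epsilon>>0. \<forall>\<^sub>F n in sequentially. collection_mu j (\<rho> (s n)) \<le> collection_mu j \<sigma> + ennreal \<epsilon>)"
proof -
  \<comment> \<open>The possible numbers of profiles are collected over all subsequences at once,
    because gaining a profile costs a further subsequence; the maximum then excludes any
    extension.\<close>
  define W where "W = {P. \<exists>s \<iota> y \<sigma>. strict_mono s \<and> profile_system (\<lambda>n. \<rho> (s n)) k \<iota> y \<sigma> P}"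
  have "W \<subseteq> {..k}"
    using profile_count_le[OF \<rho> low c] by (auto simp: W_def)
  then have fin: "finite W" by (rule finite_subset) simp
  have "profile_system (\<lambda>n. \<rho> (id n)) k (\<lambda>_. 0) (\<lambda>_ _. 0) (\<lambda>_ _. 0) 0" by (simp add: profile_system_def)
  moreover have "strict_mono (id :: nat \<Rightarrow> nat)" by (simp add: strict_mono_def)
  ultimately have "0 \<in> W" unfolding W_def by blast
  define P where "P = Max W"
  have "P \<in> W" unfolding P_def using fin \<open>0 \<in> W\<close> by (intro Max_in) auto
  then obtain s \<iota> y \<sigma> where s: "strict_mono s" and prof: "profile_system (\<lambda>n. \<rho> (s n)) k \<iota> y \<sigma> P"
    unfolding W_def by blast
  have Pk: "P \<le> k" using \<open>P \<in> W\<close> \<open>W \<subseteq> {..k}\<close> by auto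
  have total: "(\<Sum>b<P. mass (\<sigma> b) UNIV) = m"
  proof (rule antisym)
    show "(\<Sum>b<P. mass (\<sigma> b) UNIV) \<le> m" by (rule profile_total_mass_le[OF \<rho> prof])
    show "m \<le> (\<Sum>b<P. mass (\<sigma> b) UNIV)"
    proof (rule ccontr)
      assume "\<not> ?thesis"
      then have "(\<Sum>b<P. mass (\<sigma> b) UNIV) < m" by simp
      from profile_system_extend[OF \<rho> low c prof this]
      obtain s' \<iota>' y' \<sigma>' where s': "strict_mono s'" "profile_system (\<lambda>n. \<rho> (s (s' n))) k \<iota>' y' \<sigma>' (Suc P)"
        by blast
      have "strict_mono (\<lambda>n. s (s' n))" using s s'(1) by (simp add: strict_mono_def)
      then have "Suc P \<in> W" unfolding W_def using s'(2) by blast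
      then have "Suc P \<le> P" unfolding P_def using fin by (intro Max_ge)
      then show False by simp
    qed
  qed
  define \<tau> where "\<tau> = map \<sigma> [0..<P] @ replicate (k - P) (\<lambda>_. 0)"
  have nth: "\<tau> ! i = (if i < P then \<sigma> i else (\<lambda>_. 0))" if "i < k" for i
    using that by (simp add: \<tau>_def nth_append)
  have \<tau>: "\<tau> \<in> collections k m"
    unfolding collections_def
  proof (intro CollectI conjI allI impI)
    show "length \<tau> = k" using Pk by (simp add: \<tau>_def)
    show "finite_density (\<tau> ! i)" if "i < k" for i
      using nth[OF that] prof finite_density_zero by (auto simp: profile_system_def)
    have "(\<Sum>i<k. mass (\<tau> ! i) UNIV) = (\<Sum>i<k. if i < P then mass (\<sigma> i) UNIV else 0)"
      by (intro sum.cong) (auto simp: nth mass_zero)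
    also have "\<dots> = (\<Sum>i<P. mass (\<sigma> i) UNIV)"
      using Pk by (intro sum.mono_neutral_cong_right) auto
    finally show "(\<Sum>i<k. mass (\<tau> ! i) UNIV) = m" using total by simp
  qed
  obtain M where M: "\<And>j. j \<le> k \<Longrightarrow> collection_mu j \<tau> \<le> ennreal M"
    using collection_mu_uniformly_bounded[OF k m, where 'a='a] \<tau> by metis
  have "\<forall>\<^sub>F n in sequentially. collection_mu j (\<rho> (s n)) \<le> collection_mu j \<tau> + ennreal \<epsilon>"
    if j: "j \<le> k" and e: "\<epsilon> > 0" for j \<epsilon>
  proof -
    \<comment> \<open>Finiteness turns the addition of \<epsilon> into a strict increase, as the
      upper semicontinuity statement demands.\<close>
    have "collection_mu j \<tau> < top" using M[OF j] by (rule le_less_trans) simp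
    then obtain z where z: "collection_mu j \<tau> = ennreal z" "z \<ge> 0" by (cases "collection_mu j \<tau>") auto
    have "collection_mu j \<tau> < ennreal (z + \<epsilon>)" unfolding z(1) using z(2) e by (simp add: ennreal_less_iff)
    from collection_mu_upper_semicontinuous[OF \<rho> prof this[unfolded \<tau>_def]]
    show ?thesis unfolding z(1) using z(2) e by (simp add: ennreal_plus)
  qed
  then show ?thesis using s \<tau> by blast
qed

subsection \<open>Existence of a maximizer\<close>

lemma admissible_iff_collections:
  fixes \<rho> :: "('a::euclidean_space \<Rightarrow> real) list"
  assumes m: "m > 0"
  shows "\<rho> \<in> admissible k m \<longleftrightarrow> \<rho> \<in> collections k m"
proof -
  have nn: "(\<integral>\<^sup>+x. ennreal (r x) \<partial>lebesgue) = ennreal (mass r UNIV)" if "finite_density r" for r :: "'a \<Rightarrow> real"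
  proof -
    have "(\<integral>\<^sup>+x. ennreal (r x) \<partial>lebesgue) = ennreal (\<integral>x. r x \<partial>lebesgue)"
      using that by (intro nn_integral_eq_integral) (auto simp: finite_density_def density_fun_def)
    then show ?thesis using mass_eq_integral[OF that, of UNIV] by simp
  qed
  have sl: "(\<Sum>r\<leftarrow>\<rho>. \<integral>\<^sup>+x. ennreal (r x) \<partial>lebesgue) = (\<Sum>i<length \<rho>. \<integral>\<^sup>+x. ennreal ((\<rho> ! i) x) \<partial>lebesgue)"
    by (simp add: sum_list_sum_nth atLeast0LessThan)
  have mass_sum: "(\<Sum>i<length \<rho>. \<integral>\<^sup>+x. ennreal ((\<rho> ! i) x) \<partial>lebesgue) = ennreal (\<Sum>i<length \<rho>. mass (\<rho> ! i) UNIV)"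
    if "\<forall>i<length \<rho>. finite_density (\<rho> ! i)"
    using that nn by (simp add: sum_ennreal)
  show ?thesis
  proof
    assume a: "\<rho> \<in> admissible k m"
    then have len: "length \<rho> = k" and tot: "(\<Sum>i<length \<rho>. \<integral>\<^sup>+x. ennreal ((\<rho> ! i) x) \<partial>lebesgue) = ennreal m"
      and d: "\<And>i. i < length \<rho> \<Longrightarrow> density_fun (\<rho> ! i)"
      unfolding sl[symmetric] by (auto simp: admissible_def density_fun_def)
    have fd: "finite_density (\<rho> ! i)" if i: "i < length \<rho>" for i
    proof -
      have "(\<integral>\<^sup>+x. ennreal ((\<rho> ! i) x) \<partial>lebesgue) \<le> ennreal m"
        unfolding tot[symmetric] using i by (intro member_le_sum) auto
      then have "(\<integral>\<^sup>+x. ennreal ((\<rho> ! i) x) \<partial>lebesgue) < \<infinity>" by (rule le_less_trans) simp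
      then have "integrable lebesgue (\<rho> ! i)"
        using d[OF i] by (intro integrableI_nonneg) (auto simp: density_fun_def)
      then show ?thesis using d[OF i] by (simp add: finite_density_def)
    qed
    have "(\<Sum>i<length \<rho>. mass (\<rho> ! i) UNIV) = m"
      using mass_sum tot fd m by (simp add: sum_nonneg)
    then show "\<rho> \<in> collections k m" using len fd by (simp add: collections_def)
  next
    assume a: "\<rho> \<in> collections k m"
    then have "\<forall>i<length \<rho>. finite_density (\<rho> ! i)" by (simp add: collections_def)
    then have "(\<Sum>r\<leftarrow>\<rho>. \<integral>\<^sup>+x. ennreal (r x) \<partial>lebesgue) = ennreal m"
      unfolding sl using mass_sum a by (simp add: collections_def)
    then show "\<rho> \<in> admissible k m"
      using a by (auto simp: collections_def admissible_def in_set_conv_nth finite_density_def density_fun_def)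
  qed
qed

lemma collections_nonempty:
  assumes k: "k \<ge> 1" and m: "m > 0"
  shows "collections k m \<noteq> ({} :: ('a::euclidean_space \<Rightarrow> real) list set)"
proof -
  define v where "v = unit_ball_vol (DIM('a))"
  have v: "v > 0" by (simp add: v_def)
  \<comment> \<open>With R \<ge> 1 the N-th power of R is at least R, so the ball has volume at
    least m and the constant height m / V does not exceed 1.\<close>
  define R where "R = max 1 (m / v)"
  have R: "R \<ge> 1" "m \<le> v * R" using v by (auto simp: R_def field_simps max_def)
  have "R ^ 1 \<le> R ^ DIM('a)" by (rule power_increasing) (use R in auto)
  then have vR: "m \<le> v * R ^ DIM('a)" using R(2) v by (smt (verit) mult_left_mono power_one_right)
  define V where "V = v * R ^ DIM('a)"
  have V: "V > 0" "m / V \<le> 1" using vR m by (auto simp: V_def)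
  define r :: "'a \<Rightarrow> real" where "r x = m / V * indicator (cball 0 R) x" for x
  have int: "integrable lebesgue (indicator (cball (0::'a) R) :: 'a \<Rightarrow> real)"
    using indicator_cball_L12[of "0::'a" R] by (simp add: L12_def)
  have r: "finite_density r"
  proof -
    have "integrable lebesgue r" unfolding r_def[abs_def] using int by simp
    moreover have "0 \<le> r x \<and> r x \<le> 1" for x using V m by (auto simp: r_def indicator_def)
    ultimately show ?thesis by (simp add: finite_density_def density_fun_def)
  qed
  have mr: "mass r UNIV = m"
  proof -
    have "measure lebesgue (cball (0::'a) R) = V"
      using content_cball[of R "0::'a"] R by (simp add: V_def v_def)
    then have "(\<integral>x. r x \<partial>lebesgue) = m" unfolding r_def using V by simp
    then show ?thesis using mass_eq_integral[OF r, of UNIV] by simp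
  qed
  have "r # replicate (k - 1) (\<lambda>_. 0) \<in> collections k m"
    unfolding collections_def
  proof (intro CollectI conjI allI impI)
    show "length (r # replicate (k - 1) (\<lambda>_. 0)) = k" using k by simp
    show "finite_density ((r # replicate (k - 1) (\<lambda>_. 0)) ! i)" if "i < k" for i
      using that r finite_density_zero by (cases i) auto
    have "(\<Sum>i<k. mass ((r # replicate (k - 1) (\<lambda>_. 0)) ! i) UNIV) = (\<Sum>i<k. if i = 0 then m else 0)"
    proof (rule sum.cong)
      fix i assume "i \<in> {..<k}"
      then show "mass ((r # replicate (k - 1) (\<lambda>_. 0)) ! i) UNIV = (if i = 0 then m else 0)"
        using mr by (cases i) (auto simp: mass_zero)
    qed simp
    then show "(\<Sum>i<k. mass ((r # replicate (k - 1) (\<lambda>_. 0)) ! i) UNIV) = m" using k by simp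
  qed
  then show ?thesis by blast
qed

lemma nondecreasing_each_mono:
  assumes F: "nondecreasing_each k F" and x: "x \<in> orthant k" and z: "z \<in> orthant k"
    and le: "\<And>i. i \<in> {1..k} \<Longrightarrow> x i \<le> z i"
  shows "F x \<le> F z"
proof -
  \<comment> \<open>Coordinates are raised one at a time: \<open>w j\<close> has already moved the
    first \<open>j\<close> of them from \<open>x\<close> to \<open>z\<close>.\<close>
  define w where "w j i = (if i \<in> {1..j} then z i else x i)" for j i
  have wo: "w j \<in> orthant k" if "j \<le> k" for j
    using x z that by (auto simp: orthant_def w_def PiE_iff extensional_def)
  have "F x \<le> F (w j)" if "j \<le> k" for j
    using that
  proof (induction j)
    case 0
    have "w 0 = x" by (auto simp: w_def fun_eq_iff)
    then show ?case by simp
  next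
    case (Suc j)
    have "w (Suc j) = (w j)(Suc j := z (Suc j))" by (auto simp: w_def fun_eq_iff)
    moreover have "w j (Suc j) \<le> z (Suc j)" using le[of "Suc j"] Suc.prems by (simp add: w_def)
    ultimately have "F (w j) \<le> F (w (Suc j))"
      using F wo[of j] Suc.prems unfolding nondecreasing_each_def by auto
    then show ?case using Suc by simp
  qed
  moreover have "w k = z"
    using x z by (auto simp: w_def fun_eq_iff orthant_def PiE_iff extensional_def)
  ultimately show ?thesis by (metis order_refl)
qed

lemma upper_semicontinuous_shift:
  assumes F: "upper_semicontinuous k F" and z: "z \<in> orthant k" and \<eta>: "\<eta> > 0"
  shows "\<exists>\<epsilon>>0. F (\<lambda>i\<in>{1..k}. z i + \<epsilon>) < F z + \<eta>"
proof -
  \<comment> \<open>A continuous curve through \<open>z\<close> along the diagonal; the absolute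
    value keeps it in the orthant for negative parameters, so the preimage is open in the whole
    line.\<close>
  define \<gamma> where "\<gamma> e = (\<lambda>i\<in>{1..k}. z i + \<bar>e\<bar>)" for e :: real
  have z0: "0 \<le> z i" if "i \<in> {1..k}" for i using z that by (auto simp: orthant_def)
  have "continuous_map euclideanreal (orthant_topology k) \<gamma>"
    unfolding orthant_topology_def continuous_map_componentwise
  proof (intro conjI ballI)
    show "\<gamma> ` topspace euclideanreal \<subseteq> extensional {1..k}" by (auto simp: \<gamma>_def)
    fix i assume i: "i \<in> {1..k}"
    have "continuous_on UNIV (\<lambda>e. z i + \<bar>e\<bar>)" by (intro continuous_intros)
    then show "continuous_map euclideanreal (top_of_set {0..}) (\<lambda>e. \<gamma> e i)"
      using i z0[OF i] by (auto simp: continuous_map_in_subtopology \<gamma>_def)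
  qed
  moreover have "openin (orthant_topology k) {x \<in> orthant k. F x < F z + \<eta>}"
    using F by (simp add: upper_semicontinuous_def)
  ultimately have "openin euclideanreal {e \<in> topspace euclideanreal. \<gamma> e \<in> {x \<in> orthant k. F x < F z + \<eta>}}"
    by (rule openin_continuous_map_preimage)
  then have op: "open {e. \<gamma> e \<in> {x \<in> orthant k. F x < F z + \<eta>}}" by simp
  have "\<gamma> 0 = z"
    using z by (auto simp: \<gamma>_def orthant_def PiE_iff extensional_def fun_eq_iff)
  then have "0 \<in> {e. \<gamma> e \<in> {x \<in> orthant k. F x < F z + \<eta>}}" using z \<eta> by simp
  with op obtain d where d: "d > 0" "ball 0 d \<subseteq> {e. \<gamma> e \<in> {x \<in> orthant k. F x < F z + \<eta>}}"
    unfolding open_contains_ball by blast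
  have "d / 2 \<in> ball 0 d" using d(1) by simp
  then have "F (\<gamma> (d / 2)) < F z + \<eta>" using d(2) by blast
  then show ?thesis using d(1) by (intro exI[of _ "d / 2"]) (simp add: \<gamma>_def)
qed

lemma spectrum_vector_orthant: "spectrum_vector k \<rho> \<in> orthant k"
  by (auto simp: spectrum_vector_def orthant_def)

theorem mainTheorem6:
  fixes k :: nat and m :: real and F :: "(nat \<Rightarrow> real) \<Rightarrow> real"
  assumes "k \<ge> 1" and "m > 0"
    and "upper_semicontinuous k F" and "nondecreasing_each k F"
  shows "\<exists>\<rho> \<in> (admissible k m :: (real ^ 'n \<Rightarrow> real) list set).
           \<forall>\<sigma> \<in> (admissible k m :: (real ^ 'n \<Rightarrow> real) list set).
             F (spectrum_vector k \<sigma>) \<le> F (spectrum_vector k \<rho>)"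
proof -
  define A where "A = (collections k m :: (real ^ 'n \<Rightarrow> real) list set)"
  define x where "x = (\<lambda>\<rho> :: (real ^ 'n \<Rightarrow> real) list. spectrum_vector k \<rho>)"
  have xo: "x \<rho> \<in> orthant k" for \<rho> by (simp add: x_def spectrum_vector_orthant)
  have xi: "x \<rho> i = enn2real (collection_mu i \<rho>)" if "i \<in> {1..k}" for \<rho> i
    using that by (simp add: x_def spectrum_vector_def)
  obtain M where M: "M \<ge> 0" "\<And>\<rho> j. \<rho> \<in> A \<Longrightarrow> j \<le> k \<Longrightarrow> collection_mu j \<rho> \<le> ennreal M"
    using collection_mu_uniformly_bounded[OF assms(1,2), where 'a="real ^ 'n"] unfolding A_def by metis
  have FM: "F (x \<rho>) \<le> F (\<lambda>i\<in>{1..k}. M)" if "\<rho> \<in> A" for \<rho>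
  proof (rule nondecreasing_each_mono[OF assms(4) xo])
    show "(\<lambda>i\<in>{1..k}. M) \<in> orthant k" using M(1) by (auto simp: orthant_def)
    show "x \<rho> i \<le> (\<lambda>i\<in>{1..k}. M) i" if "i \<in> {1..k}" for i
      using that xi M(1) M(2)[OF \<open>\<rho> \<in> A\<close>, of i] by (simp add: enn2real_leI)
  qed
  let ?V = "(\<lambda>\<rho>. F (x \<rho>)) ` A"
  have ne: "?V \<noteq> {}" using collections_nonempty[OF assms(1,2), where 'a="real ^ 'n"] by (simp add: A_def)
  have bdd: "bdd_above ?V" by (rule bdd_aboveI2) (rule FM)
  define S where "S = Sup ?V"
  have "\<exists>\<rho>\<in>A. S - 1 / real (Suc n) < F (x \<rho>)" for n
  proof -
    have "S - 1 / real (Suc n) < Sup ?V" by (simp add: S_def)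
    from less_cSupD[OF ne this] show ?thesis by auto
  qed
  then obtain \<rho> where \<rho>: "\<And>n. \<rho> n \<in> A" "\<And>n. S - 1 / real (Suc n) < F (x (\<rho> n))" by metis
  \<comment> \<open>Eventually the spectrum vectors lie below that of \<sigma> shifted by
    \<epsilon>, so monotonicity bounds \<open>F\<close> by its value at the shifted vector, and
    upper semicontinuity brings this within \<eta> of F (x \<sigma>).\<close>
  have limit: "S \<le> F (x \<sigma>)"
    if r: "\<And>n. n \<le> r n" and ev: "\<And>i \<epsilon>. i \<in> {1..k} \<Longrightarrow> \<epsilon> > 0 \<Longrightarrow> \<forall>\<^sub>F n in sequentially. x (\<rho> (r n)) i \<le> x \<sigma> i + \<epsilon>"
    for r :: "nat \<Rightarrow> nat" and \<sigma>
  proof (rule field_le_epsilon)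
    fix \<eta> :: real assume "\<eta> > 0"
    then obtain \<epsilon> where \<epsilon>: "\<epsilon> > 0" "F (\<lambda>i\<in>{1..k}. x \<sigma> i + \<epsilon>) < F (x \<sigma>) + \<eta>"
      using upper_semicontinuous_shift[OF assms(3) xo] by blast
    have zo: "(\<lambda>i\<in>{1..k}. x \<sigma> i + \<epsilon>) \<in> orthant k"
      using xo[of \<sigma>] \<epsilon>(1) by (auto simp: orthant_def PiE_iff intro: add_nonneg_nonneg)
    have "\<forall>\<^sub>F n in sequentially. \<forall>i\<in>{1..k}. x (\<rho> (r n)) i \<le> x \<sigma> i + \<epsilon>"
      by (intro eventually_ball_finite ballI ev \<epsilon>(1)) auto
    then have "\<forall>\<^sub>F n in sequentially. S - 1 / real (Suc n) \<le> F (x \<sigma>) + \<eta>"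
    proof eventually_elim
      case (elim n)
      have "1 / real (Suc (r n)) \<le> 1 / real (Suc n)" using r[of n] by (intro divide_left_mono) auto
      moreover have "F (x (\<rho> (r n))) \<le> F (\<lambda>i\<in>{1..k}. x \<sigma> i + \<epsilon>)"
        by (rule nondecreasing_each_mono[OF assms(4) xo zo]) (use elim in simp)
      ultimately show ?case using \<rho>(2)[of "r n"] \<epsilon>(2) by linarith
    qed
    moreover have "(\<lambda>n. S - 1 / real (Suc n)) \<longlonglongrightarrow> S - 0"
      by (intro tendsto_intros LIMSEQ_Suc[OF lim_1_over_n])
    ultimately show "S \<le> F (x \<sigma>) + \<eta>"
      by (intro LIMSEQ_le_const2[of "\<lambda>n. S - 1 / real (Suc n)"]) (simp_all add: eventually_sequentially)
  qed
  have "\<exists>\<sigma>\<in>A. S \<le> F (x \<sigma>)"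
  proof (cases "\<exists>c>0. \<exists>N. \<forall>n\<ge>N. ennreal c \<le> collection_mu k (\<rho> n)")
    case True
    then obtain c N where c: "c > 0" "\<And>n. n \<ge> N \<Longrightarrow> ennreal c \<le> collection_mu k (\<rho> n)" by blast
    have "\<rho> (n + N) \<in> collections k m" "ennreal c \<le> collection_mu k (\<rho> (n + N))" for n
      using \<rho>(1) c(2) by (auto simp: A_def)
    from collections_limit[of "\<lambda>n. \<rho> (n + N)", OF this c(1) assms(1,2)]
    obtain s \<sigma> where \<sigma>: "\<sigma> \<in> A" and s: "strict_mono s"
      and ev: "\<And>j \<epsilon>. j \<le> k \<Longrightarrow> \<epsilon> > 0 \<Longrightarrow>
        \<forall>\<^sub>F n in sequentially. collection_mu j (\<rho> (s n + N)) \<le> collection_mu j \<sigma> + ennreal \<epsilon>"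
      unfolding A_def by blast
    have "S \<le> F (x \<sigma>)"
    proof (rule limit[of "\<lambda>n. s n + N"])
      show "n \<le> s n + N" for n using seq_suble[OF s, of n] by simp
      fix i \<epsilon> assume i: "i \<in> {1..k}" and e: "(\<epsilon> :: real) > 0"
      have fin: "collection_mu i \<tau> < top" if "\<tau> \<in> A" for \<tau>
        using M(2)[OF that, of i] i by (auto intro: le_less_trans)
      have "i \<le> k" using i by simp
      from ev[OF this e] show "\<forall>\<^sub>F n in sequentially. x (\<rho> (s n + N)) i \<le> x \<sigma> i + \<epsilon>"
      proof eventually_elim
        case (elim n)
        then have "enn2real (collection_mu i (\<rho> (s n + N))) \<le> enn2real (collection_mu i \<sigma> + ennreal \<epsilon>)"
          using fin[OF \<sigma>] by (intro enn2real_mono) (auto simp: less_top)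
        also have "\<dots> = enn2real (collection_mu i \<sigma>) + \<epsilon>"
          using fin[OF \<sigma>] e by (subst enn2real_plus) auto
        finally show ?case using xi[OF i] by simp
      qed
    qed
    then show ?thesis using \<sigma> by blast
  next
    case False
    then have small: "\<exists>n\<ge>N. collection_mu k (\<rho> n) < ennreal c" if "c > 0" for c N
      using that by (meson linorder_not_le)
    have "\<exists>r. \<forall>n. collection_mu k (\<rho> (r n)) < ennreal (1 / real (Suc n)) \<and> r n < r (Suc n)"
    proof (rule dependent_nat_choice)
      show "\<exists>n. collection_mu k (\<rho> n) < ennreal (1 / real (Suc 0))" using small[of 1 0] by auto
      show "\<exists>n'. collection_mu k (\<rho> n') < ennreal (1 / real (Suc (Suc l))) \<and> n < n'" for n l
        using small[of "1 / real (Suc (Suc l))" "Suc n"] by (auto simp: Suc_le_eq)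
    qed
    then obtain r where r: "\<And>n. collection_mu k (\<rho> (r n)) < ennreal (1 / real (Suc n))" "\<And>n. r n < r (Suc n)"
      by blast
    have rm: "strict_mono r" using r(2) by (simp add: strict_mono_Suc_iff)
    \<comment> \<open>Along \<open>r\<close> the entries 1 to k are all at most the k-th and tend to
      0, while every spectrum vector is nonnegative. Any collection dominates such a limit;
      \<open>\<rho> 0\<close> is simply at hand.\<close>
    have "S \<le> F (x (\<rho> 0))"
    proof (rule limit[of r])
      show "n \<le> r n" for n by (rule seq_suble[OF rm])
      fix i \<epsilon> assume i: "i \<in> {1..k}" and e: "(\<epsilon> :: real) > 0"
      have "\<forall>\<^sub>F n in sequentially. 1 / real (Suc n) < \<epsilon>"
        by (rule order_tendstoD(2)[OF LIMSEQ_Suc[OF lim_1_over_n] e])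
      then show "\<forall>\<^sub>F n in sequentially. x (\<rho> (r n)) i \<le> x (\<rho> 0) i + \<epsilon>"
      proof eventually_elim
        case (elim n)
        have "collection_mu i (\<rho> (r n)) \<le> collection_mu k (\<rho> (r n))"
          by (rule collection_mu_mono) (use i in simp)
        also have "\<dots> \<le> ennreal (1 / real (Suc n))" using r(1)[of n] by (rule less_imp_le)
        finally have "x (\<rho> (r n)) i \<le> 1 / real (Suc n)" unfolding xi[OF i] by (intro enn2real_leI) auto
        moreover have "0 \<le> x (\<rho> 0) i" unfolding xi[OF i] by simp
        ultimately show ?case using elim by linarith
      qed
    qed
    then show ?thesis using \<rho>(1) by blast
  qed
  then obtain \<sigma> where \<sigma>: "\<sigma> \<in> A" "S \<le> F (x \<sigma>)" by blast
  have "F (x \<tau>) \<le> F (x \<sigma>)" if "\<tau> \<in> A" for \<tau>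
    using cSup_upper[OF _ bdd, of "F (x \<tau>)"] that \<sigma>(2) by (auto simp: S_def)
  then show ?thesis
    using \<sigma>(1) admissible_iff_collections[OF assms(2), where 'a="real ^ 'n"] unfolding A_def x_def by blast
qed

end
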